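(* Let $G$ be a finite group, let $\alpha$ be a finite-dimensional orthogonal $G$-representation and let $\epsilon$ be a $1$-dimensional $G$-representation. Then corresponding to every 1-morphism $E:\mathfrak J_G\to\mathfrak T_G$ in $\mathbf{Fun}(\mathcal O_G^{op},\mathrm{Cat})$ there exists a 1-morphism $\mathbf T_{(\alpha,\epsilon)}E:\mathfrak J_G\to\mathfrak T_G$, called the $\alpha$-th Taylor approximation of $E$ in the direction of $\epsilon$ (given by the formula in the context), together with 2-morphisms (i) $\eta^E_{\alpha,\epsilon}:E\to\mathbf T_{(\alpha,\epsilon)}E$, (ii) $\eta^E_{\alpha,\alpha',\epsilon}:\mathbf T_{(\alpha,\epsilon)}E\to\mathbf T_{(\alpha',\epsilon)}E$ for a sub-representation $\alpha'\subset\alpha$, such that $\eta^E_{\alpha',\epsilon}=\eta^E_{\alpha,\alpha',\epsilon}\circ\eta^E_{\alpha,\epsilon}$ and $\eta^E_{\alpha',\alpha'',\epsilon}\circ\eta^E_{\alpha,\alpha',\epsilon}=\eta^E_{\alpha,\alpha'',\epsilon}$ whenever $\alpha''\subset\alpha'\subset\alpha$ as $G$-representations.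
   Context: $G$ is a finite group, $\mathcal O_G$ its orbit category, $\mathrm{Cat}$ the category of small categories. For $H\le G$, $\mathcal U_H$ is a complete $H$-universe and $\mathrm{Rep}_H$ is the category of finite-dimensional orthogonal $H$-representations in $\mathcal U_H$, whose morphism space $\mathrm{Mor}_H(U,V)$ is the $H$-space of linear isometric embeddings $U\to V$, with $H$ acting by conjugation. $H\mathrm{Top}_*$ is the category of pointed $H$-spaces; $\iota_K$ denotes restriction to a subgroup $K$; $|V|$ is the real dimension of $V$. $\mathfrak J_G,\mathfrak T_G:\mathcal O_G^{op}\to\mathrm{Cat}$ are the presheaves $G/H\mapsto\mathrm{Rep}_H$ and $G/H\mapsto H\mathrm{Top}_*$. A 1-morphism $E:\mathfrak J_G\to\mathfrak T_G$ (a "$G$-equivariant Weiss functor") is a natural transformation: it consists of functors $E_{G/H}:\mathrm{Rep}_H\to H\mathrm{Top}_*$, one for each subgroup $H\le G$, compatible with restriction to subgroups (up to conjugation in $G$). A 2-morphism $E\to F$ is a family of natural transformations $E_{G/H}\to F_{G/H}$ compatible with restrictions. For $W\in\mathrm{Rep}_H$, $\mathscr V(W)$ is the $H$-category whose objects are the sub-vector spaces of $W$ (not necessarily $H$-invariant) and whose morphisms are linear isometries (not necessarily surjective); $\mathscr V^\circ(W)$, also written $\mathscr V^\circ_H(W)$, is its full subcategory of nonzero vector spaces. $\mathscr V_H$ is the $H$-category of finite-dimensional sub-vector spaces of $\mathcal U_H$, in which morphisms are linear isometries, and $\widehat E_{G/H}:\mathscr V_H\to H\mathrm{Top}_*$ is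 the right Kan extension of $E_{G/H}$ along $\mathrm{Rep}_H\hookrightarrow\mathscr V_H$. For $\alpha\in\mathrm{Rep}_G$ define $\tau_\alpha E:\mathfrak J_G\to\mathfrak T_G$ by $$(\tau_\alpha E)_{G/H}(W)=\operatorname{holim}_{U\in\mathscr V^\circ_H(\iota_H\alpha)}\widehat E_{G/H}(W\oplus U),\qquad W\in\mathrm{Rep}_H.$$ The homotopy limit of a functor $F$ on an $H$-category $\mathcal C$ is the totalization of the cosimplicial object $[n]\mapsto\prod_{c_0\to\cdots\to c_n}F(c_n)$, with $h\in H$ acting by $h^{-1}\cdot\prod_{c_0\to\cdots\to c_n}F(c_n)=\prod_{hc_0\to\cdots\to hc_n}h^{-1}\cdot F(hc_n)$. There are natural maps $E_{G/H}(W)\to(\tau_\alpha E)_{G/H}(W)$, which assemble to a 2-morphism $\eta^E_\alpha:E\to\tau_\alpha E$. Put $\tau_\alpha^{(n)}E=\tau_\alpha(\tau_\alpha^{(n-1)}E)$. For $|\epsilon|=1$ the $\alpha$-th Taylor approximation of $E$ in the direction of $\epsilon$ is $$(\mathbf T_{(\alpha,\epsilon)}E)_{G/H}(W)=\operatorname{hocolim}_{n\in\mathbb N}(\tau^{(n)}_{\alpha\oplus\epsilon}E)_{G/H}(W),$$ with transition maps obtained by applying $\tau^{(n)}_{\alpha\oplus\epsilon}$ to $\eta^E_{\alpha\oplus\epsilon}$. *)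

theory Defs
  imports "HOL-Analysis.Analysis" "HOL-Algebra.Group" "HOL-Homology.Simplices"
begin

section \<open>Topologies on sets of maps, and quotient topologies\<close>

definition cmaps :: "'a topology \<Rightarrow> 'b topology \<Rightarrow> ('a \<Rightarrow> 'b) set" where
  "cmaps X Y = {f \<in> extensional (topspace X). continuous_map X Y f}"

definition compact_open_topology :: "'a topology \<Rightarrow> 'b topology \<Rightarrow> ('a \<Rightarrow> 'b) topology" where
  "compact_open_topology X Y =
     topology_generated_by
       {{f \<in> cmaps X Y. f ` C \<subseteq> V} | C V. compactin X C \<and> openin Y V}"

lemma topspace_compact_open_topology [simp]: "topspace (compact_open_topology X Y) = cmaps X Y"
proof -
  have "cmaps X Y \<in> {{f \<in> cmaps X Y. f ` C \<subseteq> V} | C V. compactin X C \<and> openin Y V}"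
    by (rule CollectI, rule exI [of _ "{}"], rule exI [of _ "{}"]) auto
  then show ?thesis
    unfolding compact_open_topology_def topology_generated_by_topspace by blast
qed

definition quotient_topology :: "'a topology \<Rightarrow> ('a \<Rightarrow> 'b) \<Rightarrow> 'b topology" where
  "quotient_topology X q =
     topology (\<lambda>S. S \<subseteq> q ` topspace X \<and> openin X {x \<in> topspace X. q x \<in> S})"

lemma openin_quotient_topology:
  "openin (quotient_topology X q) S \<longleftrightarrow>
     S \<subseteq> q ` topspace X \<and> openin X {x \<in> topspace X. q x \<in> S}"
proof -
  have "istopology (\<lambda>S. S \<subseteq> q ` topspace X \<and> openin X {x \<in> topspace X. q x \<in> S})"
    unfolding istopology_def
  proof (intro conjI allI impI)
    fix S T
    assume "S \<subseteq> q ` topspace X \<and> openin X {x \<in> topspace X. q x \<in> S}"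
      and "T \<subseteq> q ` topspace X \<and> openin X {x \<in> topspace X. q x \<in> T}"
    moreover have "{x \<in> topspace X. q x \<in> S \<inter> T} =
        {x \<in> topspace X. q x \<in> S} \<inter> {x \<in> topspace X. q x \<in> T}" by blast
    ultimately show "S \<inter> T \<subseteq> q ` topspace X" "openin X {x \<in> topspace X. q x \<in> S \<inter> T}"
      by auto
  next
    fix K
    assume K: "\<forall>S\<in>K. S \<subseteq> q ` topspace X \<and> openin X {x \<in> topspace X. q x \<in> S}"
    then show "\<Union>K \<subseteq> q ` topspace X" by blast
    have "{x \<in> topspace X. q x \<in> \<Union>K} = (\<Union>S\<in>K. {x \<in> topspace X. q x \<in> S})" by blast
    with K show "openin X {x \<in> topspace X. q x \<in> \<Union>K}" by auto
  qed
  then show ?thesis by (simp add: quotient_topology_def)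
qed

lemma quotient_map_quotient_topology: "quotient_map X (quotient_topology X q) q"
proof -
  have "openin (quotient_topology X q) (q ` topspace X)"
  proof -
    have "{x \<in> topspace X. q x \<in> q ` topspace X} = topspace X" by blast
    then show ?thesis by (simp add: openin_quotient_topology)
  qed
  then have "topspace (quotient_topology X q) = q ` topspace X"
    using openin_quotient_topology [of X q "topspace (quotient_topology X q)"]
    by (auto dest: openin_subset)
  then show ?thesis by (auto simp: quotient_map_def openin_quotient_topology)
qed


section \<open>Orthogonal representations and linear isometries\<close>

definition fin_dim :: "'a::real_vector set \<Rightarrow> bool" where
  "fin_dim V \<longleftrightarrow> (\<exists>B. finite B \<and> span B = V)"

text \<open>Linear isometric embeddings between subspaces; they are extensional, so that two of them are
  equal as soon as they agree on their domain.\<close>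

definition Mor :: "'a::real_inner set \<Rightarrow> 'b::real_inner set \<Rightarrow> ('a \<Rightarrow> 'b) set" where
  "Mor X Y = {f \<in> X \<rightarrow>\<^sub>E Y.
     (\<forall>x\<in>X. \<forall>y\<in>X. \<forall>a b. f (a *\<^sub>R x + b *\<^sub>R y) = a *\<^sub>R f x + b *\<^sub>R f y) \<and>
     (\<forall>x\<in>X. norm (f x) = norm x)}"

text \<open>The topology of pointwise convergence, which on linear maps out of a finite-dimensional space
  is the usual (norm) topology.\<close>

definition Mor_top :: "'a::real_inner set \<Rightarrow> 'b::real_inner set \<Rightarrow> ('a \<Rightarrow> 'b) topology" where
  "Mor_top X Y = subtopology (product_topology (\<lambda>_. euclidean) X) (Mor X Y)"

record ('g, 'a) rep =
  rspace :: "'a set"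
  ract :: "'g \<Rightarrow> 'a \<Rightarrow> 'a"

definition orthogonal_rep :: "('g, 'm) monoid_scheme \<Rightarrow> ('g, 'a::real_inner) rep \<Rightarrow> bool" where
  "orthogonal_rep G P \<longleftrightarrow>
     subspace (rspace P) \<and>
     (\<forall>g\<in>carrier G. restrict (ract P g) (rspace P) \<in> Mor (rspace P) (rspace P)) \<and>
     (\<forall>x\<in>rspace P. ract P \<one>\<^bsub>G\<^esub> x = x) \<and>
     (\<forall>g\<in>carrier G. \<forall>h\<in>carrier G. \<forall>x\<in>rspace P.
        ract P (g \<otimes>\<^bsub>G\<^esub> h) x = ract P g (ract P h x))"

definition finite_rep :: "('g, 'm) monoid_scheme \<Rightarrow> ('g, 'a::real_inner) rep \<Rightarrow> bool" where
  "finite_rep G P \<longleftrightarrow> orthogonal_rep G P \<and> fin_dim (rspace P)"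

definition subrep ::
  "('g, 'm) monoid_scheme \<Rightarrow> ('g, 'a::real_inner) rep \<Rightarrow> ('g, 'a) rep \<Rightarrow> bool" where
  "subrep G Q P \<longleftrightarrow>
     orthogonal_rep G P \<and> orthogonal_rep G Q \<and> rspace Q \<subseteq> rspace P \<and>
     (\<forall>g\<in>carrier G. \<forall>x\<in>rspace Q. ract Q g x = ract P g x)"

definition rep_sum :: "('g, 'a) rep \<Rightarrow> ('g, 'b) rep \<Rightarrow> ('g, 'a \<times> 'b) rep" (infixr "\<oplus>\<^sub>r" 65) where
  "P \<oplus>\<^sub>r Q =
     \<lparr>rspace = rspace P \<times> rspace Q, ract = (\<lambda>g. map_prod (ract P g) (ract Q g))\<rparr>"

text \<open>The conjugation \<open>a \<circ> f \<circ> a\<inverse> : aX \<rightarrow> aY\<close> of a map \<open>f : X \<rightarrow> Y\<close>.\<close>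

definition conj_map ::
  "('g, 'm) monoid_scheme \<Rightarrow> ('g, 'a) rep \<Rightarrow> ('g, 'b) rep \<Rightarrow> 'g \<Rightarrow> 'a set \<Rightarrow> ('a \<Rightarrow> 'b) \<Rightarrow> 'a \<Rightarrow> 'b"
  where
  "conj_map G P Q a X f = (\<lambda>x\<in>ract P a ` X. ract Q a (f (ract P (inv\<^bsub>G\<^esub> a) x)))"

definition orthogonal_matrix_rep ::
  "('g, 'm) monoid_scheme \<Rightarrow> nat \<Rightarrow> ('g \<Rightarrow> nat \<Rightarrow> nat \<Rightarrow> real) \<Rightarrow> bool" where
  "orthogonal_matrix_rep G n M \<longleftrightarrow>
     (\<forall>g\<in>carrier G. \<forall>i<n. \<forall>j<n. (\<Sum>k<n. M g k i * M g k j) = (if i = j then 1 else 0)) \<and>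
     (\<forall>g\<in>carrier G. \<forall>h\<in>carrier G. \<forall>i<n. \<forall>j<n.
        M (g \<otimes>\<^bsub>G\<^esub> h) i j = (\<Sum>k<n. M g i k * M h k j))"

text \<open>A complete universe has countable dimension and contains countably many mutually orthogonal
  copies of every finite-dimensional orthogonal representation; \<open>e k 0, \<dots>, e k (n - 1)\<close> below is the
  basis of the \<open>k\<close>-th copy.\<close>

definition complete_universe ::
  "('g, 'm) monoid_scheme \<Rightarrow> ('g, 'v::real_inner) rep \<Rightarrow> bool" where
  "complete_universe G \<U> \<longleftrightarrow>
     orthogonal_rep G \<U> \<and>
     (\<exists>B. countable B \<and> span B = rspace \<U>) \<and>
     (\<forall>n M. orthogonal_matrix_rep G n M \<longrightarrow>
        (\<exists>e :: nat \<Rightarrow> nat \<Rightarrow> 'v.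
           (\<forall>k. \<forall>i<n. e k i \<in> rspace \<U>) \<and>
           (\<forall>k l. \<forall>i<n. \<forall>j<n. inner (e k i) (e l j) = (if k = l \<and> i = j then 1 else 0)) \<and>
           (\<forall>g\<in>carrier G. \<forall>k. \<forall>j<n. ract \<U> g (e k j) = (\<Sum>i<n. M g i j *\<^sub>R e k i))))"

text \<open>Objects of \<open>Rep\<^sub>H\<close>. The \<open>H\<close>-universe is the restriction to \<open>H\<close> of one complete \<open>G\<close>-universe
  (which is again complete), so that for \<open>K \<le> H\<close> an object of \<open>Rep\<^sub>H\<close> is an object of \<open>Rep\<^sub>K\<close>.\<close>

definition Rep :: "('g, 'v::real_inner) rep \<Rightarrow> 'g set \<Rightarrow> 'v set set" where
  "Rep \<U> H = {W. subspace W \<and> fin_dim W \<and> W \<subseteq> rspace \<U> \<and> (\<forall>h\<in>H. ract \<U> h ` W \<subseteq> W)}"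


section \<open>Pointed spaces with action, 1-morphisms and 2-morphisms\<close>

record ('g, 'p) gspace =
  tp :: "'p topology"
  pt0 :: 'p
  act :: "'g \<Rightarrow> 'p \<Rightarrow> 'p"

definition pointed_gspace ::
  "('g, 'm) monoid_scheme \<Rightarrow> 'g set \<Rightarrow> ('g, 'p) gspace \<Rightarrow> bool" where
  "pointed_gspace G H X \<longleftrightarrow>
     pt0 X \<in> topspace (tp X) \<and>
     (\<forall>h\<in>H. continuous_map (tp X) (tp X) (act X h) \<and> act X h (pt0 X) = pt0 X) \<and>
     (\<forall>x\<in>topspace (tp X). act X \<one>\<^bsub>G\<^esub> x = x) \<and>
     (\<forall>h\<in>H. \<forall>k\<in>H. \<forall>x\<in>topspace (tp X). act X (h \<otimes>\<^bsub>G\<^esub> k) x = act X h (act X k x))"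

text \<open>The data of a 1-morphism \<open>E : J\<^sub>G \<rightarrow> T\<^sub>G\<close>:
  \<^item> \<open>obj E H W\<close> is the pointed \<open>H\<close>-space \<open>E\<^bsub>G/H\<^esub>(W)\<close>;
  \<^item> \<open>mor E H W W' f : E\<^bsub>G/H\<^esub>(W) \<rightarrow> E\<^bsub>G/H\<^esub>(W')\<close> for a linear isometric embedding \<open>f : W \<rightarrow> W'\<close>;
  \<^item> \<open>cmp E a K H V : E\<^bsub>G/K\<^esub>(V) \<rightarrow> E\<^bsub>G/H\<^esub>(aV)\<close>, for \<open>aKa\<inverse> \<le> H\<close> and \<open>aV \<in> Rep\<^sub>H\<close>, is the comparison
    with restriction and conjugation along the map \<open>G/K \<rightarrow> G/H\<close>, \<open>xK \<mapsto> xa\<inverse>H\<close>. For \<open>a = 1\<close> it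
    identifies \<open>E\<^bsub>G/K\<^esub>(\<iota>\<^sub>K W)\<close> with \<open>\<iota>\<^sub>K E\<^bsub>G/H\<^esub>(W)\<close>.\<close>

record ('g, 'v, 'p) weiss =
  obj :: "'g set \<Rightarrow> 'v set \<Rightarrow> ('g, 'p) gspace"
  mor :: "'g set \<Rightarrow> 'v set \<Rightarrow> 'v set \<Rightarrow> ('v \<Rightarrow> 'v) \<Rightarrow> 'p \<Rightarrow> 'p"
  cmp :: "'g \<Rightarrow> 'g set \<Rightarrow> 'g set \<Rightarrow> 'v set \<Rightarrow> 'p \<Rightarrow> 'p"

definition orbit_map :: "('g, 'm) monoid_scheme \<Rightarrow> 'g \<Rightarrow> 'g set \<Rightarrow> 'g set \<Rightarrow> bool" where
  "orbit_map G a K H \<longleftrightarrow>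
     a \<in> carrier G \<and> subgroup K G \<and> subgroup H G \<and> (\<forall>k\<in>K. a \<otimes>\<^bsub>G\<^esub> k \<otimes>\<^bsub>G\<^esub> inv\<^bsub>G\<^esub> a \<in> H)"

text \<open>A functor \<open>Rep\<^sub>H \<rightarrow> HTop\<^sub>*\<close> enriched in \<open>H\<close>-spaces. As the spaces \<open>Mor W W'\<close> are compact
  Hausdorff, continuity on morphism spaces is joint continuity of the evaluation.\<close>

definition enriched_functor ::
  "('g, 'm) monoid_scheme \<Rightarrow> ('g, 'v::real_inner) rep \<Rightarrow> 'g set
     \<Rightarrow> ('v set \<Rightarrow> ('g, 'p) gspace) \<Rightarrow> ('v set \<Rightarrow> 'v set \<Rightarrow> ('v \<Rightarrow> 'v) \<Rightarrow> 'p \<Rightarrow> 'p) \<Rightarrow> bool" where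
  "enriched_functor G \<U> H F Fm \<longleftrightarrow>
     (\<forall>W\<in>Rep \<U> H. pointed_gspace G H (F W)) \<and>
     (\<forall>W\<in>Rep \<U> H. \<forall>W'\<in>Rep \<U> H.
        continuous_map (prod_topology (Mor_top W W') (tp (F W))) (tp (F W'))
          (\<lambda>(f, x). Fm W W' f x) \<and>
        (\<forall>f\<in>Mor W W'. Fm W W' f (pt0 (F W)) = pt0 (F W')) \<and>
        (\<forall>h\<in>H. \<forall>f\<in>Mor W W'. \<forall>x\<in>topspace (tp (F W)).
           Fm W W' (conj_map G \<U> \<U> h W f) (act (F W) h x) = act (F W') h (Fm W W' f x))) \<and>
     (\<forall>W\<in>Rep \<U> H. \<forall>x\<in>topspace (tp (F W)). Fm W W (\<lambda>w\<in>W. w) x = x) \<and>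
     (\<forall>W\<in>Rep \<U> H. \<forall>W'\<in>Rep \<U> H. \<forall>W''\<in>Rep \<U> H. \<forall>f\<in>Mor W W'. \<forall>g\<in>Mor W' W''.
        \<forall>x\<in>topspace (tp (F W)). Fm W W'' (compose W g f) x = Fm W' W'' g (Fm W W' f x))"

text \<open>The comparison maps are homeomorphisms, natural and functorial in the map of orbits. Since
  \<open>h \<in> H\<close> represents the identity of \<open>G/H\<close> but acts on \<open>Rep\<^sub>H\<close> and \<open>HTop\<^sub>*\<close> by conjugating
  morphisms, naturality cannot be a strict equality: the comparison for \<open>h\<close> is the action of \<open>h\<close>.\<close>

definition one_morphism ::
  "('g, 'm) monoid_scheme \<Rightarrow> ('g, 'v::real_inner) rep \<Rightarrow> ('g, 'v, 'p) weiss \<Rightarrow> bool" where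
  "one_morphism G \<U> E \<longleftrightarrow>
     (\<forall>H. subgroup H G \<longrightarrow> enriched_functor G \<U> H (obj E H) (mor E H)) \<and>
     (\<forall>a K H V. orbit_map G a K H \<and> V \<in> Rep \<U> K \<and> ract \<U> a ` V \<in> Rep \<U> H \<longrightarrow>
        homeomorphic_map (tp (obj E K V)) (tp (obj E H (ract \<U> a ` V))) (cmp E a K H V) \<and>
        cmp E a K H V (pt0 (obj E K V)) = pt0 (obj E H (ract \<U> a ` V)) \<and>
        (\<forall>k\<in>K. \<forall>x\<in>topspace (tp (obj E K V)).
           cmp E a K H V (act (obj E K V) k x) =
           act (obj E H (ract \<U> a ` V)) (a \<otimes>\<^bsub>G\<^esub> k \<otimes>\<^bsub>G\<^esub> inv\<^bsub>G\<^esub> a) (cmp E a K H V x))) \<and>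
     (\<forall>a K H V V'. orbit_map G a K H \<and> V \<in> Rep \<U> K \<and> V' \<in> Rep \<U> K \<and>
        ract \<U> a ` V \<in> Rep \<U> H \<and> ract \<U> a ` V' \<in> Rep \<U> H \<longrightarrow>
        (\<forall>f\<in>Mor V V'. \<forall>x\<in>topspace (tp (obj E K V)).
           cmp E a K H V' (mor E K V V' f x) =
           mor E H (ract \<U> a ` V) (ract \<U> a ` V') (conj_map G \<U> \<U> a V f) (cmp E a K H V x))) \<and>
     (\<forall>a b L K H V. orbit_map G b L K \<and> orbit_map G a K H \<and> V \<in> Rep \<U> L \<and>
        ract \<U> b ` V \<in> Rep \<U> K \<and> ract \<U> (a \<otimes>\<^bsub>G\<^esub> b) ` V \<in> Rep \<U> H \<longrightarrow>
        (\<forall>x\<in>topspace (tp (obj E L V)).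
           cmp E (a \<otimes>\<^bsub>G\<^esub> b) L H V x = cmp E a K H (ract \<U> b ` V) (cmp E b L K V x))) \<and>
     (\<forall>H V. \<forall>h\<in>H. subgroup H G \<and> V \<in> Rep \<U> H \<longrightarrow>
        (\<forall>x\<in>topspace (tp (obj E H V)). cmp E h H H V x = act (obj E H V) h x))"

type_synonym ('g, 'v, 'p) two_cell = "'g set \<Rightarrow> 'v set \<Rightarrow> 'p \<Rightarrow> 'p"

definition two_morphism ::
  "('g, 'm) monoid_scheme \<Rightarrow> ('g, 'v::real_inner) rep \<Rightarrow> ('g, 'v, 'p) weiss \<Rightarrow> ('g, 'v, 'p) weiss
     \<Rightarrow> ('g, 'v, 'p) two_cell \<Rightarrow> bool" where
  "two_morphism G \<U> E F \<eta> \<longleftrightarrow>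
     one_morphism G \<U> E \<and> one_morphism G \<U> F \<and>
     (\<forall>H. subgroup H G \<longrightarrow>
        (\<forall>W\<in>Rep \<U> H.
           continuous_map (tp (obj E H W)) (tp (obj F H W)) (\<eta> H W) \<and>
           \<eta> H W (pt0 (obj E H W)) = pt0 (obj F H W) \<and>
           (\<forall>h\<in>H. \<forall>x\<in>topspace (tp (obj E H W)).
              \<eta> H W (act (obj E H W) h x) = act (obj F H W) h (\<eta> H W x))) \<and>
        (\<forall>W\<in>Rep \<U> H. \<forall>W'\<in>Rep \<U> H. \<forall>f\<in>Mor W W'. \<forall>x\<in>topspace (tp (obj E H W)).
           \<eta> H W' (mor E H W W' f x) = mor F H W W' f (\<eta> H W x))) \<and>
     (\<forall>a K H V. orbit_map G a K H \<and> V \<in> Rep \<U> K \<and> ract \<U> a ` V \<in> Rep \<U> H \<longrightarrow>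
        (\<forall>x\<in>topspace (tp (obj E K V)).
           \<eta> H (ract \<U> a ` V) (cmp E a K H V x) = cmp F a K H V (\<eta> K V x)))"

definition two_cell_comp ::
  "('g, 'v, 'p) two_cell \<Rightarrow> ('g, 'v, 'p) two_cell \<Rightarrow> ('g, 'v, 'p) two_cell" (infixl "\<circ>\<^sub>2" 55) where
  "\<theta> \<circ>\<^sub>2 \<eta> = (\<lambda>H W x. \<theta> H W (\<eta> H W x))"

definition two_cell_eq ::
  "('g, 'm) monoid_scheme \<Rightarrow> ('g, 'v::real_inner) rep \<Rightarrow> ('g, 'v, 'p) weiss
     \<Rightarrow> ('g, 'v, 'p) two_cell \<Rightarrow> ('g, 'v, 'p) two_cell \<Rightarrow> bool" where
  "two_cell_eq G \<U> E \<eta> \<theta> \<longleftrightarrow>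
     (\<forall>H. subgroup H G \<longrightarrow>
        (\<forall>W\<in>Rep \<U> H. \<forall>x\<in>topspace (tp (obj E H W)). \<eta> H W x = \<theta> H W x))"


section \<open>A universe of points\<close>

text \<open>An element of the nerve in degree \<open>n\<close> is a functor \<open>(c, f)\<close> out of \<open>{0 \<le> \<dots> \<le> n}\<close>, that is, a string
  of \<open>n\<close> composable morphisms; \<open>f (i, j)\<close> is the morphism \<open>c i \<rightarrow> c j\<close>.\<close>

type_synonym 'a nchain = "(nat \<Rightarrow> 'a set) \<times> (nat \<times> nat \<Rightarrow> 'a \<Rightarrow> 'a)"

text \<open>The points of all spaces are taken from one type that is closed under the three constructions
  below, so that these can be iterated: a point of a right Kan extension is a family indexed by
  morphisms \<open>f : X \<rightarrow> Z\<close>, a point of a totalization is a family indexed by degree, simplex coordinates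
  and nerve, and a point of a mapping telescope has a stage, a coordinate in \<open>[0,1)\<close> and a point of
  that stage. Any set of points of type \<open>'x\<close> embeds by \<open>Atom\<close>.\<close>

datatype ('x, 'v, 'a) point =
    Atom 'x
  | Kan (kan_fam: "'v set \<Rightarrow> ('v \<times> 'a \<Rightarrow> 'v) \<Rightarrow> ('x, 'v, 'a) point")
  | Tot (tot_fam: "nat \<Rightarrow> (nat \<Rightarrow> real) \<Rightarrow> 'a nchain \<Rightarrow> ('x, 'v, 'a) point")
  | Tel (tel_stage: nat) (tel_coord: real) (tel_point: "('x, 'v, 'a) point")


section \<open>Right Kan extension along \<open>Rep\<^sub>H \<rightarrow> V\<^sub>H\<close>\<close>

text \<open>The pointwise enriched right Kan extension at \<open>X\<close> is the space of natural transformations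
  \<open>Mor(X, -) \<rightarrow> E\<^bsub>G/H\<^esub>\<close> of continuous functors on \<open>Rep\<^sub>H\<close>, with the topology of the end, as a subspace of
  \<open>\<Prod>\<^bsub>Z\<^esub> Map(Mor(X, Z), E\<^bsub>G/H\<^esub>(Z))\<close>. It is evaluated at (not necessarily invariant) subspaces \<open>X\<close> of the
  external orthogonal direct sum of the universe and a further representation.\<close>

definition kan_set ::
  "('g, 'v::real_inner) rep \<Rightarrow> ('g, 'v, ('x, 'v, 'a::real_inner) point) weiss \<Rightarrow> 'g set
     \<Rightarrow> ('v \<times> 'a) set \<Rightarrow> ('v set \<Rightarrow> ('v \<times> 'a \<Rightarrow> 'v) \<Rightarrow> ('x, 'v, 'a) point) set" where
  "kan_set \<U> E H X =
     {\<phi> \<in> (\<Pi>\<^sub>E Z\<in>Rep \<U> H. cmaps (Mor_top X Z) (tp (obj E H Z))).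
        \<forall>Z\<in>Rep \<U> H. \<forall>Z'\<in>Rep \<U> H. \<forall>u\<in>Mor Z Z'. \<forall>f\<in>Mor X Z.
          \<phi> Z' (compose X u f) = mor E H Z Z' u (\<phi> Z f)}"

definition kan_top ::
  "('g, 'v::real_inner) rep \<Rightarrow> ('g, 'v, ('x, 'v, 'a::real_inner) point) weiss \<Rightarrow> 'g set
     \<Rightarrow> ('v \<times> 'a) set \<Rightarrow> ('x, 'v, 'a) point topology" where
  "kan_top \<U> E H X =
     pullback_topology (Kan ` kan_set \<U> E H X) kan_fam
       (product_topology (\<lambda>Z. compact_open_topology (Mor_top X Z) (tp (obj E H Z))) (Rep \<U> H))"

definition kan_base ::
  "('g, 'v::real_inner) rep \<Rightarrow> ('g, 'v, ('x, 'v, 'a::real_inner) point) weiss \<Rightarrow> 'g set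
     \<Rightarrow> ('v \<times> 'a) set \<Rightarrow> ('x, 'v, 'a) point" where
  "kan_base \<U> E H X = Kan (\<lambda>Z\<in>Rep \<U> H. \<lambda>f\<in>Mor X Z. pt0 (obj E H Z))"

definition kan_mor ::
  "('g, 'v::real_inner) rep \<Rightarrow> 'g set \<Rightarrow> ('v \<times> 'a::real_inner) set \<Rightarrow> ('v \<times> 'a) set
     \<Rightarrow> ('v \<times> 'a \<Rightarrow> 'v \<times> 'a) \<Rightarrow> ('x, 'v, 'a) point \<Rightarrow> ('x, 'v, 'a) point" where
  "kan_mor \<U> H X X' m p = Kan (\<lambda>Z\<in>Rep \<U> H. \<lambda>f\<in>Mor X' Z. kan_fam p Z (compose X f m))"

text \<open>For \<open>h \<in> H\<close>, the map from the value at \<open>X\<close> to the value at \<open>hX\<close> that sends \<open>\<phi>\<close> to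
  \<open>f \<mapsto> h \<phi>(h\<inverse> f h)\<close>. Here \<open>\<beta>\<close> is the representation that is added to the universe.\<close>

definition kan_act ::
  "('g, 'm) monoid_scheme \<Rightarrow> ('g, 'v::real_inner) rep \<Rightarrow> ('g, 'a::real_inner) rep
     \<Rightarrow> ('g, 'v, ('x, 'v, 'a) point) weiss \<Rightarrow> 'g set \<Rightarrow> 'g \<Rightarrow> ('v \<times> 'a) set
     \<Rightarrow> ('x, 'v, 'a) point \<Rightarrow> ('x, 'v, 'a) point" where
  "kan_act G \<U> \<beta> E H h X p =
     Kan (\<lambda>Z\<in>Rep \<U> H. \<lambda>f\<in>Mor (ract (\<U> \<oplus>\<^sub>r \<beta>) h ` X) Z.
       act (obj E H Z) h
         (kan_fam p Z (conj_map G (\<U> \<oplus>\<^sub>r \<beta>) \<U> (inv\<^bsub>G\<^esub> h) (ract (\<U> \<oplus>\<^sub>r \<beta>) h ` X) f)))"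

definition kan_cmp ::
  "('g, 'm) monoid_scheme \<Rightarrow> ('g, 'v::real_inner) rep \<Rightarrow> ('g, 'a::real_inner) rep
     \<Rightarrow> ('g, 'v, ('x, 'v, 'a) point) weiss \<Rightarrow> 'g \<Rightarrow> 'g set \<Rightarrow> 'g set \<Rightarrow> ('v \<times> 'a) set
     \<Rightarrow> ('x, 'v, 'a) point \<Rightarrow> ('x, 'v, 'a) point" where
  "kan_cmp G \<U> \<beta> E a K H X p =
     Kan (\<lambda>Z\<in>Rep \<U> H. \<lambda>f\<in>Mor (ract (\<U> \<oplus>\<^sub>r \<beta>) a ` X) Z.
       cmp E a K H (ract \<U> (inv\<^bsub>G\<^esub> a) ` Z)
         (kan_fam p (ract \<U> (inv\<^bsub>G\<^esub> a) ` Z)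
           (conj_map G (\<U> \<oplus>\<^sub>r \<beta>) \<U> (inv\<^bsub>G\<^esub> a) (ract (\<U> \<oplus>\<^sub>r \<beta>) a ` X) f)))"

definition kan_two ::
  "('g, 'v::real_inner) rep \<Rightarrow> ('g, 'v, ('x, 'v, 'a::real_inner) point) two_cell \<Rightarrow> 'g set
     \<Rightarrow> ('v \<times> 'a) set \<Rightarrow> ('x, 'v, 'a) point \<Rightarrow> ('x, 'v, 'a) point" where
  "kan_two \<U> \<eta> H X p = Kan (\<lambda>Z\<in>Rep \<U> H. \<lambda>f\<in>Mor X Z. \<eta> H Z (kan_fam p Z f))"


section \<open>Homotopy limits\<close>

text \<open>The category with objects \<open>C\<close> and all linear isometric embeddings as morphisms.\<close>

definition nerve :: "'a::real_inner set set \<Rightarrow> nat \<Rightarrow> 'a nchain set" where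
  "nerve C n = {(c, f). c \<in> {..n} \<rightarrow>\<^sub>E C \<and>
     f \<in> (\<Pi>\<^sub>E (i, j)\<in>{(i, j). i \<le> j \<and> j \<le> n}. Mor (c i) (c j)) \<and>
     (\<forall>i\<le>n. f (i, i) = (\<lambda>x\<in>c i. x)) \<and>
     (\<forall>i j k. i \<le> j \<and> j \<le> k \<and> k \<le> n \<longrightarrow> f (i, k) = compose (c i) (f (j, k)) (f (i, j)))}"

definition monotone_map :: "nat \<Rightarrow> nat \<Rightarrow> (nat \<Rightarrow> nat) \<Rightarrow> bool" where
  "monotone_map m n \<theta> \<longleftrightarrow> \<theta> ` {..m} \<subseteq> {..n} \<and> mono_on {..m} \<theta>"

definition nerve_pull :: "nat \<Rightarrow> (nat \<Rightarrow> nat) \<Rightarrow> 'a nchain \<Rightarrow> 'a nchain" where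
  "nerve_pull m \<theta> = (\<lambda>(c, f).
     (\<lambda>i\<in>{..m}. c (\<theta> i), \<lambda>(i, j)\<in>{(i, j). i \<le> j \<and> j \<le> m}. f (\<theta> i, \<theta> j)))"

definition nerve_conj ::
  "('g, 'm) monoid_scheme \<Rightarrow> ('g, 'a) rep \<Rightarrow> 'g \<Rightarrow> nat \<Rightarrow> 'a nchain \<Rightarrow> 'a nchain" where
  "nerve_conj G \<beta> a n = (\<lambda>(c, f).
     (\<lambda>i\<in>{..n}. ract \<beta> a ` c i,
      \<lambda>(i, j)\<in>{(i, j). i \<le> j \<and> j \<le> n}. conj_map G \<beta> \<beta> a (c i) (f (i, j))))"

definition simplex_top :: "nat \<Rightarrow> (nat \<Rightarrow> real) topology" where
  "simplex_top n = subtopology (powertop_real UNIV) (standard_simplex n)"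

definition simplex_push :: "nat \<Rightarrow> (nat \<Rightarrow> nat) \<Rightarrow> (nat \<Rightarrow> real) \<Rightarrow> nat \<Rightarrow> real" where
  "simplex_push m \<theta> t = (\<lambda>j. \<Sum>i | i \<le> m \<and> \<theta> i = j. t i)"

text \<open>The cosimplicial space \<open>[n] \<mapsto> \<Prod>\<^bsub>c\<^sub>0 \<rightarrow> \<dots> \<rightarrow> c\<^sub>n\<^esub> F(c\<^sub>n)\<close>, for a functor with values \<open>F\<close> on objects and
  \<open>Fm\<close> on morphisms. The product is taken over the set of strings, without a topology on that set.\<close>

definition cosimp_top ::
  "'a::real_inner set set \<Rightarrow> ('a set \<Rightarrow> 'p topology) \<Rightarrow> nat \<Rightarrow> ('a nchain \<Rightarrow> 'p) topology" where
  "cosimp_top C F n = product_topology (\<lambda>(c, f). F (c n)) (nerve C n)"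

definition cosimp_push ::
  "'a::real_inner set set \<Rightarrow> ('a set \<Rightarrow> 'a set \<Rightarrow> ('a \<Rightarrow> 'a) \<Rightarrow> 'p \<Rightarrow> 'p) \<Rightarrow> nat \<Rightarrow> nat \<Rightarrow> (nat \<Rightarrow> nat)
     \<Rightarrow> ('a nchain \<Rightarrow> 'p) \<Rightarrow> ('a nchain \<Rightarrow> 'p)" where
  "cosimp_push C Fm m n \<theta> x =
     (\<lambda>(c, f)\<in>nerve C n. Fm (c (\<theta> m)) (c n) (f (\<theta> m, n)) (x (nerve_pull m \<theta> (c, f))))"

definition tot_set ::
  "'a::real_inner set set \<Rightarrow> ('a set \<Rightarrow> 'p topology) \<Rightarrow> ('a set \<Rightarrow> 'a set \<Rightarrow> ('a \<Rightarrow> 'a) \<Rightarrow> 'p \<Rightarrow> 'p)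
     \<Rightarrow> (nat \<Rightarrow> (nat \<Rightarrow> real) \<Rightarrow> 'a nchain \<Rightarrow> 'p) set" where
  "tot_set C F Fm =
     {\<phi>. (\<forall>n. \<phi> n \<in> cmaps (simplex_top n) (cosimp_top C F n)) \<and>
         (\<forall>m n \<theta>. monotone_map m n \<theta> \<longrightarrow>
            (\<forall>t\<in>standard_simplex m.
               \<phi> n (simplex_push m \<theta> t) = cosimp_push C Fm m n \<theta> (\<phi> m t)))}"

definition holim_top ::
  "'a::real_inner set set \<Rightarrow> ('a set \<Rightarrow> ('x, 'v, 'a) point topology)
     \<Rightarrow> ('a set \<Rightarrow> 'a set \<Rightarrow> ('a \<Rightarrow> 'a) \<Rightarrow> ('x, 'v, 'a) point \<Rightarrow> ('x, 'v, 'a) point)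
     \<Rightarrow> ('x, 'v, 'a) point topology" where
  "holim_top C F Fm =
     pullback_topology (Tot ` tot_set C F Fm) tot_fam
       (product_topology (\<lambda>n. compact_open_topology (simplex_top n) (cosimp_top C F n)) UNIV)"

text \<open>The family with component \<open>k n t z\<close> at degree \<open>n\<close>, simplex point \<open>t\<close> and string \<open>z\<close> in \<open>C\<close>.\<close>

definition tot_build ::
  "'a::real_inner set set \<Rightarrow> (nat \<Rightarrow> (nat \<Rightarrow> real) \<Rightarrow> 'a nchain \<Rightarrow> ('x, 'v, 'a) point)
     \<Rightarrow> ('x, 'v, 'a) point" where
  "tot_build C k = Tot (\<lambda>n. \<lambda>t\<in>standard_simplex n. \<lambda>z\<in>nerve C n. k n t z)"


section \<open>The functor \<open>\<tau>\<^sub>\<beta>\<close>\<close>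

definition vcat :: "('g, 'a::real_inner) rep \<Rightarrow> 'a set set" where
  "vcat \<beta> = {U. subspace U \<and> U \<subseteq> rspace \<beta> \<and> U \<noteq> {0}}"

definition map_sum :: "'a set \<Rightarrow> 'b set \<Rightarrow> ('a \<Rightarrow> 'c) \<Rightarrow> ('b \<Rightarrow> 'd) \<Rightarrow> 'a \<times> 'b \<Rightarrow> 'c \<times> 'd" where
  "map_sum W U f g = restrict (map_prod f g) (W \<times> U)"

definition tau_obj ::
  "('g, 'm) monoid_scheme \<Rightarrow> ('g, 'v::real_inner) rep \<Rightarrow> ('g, 'a::real_inner) rep
     \<Rightarrow> ('g, 'v, ('x, 'v, 'a) point) weiss \<Rightarrow> 'g set \<Rightarrow> 'v set \<Rightarrow> ('g, ('x, 'v, 'a) point) gspace" where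
  "tau_obj G \<U> \<beta> E H W =
     \<lparr>tp = holim_top (vcat \<beta>) (\<lambda>U. kan_top \<U> E H (W \<times> U))
              (\<lambda>U U' m. kan_mor \<U> H (W \<times> U) (W \<times> U') (map_sum W U (\<lambda>w. w) m)),
      pt0 = tot_build (vcat \<beta>) (\<lambda>n t (c, f). kan_base \<U> E H (W \<times> c n)),
      act = (\<lambda>h p. tot_build (vcat \<beta>) (\<lambda>n t (c, f).
               kan_act G \<U> \<beta> E H h (W \<times> ract \<beta> (inv\<^bsub>G\<^esub> h) ` c n)
                 (tot_fam p n t (nerve_conj G \<beta> (inv\<^bsub>G\<^esub> h) n (c, f)))))\<rparr>"

definition tau ::
  "('g, 'm) monoid_scheme \<Rightarrow> ('g, 'v::real_inner) rep \<Rightarrow> ('g, 'a::real_inner) rep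
     \<Rightarrow> ('g, 'v, ('x, 'v, 'a) point) weiss \<Rightarrow> ('g, 'v, ('x, 'v, 'a) point) weiss" where
  "tau G \<U> \<beta> E =
     \<lparr>obj = tau_obj G \<U> \<beta> E,
      mor = (\<lambda>H W W' g p. tot_build (vcat \<beta>) (\<lambda>n t (c, f).
               kan_mor \<U> H (W \<times> c n) (W' \<times> c n) (map_sum W (c n) g (\<lambda>u. u))
                 (tot_fam p n t (c, f)))),
      cmp = (\<lambda>a K H V p. tot_build (vcat \<beta>) (\<lambda>n t (c, f).
               kan_cmp G \<U> \<beta> E a K H (V \<times> ract \<beta> (inv\<^bsub>G\<^esub> a) ` c n)
                 (tot_fam p n t (nerve_conj G \<beta> (inv\<^bsub>G\<^esub> a) n (c, f)))))\<rparr>"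

definition tau_two ::
  "('g, 'v::real_inner) rep \<Rightarrow> ('g, 'a::real_inner) rep
     \<Rightarrow> ('g, 'v, ('x, 'v, 'a) point) two_cell \<Rightarrow> ('g, 'v, ('x, 'v, 'a) point) two_cell" where
  "tau_two \<U> \<beta> \<eta> = (\<lambda>H W p. tot_build (vcat \<beta>) (\<lambda>n t (c, f).
     kan_two \<U> \<eta> H (W \<times> c n) (tot_fam p n t (c, f))))"

text \<open>The natural map \<open>E \<rightarrow> \<tau>\<^sub>\<beta> E\<close>, induced by the inclusions of \<open>W\<close> into \<open>W \<oplus> U\<close>.\<close>

definition tau_unit ::
  "('g, 'v::real_inner) rep \<Rightarrow> ('g, 'a::real_inner) rep
     \<Rightarrow> ('g, 'v, ('x, 'v, 'a) point) weiss \<Rightarrow> ('g, 'v, ('x, 'v, 'a) point) two_cell" where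
  "tau_unit \<U> \<beta> E = (\<lambda>H W x. tot_build (vcat \<beta>) (\<lambda>n t (c, f).
     Kan (\<lambda>Z\<in>Rep \<U> H. \<lambda>g\<in>Mor (W \<times> c n) Z. mor E H W Z (\<lambda>w\<in>W. g (w, 0)) x)))"

text \<open>The map \<open>\<tau>\<^sub>\<beta> E \<rightarrow> \<tau>\<^sub>\<gamma> E\<close> for a subrepresentation \<open>\<gamma>\<close> of \<open>\<beta>\<close>: restriction of the homotopy limit to
  strings of subspaces of \<open>\<gamma>\<close>.\<close>

definition tau_res ::
  "('g, 'a::real_inner) rep \<Rightarrow> ('g, 'v, ('x, 'v, 'a) point) two_cell" where
  "tau_res \<gamma> = (\<lambda>H W p. tot_build (vcat \<gamma>) (tot_fam p))"


section \<open>Sequential homotopy colimits\<close>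

text \<open>The pointed mapping telescope of \<open>X 0 \<rightarrow> X 1 \<rightarrow> \<dots>\<close> with transition maps \<open>s\<close>: the quotient of
  \<open>\<Coprod>\<^sub>n X n \<times> [0,1]\<close> by \<open>(n, x, 1) \<sim> (n + 1, s n x, 0)\<close> in which moreover all points \<open>(n, *, r)\<close> are
  identified. \<open>tel_quot\<close> sends a point to the normal form of its class.\<close>

definition tel_base :: "(nat \<Rightarrow> ('g, ('x, 'v, 'a) point) gspace) \<Rightarrow> ('x, 'v, 'a) point" where
  "tel_base X = Tel 0 0 (pt0 (X 0))"

definition tel_quot ::
  "(nat \<Rightarrow> ('g, ('x, 'v, 'a) point) gspace) \<Rightarrow> (nat \<Rightarrow> ('x, 'v, 'a) point \<Rightarrow> ('x, 'v, 'a) point)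
     \<Rightarrow> nat \<Rightarrow> ('x, 'v, 'a) point \<Rightarrow> real \<Rightarrow> ('x, 'v, 'a) point" where
  "tel_quot X s n x r =
     (if x = pt0 (X n) then tel_base X
      else if r < 1 then Tel n r x
      else if s n x = pt0 (X (Suc n)) then tel_base X
      else Tel (Suc n) 0 (s n x))"

text \<open>The map of telescopes induced by \<open>m n : X n \<rightarrow> Y n\<close>, where \<open>Y\<close>, \<open>s\<close> describe the target.\<close>

definition tel_map ::
  "(nat \<Rightarrow> ('g, ('x, 'v, 'a) point) gspace) \<Rightarrow> (nat \<Rightarrow> ('x, 'v, 'a) point \<Rightarrow> ('x, 'v, 'a) point)
     \<Rightarrow> (nat \<Rightarrow> ('x, 'v, 'a) point \<Rightarrow> ('x, 'v, 'a) point) \<Rightarrow> ('x, 'v, 'a) point \<Rightarrow> ('x, 'v, 'a) point" where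
  "tel_map Y s m p = tel_quot Y s (tel_stage p) (m (tel_stage p) (tel_point p)) (tel_coord p)"

definition telescope ::
  "(nat \<Rightarrow> ('g, ('x, 'v, 'a) point) gspace) \<Rightarrow> (nat \<Rightarrow> ('x, 'v, 'a) point \<Rightarrow> ('x, 'v, 'a) point)
     \<Rightarrow> ('g, ('x, 'v, 'a) point) gspace" where
  "telescope X s =
     \<lparr>tp = quotient_topology
              (sum_topology (\<lambda>n. prod_topology (tp (X n)) (top_of_set {0..1})) UNIV)
              (\<lambda>(n, x, r). tel_quot X s n x r),
      pt0 = tel_base X,
      act = (\<lambda>h. tel_map X s (\<lambda>n. act (X n) h))\<rparr>"

text \<open>The homotopy colimit of a sequence of 1-morphisms \<open>E n\<close> and 2-morphisms \<open>\<sigma> n : E n \<rightarrow> E (n + 1)\<close>.\<close>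

definition weiss_hocolim ::
  "('g, 'v) rep \<Rightarrow> (nat \<Rightarrow> ('g, 'v, ('x, 'v, 'a) point) weiss)
     \<Rightarrow> (nat \<Rightarrow> ('g, 'v, ('x, 'v, 'a) point) two_cell) \<Rightarrow> ('g, 'v, ('x, 'v, 'a) point) weiss" where
  "weiss_hocolim \<U> E \<sigma> =
     \<lparr>obj = (\<lambda>H W. telescope (\<lambda>n. obj (E n) H W) (\<lambda>n. \<sigma> n H W)),
      mor = (\<lambda>H W W' f.
               tel_map (\<lambda>n. obj (E n) H W') (\<lambda>n. \<sigma> n H W') (\<lambda>n. mor (E n) H W W' f)),
      cmp = (\<lambda>a K H V.
               tel_map (\<lambda>n. obj (E n) H (ract \<U> a ` V)) (\<lambda>n. \<sigma> n H (ract \<U> a ` V))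
                 (\<lambda>n. cmp (E n) a K H V))\<rparr>"


section \<open>Taylor approximations\<close>

definition tau_iter ::
  "('g, 'm) monoid_scheme \<Rightarrow> ('g, 'v::real_inner) rep \<Rightarrow> ('g, 'a::real_inner) rep
     \<Rightarrow> ('g, 'v, ('x, 'v, 'a) point) weiss \<Rightarrow> nat \<Rightarrow> ('g, 'v, ('x, 'v, 'a) point) weiss" where
  "tau_iter G \<U> \<beta> E n = (tau G \<U> \<beta> ^^ n) E"

definition tau_step ::
  "('g, 'v::real_inner) rep \<Rightarrow> ('g, 'a::real_inner) rep
     \<Rightarrow> ('g, 'v, ('x, 'v, 'a) point) weiss \<Rightarrow> nat \<Rightarrow> ('g, 'v, ('x, 'v, 'a) point) two_cell" where
  "tau_step \<U> \<beta> E n = (tau_two \<U> \<beta> ^^ n) (tau_unit \<U> \<beta> E)"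

definition taylor ::
  "('g, 'm) monoid_scheme \<Rightarrow> ('g, 'v::real_inner) rep \<Rightarrow> ('g, 'a::real_inner) rep
     \<Rightarrow> ('g, 'e::real_inner) rep \<Rightarrow> ('g, 'v, ('x, 'v, 'a \<times> 'e) point) weiss
     \<Rightarrow> ('g, 'v, ('x, 'v, 'a \<times> 'e) point) weiss" where
  "taylor G \<U> \<alpha> \<epsilon> E =
     weiss_hocolim \<U> (tau_iter G \<U> (\<alpha> \<oplus>\<^sub>r \<epsilon>) E) (tau_step \<U> (\<alpha> \<oplus>\<^sub>r \<epsilon>) E)"

text \<open>The map from \<open>E\<close>, the stage \<open>0\<close> of the telescope, into its approximation.\<close>

definition taylor_unit ::
  "('g, 'm) monoid_scheme \<Rightarrow> ('g, 'v::real_inner) rep \<Rightarrow> ('g, 'a::real_inner) rep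
     \<Rightarrow> ('g, 'e::real_inner) rep \<Rightarrow> ('g, 'v, ('x, 'v, 'a \<times> 'e) point) weiss
     \<Rightarrow> ('g, 'v, ('x, 'v, 'a \<times> 'e) point) two_cell" where
  "taylor_unit G \<U> \<alpha> \<epsilon> E = (\<lambda>H W x.
     tel_quot (\<lambda>n. obj (tau_iter G \<U> (\<alpha> \<oplus>\<^sub>r \<epsilon>) E n) H W)
       (\<lambda>n. tau_step \<U> (\<alpha> \<oplus>\<^sub>r \<epsilon>) E n H W) 0 x 0)"

text \<open>The \<open>n\<close>-fold iterates of the restriction maps from a larger representation to \<open>\<gamma>\<close>.\<close>

primrec tau_iter_res ::
  "('g, 'v::real_inner) rep \<Rightarrow> ('g, 'a::real_inner) rep \<Rightarrow> nat
     \<Rightarrow> ('g, 'v, ('x, 'v, 'a) point) two_cell" where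
  "tau_iter_res \<U> \<gamma> 0 = (\<lambda>H W x. x)"
| "tau_iter_res \<U> \<gamma> (Suc n) = tau_two \<U> \<gamma> (tau_iter_res \<U> \<gamma> n) \<circ>\<^sub>2 tau_res \<gamma>"

text \<open>The map from the approximation for \<open>\<alpha>\<close> to the one for a subrepresentation \<open>\<alpha>'\<close>. The
  formula uses \<open>\<alpha>\<close> only through the domain of the map.\<close>

definition taylor_res ::
  "('g, 'm) monoid_scheme \<Rightarrow> ('g, 'v::real_inner) rep \<Rightarrow> ('g, 'a::real_inner) rep
     \<Rightarrow> ('g, 'a) rep \<Rightarrow> ('g, 'e::real_inner) rep \<Rightarrow> ('g, 'v, ('x, 'v, 'a \<times> 'e) point) weiss
     \<Rightarrow> ('g, 'v, ('x, 'v, 'a \<times> 'e) point) two_cell" where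
  "taylor_res G \<U> \<alpha> \<alpha>' \<epsilon> E = (\<lambda>H W.
     tel_map (\<lambda>n. obj (tau_iter G \<U> (\<alpha>' \<oplus>\<^sub>r \<epsilon>) E n) H W)
       (\<lambda>n. tau_step \<U> (\<alpha>' \<oplus>\<^sub>r \<epsilon>) E n H W)
       (\<lambda>n. tau_iter_res \<U> (\<alpha>' \<oplus>\<^sub>r \<epsilon>) n H W))"

end

theory Submission
  imports Defs
begin

text \<open>
  The approximation is built from three constructions, and the theorem holds because each of them
  preserves 1-morphisms and is functorial on 2-morphisms: the right Kan extension to all
  finite-dimensional subspaces, the homotopy limit over the nonzero subspaces of a representation,
  and the telescope of the resulting sequence.

  The Kan extension at \<open>X\<close> is the space of natural transformations \<open>Mor(X, -) \<rightarrow> E\<close>. Morphisms of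
  \<open>Rep\<^sub>H\<close> are all linear isometric embeddings, equivariant or not, and a complete universe contains
  trivial representations of every dimension (\<open>trivial_model\<close>). So every \<open>X\<close> is isomorphic to an object
  \<open>Z\<close> of \<open>Rep\<^sub>H\<close>, even to one that serves all subgroups \<open>H\<close> at once, and by the Yoneda lemma the Kan
  extension at \<open>X\<close> is homeomorphic to the value of \<open>E\<close> at \<open>Z\<close> (\<open>kan_eval_homeo\<close>). This makes the
  functoriality of the Kan extension jointly continuous (\<open>kan_mor_continuous\<close>), and it shows that the
  Kan extensions for different subgroups, although taken over different categories, are related by
  homeomorphisms (\<open>kan_cmp_homeo\<close>).

  All structure on the homotopy limit \<open>\<tau>\<^sub>\<beta> E\<close> comes from natural maps between its terms together with
  a reindexing of strings, and \<open>holim_map_joint\<close> turns such data into continuous maps. In this way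
  \<open>\<tau>\<^sub>\<beta> E\<close> is a 1-morphism (\<open>one_morphism_tau\<close>), and \<open>\<tau>\<^sub>\<beta>\<close> acts on 2-morphisms, has a unit and restricts to
  subrepresentations. Equivariance never has to be treated separately: the action of \<open>h \<in> H\<close> is the
  comparison map for \<open>h\<close>, so that it is part of the naturality and functoriality of comparison maps
  (\<open>one_morphismI\<close>, \<open>two_morphismI\<close>).

  A map of telescopes is computed on representatives (\<open>tel_map_quot\<close>), which reduces the algebraic
  axioms to the stages. Joint continuity of the functoriality needs a product of a quotient map with
  a morphism space to be a quotient map; this holds as morphism spaces are compact Hausdorff
  (\<open>compact_Mor_top\<close>). Finally the restriction maps commute with the units, hence with the transition
  maps of the telescopes (\<open>iter_res_step\<close>), and are transitive in the subrepresentation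
  (\<open>iter_res_res\<close>). The asserted identities of 2-morphisms hold on the nose.
\<close>

section \<open>Function spaces with the compact-open topology\<close>

text \<open>By the tube lemma, if \<open>h p\<close> maps a compact set into an open one then so does \<open>h q\<close> for all \<open>q\<close> near \<open>p\<close>.
  Continuity of maps into Kan extensions and totalizations rests on this direction of the
  exponential law.\<close>

lemma continuous_map_curry:
  assumes h: "continuous_map (prod_topology P X) Y (\<lambda>(p, x). h p x)"
  shows "continuous_map P (compact_open_topology X Y) (\<lambda>p. \<lambda>x\<in>topspace X. h p x)"
proof -
  have cm: "(\<lambda>x\<in>topspace X. h p x) \<in> cmaps X Y" if "p \<in> topspace P" for p
  proof -
    have "continuous_map X (prod_topology P X) (\<lambda>x. (p, x))"
      using that by (auto intro!: continuous_map_pairedI)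
    from continuous_map_compose [OF this h] have "continuous_map X Y (h p)"
      by (simp add: o_def)
    then show ?thesis by (simp add: cmaps_def)
  qed
  show ?thesis
    unfolding compact_open_topology_def
  proof (rule continuous_on_generated_topo)
    fix U assume "U \<in> {{f \<in> cmaps X Y. f ` C \<subseteq> V} |C V. compactin X C \<and> openin Y V}"
    then obtain C V where U: "U = {f \<in> cmaps X Y. f ` C \<subseteq> V}"
      and C: "compactin X C" and V: "openin Y V" by blast
    have CX: "C \<subseteq> topspace X" using C compactin_subset_topspace by blast
    define W where "W = {z \<in> topspace (prod_topology P X). (case z of (p, x) \<Rightarrow> h p x) \<in> V}"
    have W: "openin (prod_topology P X) W"
      unfolding W_def by (rule openin_continuous_map_preimage [OF h V])
    have "\<exists>T. openin P T \<and> p \<in> T \<and> T \<subseteq> (\<lambda>p. \<lambda>x\<in>topspace X. h p x) -` U \<inter> topspace P"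
      if "p \<in> (\<lambda>p. \<lambda>x\<in>topspace X. h p x) -` U \<inter> topspace P" for p
    proof -
      have p: "p \<in> topspace P" and "\<And>x. x \<in> C \<Longrightarrow> h p x \<in> V"
        using that CX by (auto simp: U)
      then have "{p} \<times> C \<subseteq> W" using CX by (auto simp: W_def)
      from tube_lemma_right [OF W C p this] obtain S T where
        ST: "openin P S" "p \<in> S" "C \<subseteq> T" "S \<times> T \<subseteq> W" by blast
      have "S \<subseteq> (\<lambda>p. \<lambda>x\<in>topspace X. h p x) -` U \<inter> topspace P"
      proof
        fix q assume q: "q \<in> S"
        then have qP: "q \<in> topspace P" using ST openin_subset by blast
        moreover have "h q x \<in> V" if "x \<in> C" for x
        proof -
          have "(q, x) \<in> W" using ST q that by blast
          then show ?thesis by (simp add: W_def)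
        qed
        ultimately show "q \<in> (\<lambda>p. \<lambda>x\<in>topspace X. h p x) -` U \<inter> topspace P"
          using cm [OF qP] CX by (auto simp: U)
      qed
      with ST show ?thesis by blast
    qed
    then show "openin P ((\<lambda>p. \<lambda>x\<in>topspace X. h p x) -` U \<inter> topspace P)"
      by (subst openin_subopen) blast
  next
    have "cmaps X Y \<in> {{f \<in> cmaps X Y. f ` C \<subseteq> V} |C V. compactin X C \<and> openin Y V}"
      by (rule CollectI, rule exI [of _ "{}"], rule exI [of _ "{}"]) auto
    then show "(\<lambda>p. \<lambda>x\<in>topspace X. h p x) ` topspace P
      \<subseteq> \<Union> {{f \<in> cmaps X Y. f ` C \<subseteq> V} |C V. compactin X C \<and> openin Y V}"
      using cm by blast
  qed
qed

lemma openin_compact_open_basic: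
  assumes "compactin X C" "openin Y V"
  shows "openin (compact_open_topology X Y) {f \<in> cmaps X Y. f ` C \<subseteq> V}"
  unfolding compact_open_topology_def
  by (rule topology_generated_by_Basis) (use assms in blast)

lemma continuous_map_eval_at:
  assumes x: "x \<in> topspace X"
  shows "continuous_map (compact_open_topology X Y) Y (\<lambda>f. f x)"
  unfolding continuous_map_def
proof (intro conjI allI impI)
  show "(\<lambda>f. f x) \<in> topspace (compact_open_topology X Y) \<rightarrow> topspace Y"
    using x by (auto simp: cmaps_def continuous_map_def)
  fix V assume "openin Y V"
  from openin_compact_open_basic [OF _ this, of X "{x}"] x
  show "openin (compact_open_topology X Y) {f \<in> topspace (compact_open_topology X Y). f x \<in> V}"
    by simp
qed

text \<open>The converse direction: near a given point, \<open>f\<close> is controlled on a compact neighbourhood that it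
  maps into the prescribed open set.\<close>

lemma continuous_map_eval:
  assumes X: "neighbourhood_base_of (compactin X) X"
  shows "continuous_map (prod_topology (compact_open_topology X Y) X) Y (\<lambda>(f, x). f x)"
    (is "continuous_map ?P Y ?e")
  unfolding continuous_map_def
proof (intro conjI allI impI)
  show "?e \<in> topspace ?P \<rightarrow> topspace Y"
    by (auto simp: cmaps_def continuous_map_def)
  fix V assume V: "openin Y V"
  have "\<exists>T. openin ?P T \<and> z \<in> T \<and> T \<subseteq> {z \<in> topspace ?P. ?e z \<in> V}"
    if z: "z \<in> {z \<in> topspace ?P. ?e z \<in> V}" for z
  proof -
    obtain f x where [simp]: "z = (f, x)" by (cases z)
    have f: "f \<in> cmaps X Y" and x: "x \<in> topspace X" and fx: "f x \<in> V" using z by auto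
    have "openin X {x \<in> topspace X. f x \<in> V}"
      using f V by (auto simp: cmaps_def continuous_map_def)
    then obtain S C where SC: "openin X S" "compactin X C" "x \<in> S" "S \<subseteq> C"
      "C \<subseteq> {x \<in> topspace X. f x \<in> V}"
      using X x fx unfolding neighbourhood_base_of by (metis (mono_tags, lifting) mem_Collect_eq)
    have "openin ?P ({f \<in> cmaps X Y. f ` C \<subseteq> V} \<times> S)"
      using openin_compact_open_basic [OF SC(2) V] SC by (simp add: openin_prod_Times_iff)
    moreover have "z \<in> {f \<in> cmaps X Y. f ` C \<subseteq> V} \<times> S" using f SC by auto
    moreover have "{f \<in> cmaps X Y. f ` C \<subseteq> V} \<times> S \<subseteq> {z \<in> topspace ?P. ?e z \<in> V}"
      using SC by auto
    ultimately show ?thesis by blast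
  qed
  then show "openin ?P {z \<in> topspace ?P. ?e z \<in> V}" by (subst openin_subopen) blast
qed

lemma continuous_map_fst_fst:
    "continuous_map (prod_topology (prod_topology X Y) Z) X (\<lambda>p. fst (fst p))"
  and continuous_map_snd_fst:
    "continuous_map (prod_topology (prod_topology X Y) Z) Y (\<lambda>p. snd (fst p))"
  using continuous_map_compose [OF continuous_map_fst continuous_map_fst]
    continuous_map_compose [OF continuous_map_fst continuous_map_snd]
  by (auto simp: o_def)

lemma continuous_map_apply2:
  assumes "continuous_map (prod_topology X Y) Z (\<lambda>(x, y). h x y)"
    and "continuous_map P X u" "continuous_map P Y v"
  shows "continuous_map P Z (\<lambda>p. h (u p) (v p))"
  using continuous_map_compose [OF continuous_map_pairedI [OF assms(2,3)] assms(1)]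
  by (simp add: o_def)

section \<open>Linear isometric embeddings\<close>

lemma MorI:
  assumes "\<And>x. x \<in> X \<Longrightarrow> f x \<in> Y" "f \<in> extensional X"
    "\<And>x y a b. x \<in> X \<Longrightarrow> y \<in> X \<Longrightarrow> f (a *\<^sub>R x + b *\<^sub>R y) = a *\<^sub>R f x + b *\<^sub>R f y"
    "\<And>x. x \<in> X \<Longrightarrow> norm (f x) = norm x"
  shows "f \<in> Mor X Y"
  using assms by (auto simp: Mor_def PiE_def)

lemma Mor_mem: "f \<in> Mor X Y \<Longrightarrow> x \<in> X \<Longrightarrow> f x \<in> Y"
  and Mor_ext: "f \<in> Mor X Y \<Longrightarrow> f \<in> extensional X"
  and Mor_lin: "f \<in> Mor X Y \<Longrightarrow> x \<in> X \<Longrightarrow> y \<in> X \<Longrightarrow> f (a *\<^sub>R x + b *\<^sub>R y) = a *\<^sub>R f x + b *\<^sub>R f y"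
  and Mor_norm: "f \<in> Mor X Y \<Longrightarrow> x \<in> X \<Longrightarrow> norm (f x) = norm x"
  by (auto simp: Mor_def PiE_def)

lemma Mor_zero: "f \<in> Mor X Y \<Longrightarrow> subspace X \<Longrightarrow> f 0 = 0"
  using Mor_norm [of f X Y 0] by (simp add: subspace_0)

lemma Mor_dist:
  assumes "f \<in> Mor X Y" "subspace X" "x \<in> X" "y \<in> X"
  shows "norm (f x - f y) = norm (x - y)"
proof -
  have "f (x - y) = f x - f y" using Mor_lin [OF assms(1,3,4), of 1 "-1"] by simp
  then show ?thesis using Mor_norm [OF assms(1), of "x - y"] assms by (simp add: subspace_diff)
qed

lemma Mor_id: "X \<subseteq> Y \<Longrightarrow> subspace X \<Longrightarrow> (\<lambda>x\<in>X. x) \<in> Mor X Y"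
  by (rule MorI) (auto intro: subspace_add subspace_scale)

lemma Mor_compose:
  assumes "f \<in> Mor X Y" "g \<in> Mor Y Z" "subspace X"
  shows "compose X g f \<in> Mor X Z"
proof (rule MorI)
  show "compose X g f (a *\<^sub>R x + b *\<^sub>R y) = a *\<^sub>R compose X g f x + b *\<^sub>R compose X g f y"
    if "x \<in> X" "y \<in> X" for x y a b
    using assms that
    by (simp add: compose_def Mor_lin [OF assms(1)] Mor_lin [OF assms(2)] Mor_mem [OF assms(1)]
        subspace_add subspace_scale)
qed (use assms in \<open>auto simp: compose_def Mor_mem Mor_norm\<close>)

lemma Mor_image_subspace:
  assumes f: "f \<in> Mor X Y" and X: "subspace X"
  shows "subspace (f ` X)"
proof (rule subspaceI)
  show "0 \<in> f ` X" using Mor_zero [OF f X] X by (force simp: subspace_0)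
  show "x + y \<in> f ` X" if "x \<in> f ` X" "y \<in> f ` X" for x y
    using that X Mor_lin [OF f, where a=1 and b=1] by (auto simp: image_iff) (metis subspace_add)
  show "c *\<^sub>R x \<in> f ` X" if "x \<in> f ` X" for x c
    using that X Mor_lin [OF f, where a=c and b=0] by (auto simp: image_iff) (metis subspace_scale)
qed

lemma fin_dim_subspace: "fin_dim X \<Longrightarrow> subspace X"
  by (auto simp: fin_dim_def)

lemma fin_dim_subset:
  assumes "fin_dim V" "subspace U" "U \<subseteq> V"
  shows "fin_dim U"
proof -
  obtain T where T: "finite T" "span T = V" using assms by (auto simp: fin_dim_def)
  obtain B where B: "B \<subseteq> U" "independent B" "U \<subseteq> span B"
    using maximal_independent_subset [of U] by blast
  have "finite B" using independent_span_bound [OF T(1) B(2)] B T assms by auto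
  moreover have "span B = U" using B assms span_minimal by blast
  ultimately show ?thesis by (auto simp: fin_dim_def)
qed

lemma fin_dim_Times:
  fixes V :: "'a::real_vector set" and U :: "'b::real_vector set"
  assumes "fin_dim V" "fin_dim U"
  shows "fin_dim (V \<times> U)"
proof -
  obtain A B where A: "finite A" "span A = V" and B: "finite B" "span B = U"
    using assms by (auto simp: fin_dim_def)
  define i1 i2 where "i1 = (\<lambda>x::'a. (x, 0::'b))" and "i2 = (\<lambda>y::'b. (0::'a, y))"
  define C where "C = i1 ` A \<union> i2 ` B"
  have l1: "linear i1" and l2: "linear i2"
    by (auto intro!: linearI simp: i1_def i2_def)
  have "span C \<subseteq> V \<times> U"
    by (rule span_minimal)
      (use A B in \<open>auto simp: C_def i1_def i2_def span_base span_0 intro: subspace_Times subspace_span\<close>)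
  moreover have "V \<times> U \<subseteq> span C"
  proof clarify
    fix x y assume "x \<in> V" "y \<in> U"
    then have "i1 x \<in> span (i1 ` A)" "i2 y \<in> span (i2 ` B)"
      using A B by (simp_all add: linear_span_image [OF l1] linear_span_image [OF l2])
    then have "i1 x \<in> span C" "i2 y \<in> span C"
      using span_mono [of "i1 ` A" C] span_mono [of "i2 ` B" C]
      by (auto simp: C_def)
    from span_add [OF this] show "(x, y) \<in> span C" by (simp add: i1_def i2_def)
  qed
  moreover have "finite C" using A B by (simp add: C_def)
  ultimately show ?thesis unfolding fin_dim_def by blast
qed

lemma fin_dim_Mor_image:
  assumes f: "f \<in> Mor X Y" and X: "fin_dim X"
  shows "fin_dim (f ` X)"
proof -
  obtain B where B: "finite B" "span B = X" using X by (auto simp: fin_dim_def)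
  have sX: "subspace X" by (simp add: X fin_dim_subspace)
  have BX: "B \<subseteq> X" using B span_superset by blast
  have "span (f ` B) \<subseteq> f ` X"
    by (rule span_minimal) (use BX Mor_image_subspace [OF f sX] in auto)
  moreover have "x \<in> span B \<and> f x \<in> span (f ` B)" if "x \<in> span B" for x
    using that
  proof (induction rule: span_induct_alt)
    case base then show ?case using Mor_zero [OF f sX] by (simp add: span_0)
  next
    case (step c x y)
    then have x: "x \<in> X" "x \<in> span B" "y \<in> X" using BX B span_base by auto
    then have "f (c *\<^sub>R x + 1 *\<^sub>R y) = c *\<^sub>R f x + 1 *\<^sub>R f y"
      by (intro Mor_lin [OF f])
    with step x show ?case by (simp add: span_add span_scale span_base)
  qed
  moreover from this have "f ` X \<subseteq> span (f ` B)" using B by auto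
  ultimately have "span (f ` B) = f ` X" by blast
  then show ?thesis using B unfolding fin_dim_def by blast
qed

subsection \<open>Orthonormal frames\<close>

text \<open>A frame of a finite-dimensional subspace is indexed by an initial segment of the naturals, so that
  frames of spaces of different types can be matched up.\<close>

definition orthonormal :: "nat \<Rightarrow> (nat \<Rightarrow> 'a::real_inner) \<Rightarrow> bool" where
  "orthonormal d b \<longleftrightarrow> (\<forall>i<d. \<forall>j<d. inner (b i) (b j) = (if i = j then 1 else 0))"

lemma inner_orthonormal_sum:
  assumes "orthonormal d b" "j < d"
  shows "inner (\<Sum>i<d. c i *\<^sub>R b i) (b j) = c j"
proof -
  have "inner (\<Sum>i<d. c i *\<^sub>R b i) (b j) = (\<Sum>i<d. if i = j then c i else 0)"
    unfolding inner_sum_left by (rule sum.cong) (use assms in \<open>auto simp: orthonormal_def\<close>)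
  then show ?thesis using assms by simp
qed

lemma norm_orthonormal_sum:
  assumes "orthonormal d b"
  shows "(norm (\<Sum>i<d. c i *\<^sub>R b i))\<^sup>2 = (\<Sum>i<d. (c i)\<^sup>2)"
  unfolding power2_norm_eq_inner
  by (subst inner_sum_right)
    (use inner_orthonormal_sum [OF assms, of _ c] in \<open>simp add: power2_eq_square\<close>)

lemma frame_sum_mem: "(\<Sum>i<d. c i *\<^sub>R b i) \<in> span (b ` {..<d})"
  by (intro span_sum span_scale span_base) auto

lemma orthonormal_expansion:
  assumes "orthonormal d b" "x \<in> span (b ` {..<d})"
  shows "(\<Sum>i<d. inner x (b i) *\<^sub>R b i) = x"
  using assms(2)
proof (induction rule: span_induct_alt)
  case base then show ?case by simp
next
  case (step c x y)
  then obtain j where j: "j < d" "x = b j" by auto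
  have "(\<Sum>i<d. inner (b j) (b i) *\<^sub>R b i) = (\<Sum>i<d. if i = j then b i else 0)"
    by (rule sum.cong) (use assms j in \<open>auto simp: orthonormal_def\<close>)
  with step j show ?case
    by (simp add: inner_add_left scaleR_add_left sum.distrib flip: scaleR_scaleR scaleR_sum_right)
qed

text \<open>Gram-Schmidt. The ambient space may have infinite dimension; only the span is finite-dimensional.\<close>

lemma fin_dim_orthonormal_basis:
  assumes "fin_dim X"
  obtains d b where "orthonormal d b" "span (b ` {..<d}) = X"
proof -
  obtain B where B: "finite B" "span B = X" using assms by (auto simp: fin_dim_def)
  have "\<exists>d b. orthonormal d b \<and> span (b ` {..<d}) = span B"
    using B(1)
  proof (induction B)
    case empty
    show ?case by (rule exI [of _ 0]) (auto simp: orthonormal_def)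
  next
    case (insert a B)
    then obtain d b where b: "orthonormal d b" "span (b ` {..<d}) = span B" by blast
    define S where "S = b ` {..<d}"
    have span_ins: "span (insert a B) = span (insert a S)"
      using b by (simp add: S_def span_insert)
    \<comment> \<open>The component of the new vector orthogonal to the frame obtained so far.\<close>
    define a' where "a' = a - (\<Sum>i<d. inner a (b i) *\<^sub>R b i)"
    have sumS: "(\<Sum>i<d. inner a (b i) *\<^sub>R b i) \<in> span S"
      unfolding S_def by (rule frame_sum_mem)
    have orth: "inner a' (b j) = 0" if "j < d" for j
      using inner_orthonormal_sum [OF b(1) that, of "\<lambda>i. inner a (b i)"]
      by (simp add: a'_def inner_diff_left)
    show ?case
    proof (cases "a' = 0")
      case True
      then have "a \<in> span S" using sumS by (simp add: a'_def)
      then show ?thesis using b span_ins by (metis S_def span_redundant)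
    next
      case False
      define b' where "b' = b(d := a' /\<^sub>R norm a')"
      have "norm (b' d) = 1" using False by (simp add: b'_def)
      then have bd: "inner (b' d) (b' d) = 1" unfolding norm_eq_1 .
      have bj: "inner (b' d) (b' j) = 0" "inner (b' j) (b' d) = 0" if "j < d" for j
        using orth [OF that] that by (simp_all add: b'_def inner_commute [of _ a'])
      have bij: "inner (b' i) (b' j) = (if i = j then 1 else 0)" if "i < d" "j < d" for i j
        using b(1) that by (simp add: b'_def orthonormal_def)
      have "inner (b' i) (b' j) = (if i = j then 1 else 0)" if "i < Suc d" "j < Suc d" for i j
        using that bd bj bij by (cases "i = d"; cases "j = d") (simp_all add: less_Suc_eq)
      then have "orthonormal (Suc d) b'" by (simp add: orthonormal_def)
      moreover have "span (b' ` {..<Suc d}) = span (insert a S)"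
      proof -
        have im: "b' ` {..<Suc d} = insert (a' /\<^sub>R norm a') S"
          by (auto simp: b'_def S_def lessThan_Suc)
        have "a \<in> span (insert (a' /\<^sub>R norm a') S)"
        proof -
          have "norm a' *\<^sub>R (a' /\<^sub>R norm a') \<in> span (insert (a' /\<^sub>R norm a') S)"
            by (intro span_scale span_base) simp
          then have "a' \<in> span (insert (a' /\<^sub>R norm a') S)" using False by simp
          moreover have "(\<Sum>i<d. inner a (b i) *\<^sub>R b i) \<in> span (insert (a' /\<^sub>R norm a') S)"
            using sumS span_mono [of S "insert (a' /\<^sub>R norm a') S"] by blast
          ultimately show ?thesis using span_add unfolding a'_def by fastforce
        qed
        moreover have "a' /\<^sub>R norm a' \<in> span (insert a S)"
        proof -
          have "(\<Sum>i<d. inner a (b i) *\<^sub>R b i) \<in> span (insert a S)"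
            using sumS span_mono [of S "insert a S"] by blast
          then show ?thesis
            unfolding a'_def by (intro span_scale span_diff) (auto intro: span_base)
        qed
        ultimately show ?thesis unfolding im span_eq by (auto intro: span_base)
      qed
      ultimately show ?thesis using span_ins by metis
    qed
  qed
  with B that show thesis by metis
qed

definition frame_map :: "nat \<Rightarrow> (nat \<Rightarrow> 'a::real_inner) \<Rightarrow> (nat \<Rightarrow> 'b::real_inner) \<Rightarrow> 'a \<Rightarrow> 'b" where
  "frame_map d b e = (\<lambda>x\<in>span (b ` {..<d}). \<Sum>i<d. inner x (b i) *\<^sub>R e i)"

lemma frame_map_Mor:
  assumes b: "orthonormal d b" and e: "orthonormal d e"
  shows "frame_map d b e \<in> Mor (span (b ` {..<d})) (span (e ` {..<d}))"
proof (rule MorI)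
  fix x assume x: "x \<in> span (b ` {..<d})"
  show "frame_map d b e x \<in> span (e ` {..<d})"
    using x by (simp add: frame_map_def frame_sum_mem)
  have "(norm (frame_map d b e x))\<^sup>2 = (norm x)\<^sup>2"
    using norm_orthonormal_sum [OF e, of "\<lambda>i. inner x (b i)"]
      norm_orthonormal_sum [OF b, of "\<lambda>i. inner x (b i)"] orthonormal_expansion [OF b x] x
    by (simp add: frame_map_def)
  then show "norm (frame_map d b e x) = norm x" by simp
next
  show "frame_map d b e (r *\<^sub>R x + s *\<^sub>R y) = r *\<^sub>R frame_map d b e x + s *\<^sub>R frame_map d b e y"
    if "x \<in> span (b ` {..<d})" "y \<in> span (b ` {..<d})" for x y r s
    using that by (simp add: frame_map_def span_add span_scale inner_add_left scaleR_add_left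
        sum.distrib scaleR_sum_right)
qed (simp add: frame_map_def)

lemma frame_map_inverse:
  assumes b: "orthonormal d b" and e: "orthonormal d e" and x: "x \<in> span (b ` {..<d})"
  shows "frame_map d e b (frame_map d b e x) = x"
proof -
  have "frame_map d b e x \<in> span (e ` {..<d})" by (rule Mor_mem [OF frame_map_Mor [OF b e] x])
  moreover have "inner (frame_map d b e x) (e i) = inner x (b i)" if "i < d" for i
    using inner_orthonormal_sum [OF e that] x by (simp add: frame_map_def)
  ultimately show ?thesis using orthonormal_expansion [OF b x] by (simp add: frame_map_def [of d e b])
qed

subsection \<open>The topology on isometric embeddings\<close>

lemma topspace_Mor_top [simp]: "topspace (Mor_top X Y) = Mor X Y"
  by (auto simp: Mor_top_def Mor_def PiE_def)

lemma continuous_map_into_Mor_top: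
  "continuous_map P (Mor_top X Y) F \<longleftrightarrow>
     (\<forall>p\<in>topspace P. F p \<in> Mor X Y) \<and> (\<forall>x\<in>X. continuous_map P euclidean (\<lambda>p. F p x))"
  unfolding Mor_top_def continuous_map_in_subtopology continuous_map_componentwise
  by (auto dest: Mor_ext)

lemma continuous_map_Mor_point:
  "x \<in> X \<Longrightarrow> continuous_map P (Mor_top X Y) F \<Longrightarrow> continuous_map P euclidean (\<lambda>p. F p x)"
  by (simp add: continuous_map_into_Mor_top)

text \<open>Isometric embeddings are equicontinuous, so that pointwise convergence is uniform enough for
  evaluation to be jointly continuous.\<close>

lemma continuous_map_Mor_eval:
  assumes F: "continuous_map P (Mor_top X Y) F" and g: "continuous_map P euclidean g"
    and gX: "\<And>p. p \<in> topspace P \<Longrightarrow> g p \<in> X" and X: "subspace X"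
  shows "continuous_map P euclidean (\<lambda>p. F p (g p))"
  unfolding continuous_map_atin limitin_canonical_iff
proof
  fix p assume p: "p \<in> topspace P"
  have F_Mor: "F q \<in> Mor X Y" if "q \<in> topspace P" for q
    using F that by (simp add: continuous_map_into_Mor_top)
  have lim1: "((\<lambda>q. F q (g p)) \<longlongrightarrow> F p (g p)) (atin P p)"
    using continuous_map_Mor_point [OF gX [OF p] F] p by (simp add: continuous_map_atin)
  have "(g \<longlongrightarrow> g p) (atin P p)"
    using g p by (simp add: continuous_map_atin)
  then have "((\<lambda>q. norm (g q - g p)) \<longlongrightarrow> 0) (atin P p)"
    by (intro tendsto_norm_zero LIM_zero)
  then have "((\<lambda>q. norm (F q (g q) - F q (g p))) \<longlongrightarrow> 0) (atin P p)"
    by (rule Lim_transform_eventually)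
      (auto simp: eventually_atin p Mor_dist [OF F_Mor X] gX intro!: exI [of _ "topspace P"])
  then have "((\<lambda>q. (F q (g q) - F q (g p)) + F q (g p)) \<longlongrightarrow> 0 + F p (g p)) (atin P p)"
    by (intro tendsto_add lim1) (simp add: tendsto_norm_zero_iff)
  then show "((\<lambda>q. F q (g q)) \<longlongrightarrow> F p (g p)) (atin P p)" by simp
qed

lemma continuous_map_Mor_compose:
  assumes "continuous_map P (Mor_top Y Z) F" "continuous_map P (Mor_top X Y) M"
    and "subspace X" "subspace Y"
  shows "continuous_map P (Mor_top X Z) (\<lambda>p. compose X (F p) (M p))"
proof -
  have "\<forall>p\<in>topspace P. F p \<in> Mor Y Z \<and> M p \<in> Mor X Y"
    using assms by (simp add: continuous_map_into_Mor_top)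
  moreover have "continuous_map P euclidean (\<lambda>p. F p (M p x))" if "x \<in> X" for x
    by (rule continuous_map_Mor_eval [OF assms(1)])
      (use that assms calculation in \<open>auto simp: continuous_map_into_Mor_top intro: Mor_mem\<close>)
  ultimately show ?thesis
    using assms(3) by (auto simp: continuous_map_into_Mor_top compose_eq intro: Mor_compose)
qed

lemma continuous_map_Mor_const: "f \<in> Mor X Y \<Longrightarrow> continuous_map P (Mor_top X Y) (\<lambda>_. f)"
  by simp

lemma Hausdorff_Mor_top: "Hausdorff_space (Mor_top X Y)"
  unfolding Mor_top_def
  by (intro Hausdorff_space_subtopology) (simp add: Hausdorff_space_product_topology)

text \<open>Each \<open>f x\<close> ranges over a ball of the finite-dimensional space \<open>Y\<close>, and linearity and preservation of
  norms are closed conditions, so Tychonoff's theorem applies. Compactness of these morphism spaces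
  makes the product of a morphism space with a quotient map again a quotient map, which gives the
  continuity of the functoriality of mapping telescopes.\<close>

lemma compact_Mor_top:
  assumes X: "subspace X" and Y: "fin_dim Y"
  shows "compact_space (Mor_top X Y)"
proof -
  obtain d b where b: "orthonormal d b" "span (b ` {..<d}) = Y"
    using fin_dim_orthonormal_basis [OF Y] by blast
  \<comment> \<open>A compact subset of Y that contains the ball of radius r: linear combinations with coefficients bounded by r.\<close>
  define K where "K r = (\<lambda>c. \<Sum>i<d. c i *\<^sub>R b i) ` ({..<d} \<rightarrow>\<^sub>E {-r..r})" for r
  let ?E = "product_topology (\<lambda>_. euclidean) X :: ('a \<Rightarrow> 'b) topology"
  have K: "compactin euclidean (K r)" for r
    unfolding K_def
  proof (rule image_compactin)
    show "compactin (product_topology (\<lambda>_. euclideanreal) {..<d}) ({..<d} \<rightarrow>\<^sub>E {-r..r})"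
      by (simp add: compactin_PiE)
    have "continuous_map (product_topology (\<lambda>_. euclideanreal) {..<d}) euclidean (\<lambda>c. c i *\<^sub>R b i)"
      if "i \<in> {..<d}" for i
    proof -
      have "continuous_map (product_topology (\<lambda>_. euclideanreal) {..<d}) euclidean ((\<lambda>r. r *\<^sub>R b i) \<circ> (\<lambda>c. c i))"
        by (rule continuous_map_compose [where X' = euclideanreal])
          (use that in \<open>auto intro!: continuous_map_product_projection continuous_intros\<close>)
      then show ?thesis by (simp add: o_def)
    qed
    then show "continuous_map (product_topology (\<lambda>_. euclideanreal) {..<d}) euclidean
        (\<lambda>c. \<Sum>i<d. c i *\<^sub>R b i)"
      by (intro continuous_map_sum) auto
  qed
  have KY: "K r \<subseteq> Y" for r
  proof -
    have "(\<Sum>i<d. c i *\<^sub>R b i) \<in> Y" for c using frame_sum_mem [of c b d] b(2) by simp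
    then show ?thesis unfolding K_def by blast
  qed
  have YK: "y \<in> K (norm y)" if "y \<in> Y" for y
  proof -
    have "\<bar>inner y (b i)\<bar> \<le> norm y" if "i < d" for i
    proof -
      have "norm (b i) = 1" using b(1) that by (simp add: orthonormal_def norm_eq_1)
      then show ?thesis using Cauchy_Schwarz_ineq2 [of y "b i"] by simp
    qed
    then have "(\<lambda>i\<in>{..<d}. inner y (b i)) \<in> {..<d} \<rightarrow>\<^sub>E {- norm y..norm y}"
      by (auto simp: abs_le_iff minus_le_iff)
    moreover have "y = (\<Sum>i<d. (\<lambda>i\<in>{..<d}. inner y (b i)) i *\<^sub>R b i)"
      using orthonormal_expansion [OF b(1)] b(2) that by simp
    ultimately show ?thesis unfolding K_def by blast
  qed
  have "compactin ?E (Mor X Y)"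
  proof (rule closed_compactin)
    show c: "compactin ?E (\<Pi>\<^sub>E x\<in>X. K (norm x))"
      using K by (simp add: compactin_PiE)
    show "Mor X Y \<subseteq> (\<Pi>\<^sub>E x\<in>X. K (norm x))"
      using YK by (force simp: Mor_def PiE_def Pi_def)
    have H: "Hausdorff_space ?E" by (simp add: Hausdorff_space_product_topology)
    define A where "A x y s t = {f \<in> topspace ?E. f (s *\<^sub>R x + t *\<^sub>R y) - (s *\<^sub>R f x + t *\<^sub>R f y) \<in> {0}}"
      for x y :: 'a and s t :: real
    define N where "N x = {f \<in> topspace ?E. norm (f x) \<in> {norm x}}" for x
    have ev: "continuous_map ?E euclidean (\<lambda>f. f x)" if "x \<in> X" for x
      using that by (rule continuous_map_product_projection)
    have A: "closedin ?E (A x y s t)" if "x \<in> X" "y \<in> X" for x y s t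
      unfolding A_def
    proof (rule closedin_continuous_map_preimage)
      have "s *\<^sub>R x + t *\<^sub>R y \<in> X" using that X by (simp add: subspace_add subspace_scale)
      then show "continuous_map ?E euclidean (\<lambda>f. f (s *\<^sub>R x + t *\<^sub>R y) - (s *\<^sub>R f x + t *\<^sub>R f y))"
        using ev [OF that(1)] ev [OF that(2)] ev [of "s *\<^sub>R x + t *\<^sub>R y"]
        unfolding continuous_map_atin limitin_canonical_iff by (auto intro!: tendsto_intros)
    qed simp
    have N: "closedin ?E (N x)" if "x \<in> X" for x
      unfolding N_def
      by (rule closedin_continuous_map_preimage [where Y = euclideanreal])
        (use ev [OF that] in \<open>auto simp: continuous_map_atin intro!: tendsto_intros\<close>)
    have "Mor X Y = (\<Pi>\<^sub>E x\<in>X. K (norm x)) \<inter>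
        (\<Inter>(x, y, s, t)\<in>X \<times> X \<times> UNIV \<times> UNIV. A x y s t) \<inter> (\<Inter>x\<in>X. N x)" (is "_ = ?R")
    proof
      show "Mor X Y \<subseteq> ?R"
        using YK by (force simp: Mor_def PiE_def Pi_def A_def N_def)
      show "?R \<subseteq> Mor X Y"
      proof
        fix f assume f: "f \<in> ?R"
        show "f \<in> Mor X Y"
        proof (rule MorI)
          show "f x \<in> Y" if "x \<in> X" for x using f that KY by (blast dest: PiE_mem)
          show "f \<in> extensional X" using f by (auto simp: PiE_def)
          show "norm (f x) = norm x" if "x \<in> X" for x using f that by (auto simp: N_def)
          fix x y s t assume "x \<in> X" "y \<in> X"
          then have "f \<in> A x y s t" using f by fastforce
          then show "f (s *\<^sub>R x + t *\<^sub>R y) = s *\<^sub>R f x + t *\<^sub>R f y" by (simp add: A_def)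
        qed
      qed
    qed
    also have "closedin ?E \<dots>"
    proof (intro closedin_Int closedin_INT)
      show "closedin ?E (\<Pi>\<^sub>E x\<in>X. K (norm x))" using compactin_imp_closedin [OF H c] .
      show "X \<times> X \<times> UNIV \<times> UNIV \<noteq> {}" "X \<noteq> {}" using X subspace_0 by auto
    qed (use A N in auto)
    finally show "closedin ?E (Mor X Y)" .
  qed
  then show ?thesis unfolding Mor_top_def by (rule compact_space_subtopology)
qed

section \<open>Orthogonal representations\<close>

lemma
  assumes "orthogonal_rep G P"
  shows rep_subspace: "subspace (rspace P)"
    and rep_Mor: "\<And>g. g \<in> carrier G \<Longrightarrow> restrict (ract P g) (rspace P) \<in> Mor (rspace P) (rspace P)"
    and rep_one: "\<And>x. x \<in> rspace P \<Longrightarrow> ract P \<one>\<^bsub>G\<^esub> x = x"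
    and rep_mult: "\<And>g h x. g \<in> carrier G \<Longrightarrow> h \<in> carrier G \<Longrightarrow> x \<in> rspace P \<Longrightarrow>
      ract P (g \<otimes>\<^bsub>G\<^esub> h) x = ract P g (ract P h x)"
  using assms by (auto simp: orthogonal_rep_def)

lemma rep_mem:
  assumes "orthogonal_rep G P" "g \<in> carrier G" "x \<in> rspace P"
  shows "ract P g x \<in> rspace P"
  using Mor_mem [OF rep_Mor [OF assms(1,2)] assms(3)] assms(3) by simp

lemma rep_restrict_Mor:
  assumes P: "orthogonal_rep G P" and g: "g \<in> carrier G" and X: "subspace X" "X \<subseteq> rspace P"
    and Y: "ract P g ` X \<subseteq> Y"
  shows "restrict (ract P g) X \<in> Mor X Y"
proof (rule MorI)
  fix x y a b assume xy: "x \<in> X" "y \<in> X"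
  then have "a *\<^sub>R x + b *\<^sub>R y \<in> X" using X by (simp add: subspace_add subspace_scale)
  then show "restrict (ract P g) X (a *\<^sub>R x + b *\<^sub>R y) =
      a *\<^sub>R restrict (ract P g) X x + b *\<^sub>R restrict (ract P g) X y"
    using Mor_lin [OF rep_Mor [OF P g], of x y a b] xy X by (simp add: subset_iff)
next
  fix x assume x: "x \<in> X"
  then show "norm (restrict (ract P g) X x) = norm x"
    using Mor_norm [OF rep_Mor [OF P g], of x] X by (simp add: subset_iff)
qed (use Y in auto)

lemma rep_image_subspace:
  assumes "orthogonal_rep G P" "g \<in> carrier G" "subspace X" "X \<subseteq> rspace P"
  shows "subspace (ract P g ` X)"
  using Mor_image_subspace [OF rep_restrict_Mor [OF assms order_refl] assms(3)] by simp

lemma rep_image_fin_dim: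
  assumes "orthogonal_rep G P" "g \<in> carrier G" "fin_dim X" "X \<subseteq> rspace P"
  shows "fin_dim (ract P g ` X)"
  using fin_dim_Mor_image [OF rep_restrict_Mor [OF assms(1,2) fin_dim_subspace assms(4) order_refl]] assms(3)
  by simp

lemma rep_image_subset:
  "orthogonal_rep G P \<Longrightarrow> g \<in> carrier G \<Longrightarrow> X \<subseteq> rspace P \<Longrightarrow> ract P g ` X \<subseteq> rspace P"
  by (auto intro: rep_mem)

context group
begin

lemma rep_inv_left [simp]:
  "orthogonal_rep G P \<Longrightarrow> g \<in> carrier G \<Longrightarrow> x \<in> rspace P \<Longrightarrow> ract P (inv g) (ract P g x) = x"
  using rep_mult [of G P "inv g" g x] rep_one [of G P x] by simp

lemma rep_inv_right [simp]:
  "orthogonal_rep G P \<Longrightarrow> g \<in> carrier G \<Longrightarrow> x \<in> rspace P \<Longrightarrow> ract P g (ract P (inv g) x) = x"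
  using rep_mult [of G P g "inv g" x] rep_one [of G P x] by simp

lemma rep_image_mult:
  "orthogonal_rep G P \<Longrightarrow> g \<in> carrier G \<Longrightarrow> h \<in> carrier G \<Longrightarrow> X \<subseteq> rspace P \<Longrightarrow>
    ract P (g \<otimes> h) ` X = ract P g ` ract P h ` X"
  unfolding image_image by (rule image_cong) (auto simp: rep_mult)

lemma rep_image_one: "orthogonal_rep G P \<Longrightarrow> X \<subseteq> rspace P \<Longrightarrow> ract P \<one> ` X = X"
  by (force simp: rep_one subset_iff)

lemma rep_image_inv_left [simp]:
  "orthogonal_rep G P \<Longrightarrow> g \<in> carrier G \<Longrightarrow> X \<subseteq> rspace P \<Longrightarrow> ract P (inv g) ` ract P g ` X = X"
  using rep_image_mult [of P "inv g" g X] by (simp add: rep_image_one)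

lemma rep_image_inv_right [simp]:
  "orthogonal_rep G P \<Longrightarrow> g \<in> carrier G \<Longrightarrow> X \<subseteq> rspace P \<Longrightarrow> ract P g ` ract P (inv g) ` X = X"
  using rep_image_mult [of P g "inv g" X] by (simp add: rep_image_one)

text \<open>This equation, rather than the definition, describes a conjugate: it avoids inverses.\<close>

lemma conj_map_apply:
  assumes "orthogonal_rep G P" "a \<in> carrier G" "X \<subseteq> rspace P" "x \<in> X"
  shows "conj_map G P Q a X f (ract P a x) = ract Q a (f x)"
  using assms by (simp add: conj_map_def subset_iff)

lemma conj_map_Mor:
  assumes P: "orthogonal_rep G P" and Q: "orthogonal_rep G Q" and a: "a \<in> carrier G"
    and X: "subspace X" "X \<subseteq> rspace P" and Y: "subspace Y" "Y \<subseteq> rspace Q" and f: "f \<in> Mor X Y"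
  shows "conj_map G P Q a X f \<in> Mor (ract P a ` X) (ract Q a ` Y)"
proof -
  have aX: "subspace (ract P a ` X)" "ract P a ` X \<subseteq> rspace P"
    using rep_image_subspace [OF P a X] rep_image_subset [OF P a X(2)] by auto
  have "restrict (ract P (inv a)) (ract P a ` X) \<in> Mor (ract P a ` X) X"
    using rep_restrict_Mor [OF P _ aX, of "inv a" X] a P X by simp
  from Mor_compose [OF this f aX(1)]
  have "compose (ract P a ` X) f (restrict (ract P (inv a)) (ract P a ` X)) \<in> Mor (ract P a ` X) Y" .
  from Mor_compose [OF this rep_restrict_Mor [OF Q a Y order_refl] aX(1)]
  have "compose (ract P a ` X) (restrict (ract Q a) Y)
     (compose (ract P a ` X) f (restrict (ract P (inv a)) (ract P a ` X))) \<in> Mor (ract P a ` X) (ract Q a ` Y)" .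
  moreover have "compose (ract P a ` X) (restrict (ract Q a) Y)
     (compose (ract P a ` X) f (restrict (ract P (inv a)) (ract P a ` X))) = conj_map G P Q a X f"
    using P a X Mor_mem [OF f] by (auto simp: compose_def conj_map_def fun_eq_iff subset_iff)
  ultimately show ?thesis by simp
qed

lemma conj_map_mult:
  assumes P: "orthogonal_rep G P" and Q: "orthogonal_rep G Q" and a: "a \<in> carrier G" "b \<in> carrier G"
    and X: "X \<subseteq> rspace P" and f: "f \<in> X \<rightarrow> rspace Q"
  shows "conj_map G P Q b (ract P a ` X) (conj_map G P Q a X f) = conj_map G P Q (b \<otimes> a) X f"
proof (rule extensionalityI)
  show "conj_map G P Q b (ract P a ` X) (conj_map G P Q a X f) \<in> extensional (ract P (b \<otimes> a) ` X)"
    using rep_image_mult [OF P a(2,1) X] by (simp add: conj_map_def)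
  show "conj_map G P Q (b \<otimes> a) X f \<in> extensional (ract P (b \<otimes> a) ` X)" by (simp add: conj_map_def)
  fix y assume "y \<in> ract P (b \<otimes> a) ` X"
  then obtain x where x: "x \<in> X" and y: "y = ract P b (ract P a x)"
    using rep_image_mult [OF P a(2,1) X] by auto
  have xP: "x \<in> rspace P" using x X by blast
  have "conj_map G P Q b (ract P a ` X) (conj_map G P Q a X f) y = ract Q b (ract Q a (f x))"
    unfolding y using P a X x rep_image_subset [OF P a(1) X] by (simp add: conj_map_apply)
  moreover have "conj_map G P Q (b \<otimes> a) X f y = ract Q (b \<otimes> a) (f x)"
    unfolding y using conj_map_apply [OF P, of "b \<otimes> a" X x Q f] a X x xP by (simp add: rep_mult [OF P])
  moreover have "f x \<in> rspace Q" using f x by blast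
  ultimately show "conj_map G P Q b (ract P a ` X) (conj_map G P Q a X f) y = conj_map G P Q (b \<otimes> a) X f y"
    using a by (simp add: rep_mult [OF Q])
qed

lemma conj_map_one:
  assumes P: "orthogonal_rep G P" and Q: "orthogonal_rep G Q"
    and X: "X \<subseteq> rspace P" and f: "f \<in> Mor X Y" and Y: "Y \<subseteq> rspace Q"
  shows "conj_map G P Q \<one> X f = f"
proof (rule extensionalityI)
  show "conj_map G P Q \<one> X f \<in> extensional X"
    using rep_image_one [OF P X] by (simp add: conj_map_def)
  show "f \<in> extensional X" by (rule Mor_ext [OF f])
  fix x assume "x \<in> X"
  moreover from this have "f x \<in> rspace Q" using Mor_mem [OF f] Y by blast
  ultimately show "conj_map G P Q \<one> X f x = f x"
    using conj_map_apply [OF P one_closed X, of x Q f] X rep_one [OF P, of x] rep_one [OF Q] by auto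
qed

lemma conj_map_inv:
  assumes "orthogonal_rep G P" "orthogonal_rep G Q" "a \<in> carrier G"
    and "X \<subseteq> rspace P" "f \<in> Mor X Y" "Y \<subseteq> rspace Q"
  shows "conj_map G P Q (inv a) (ract P a ` X) (conj_map G P Q a X f) = f"
    and "conj_map G P Q a (ract P (inv a) ` X) (conj_map G P Q (inv a) X f) = f"
proof -
  have "f \<in> X \<rightarrow> rspace Q" using assms Mor_mem by blast
  then show "conj_map G P Q (inv a) (ract P a ` X) (conj_map G P Q a X f) = f"
    "conj_map G P Q a (ract P (inv a) ` X) (conj_map G P Q (inv a) X f) = f"
    using assms by (simp_all add: conj_map_mult conj_map_one)
qed

lemma conj_map_compose:
  assumes P: "orthogonal_rep G P" and Q: "orthogonal_rep G Q" and a: "a \<in> carrier G"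
    and X: "X \<subseteq> rspace P" and Y: "Y \<subseteq> rspace Q" and f: "f \<in> X \<rightarrow> Y"
  shows "conj_map G P R a X (compose X g f) =
    compose (ract P a ` X) (conj_map G Q R a Y g) (conj_map G P Q a X f)"
proof (rule extensionalityI [of _ "ract P a ` X"])
  fix y assume "y \<in> ract P a ` X"
  then obtain x where x: "x \<in> X" and y: "y = ract P a x" by auto
  have "f x \<in> Y" using f x by blast
  then show "conj_map G P R a X (compose X g f) y =
    compose (ract P a ` X) (conj_map G Q R a Y g) (conj_map G P Q a X f) y"
    unfolding y using x a P Q X Y by (simp add: conj_map_apply compose_def)
qed (auto simp: conj_map_def compose_def)

lemma conj_map_id:
  assumes "orthogonal_rep G P" "a \<in> carrier G" "X \<subseteq> rspace P"
  shows "conj_map G P P a X (\<lambda>x\<in>X. x) = (\<lambda>x\<in>ract P a ` X. x)"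
  by (rule extensionalityI [of _ "ract P a ` X"])
    (use assms in \<open>auto simp: conj_map_apply conj_map_def subset_iff\<close>)

lemma continuous_map_conj_map:
  assumes P: "orthogonal_rep G P" and Q: "orthogonal_rep G Q" and a: "a \<in> carrier G"
    and X: "subspace X" "X \<subseteq> rspace P" and Y: "subspace Y" "Y \<subseteq> rspace Q"
  shows "continuous_map (Mor_top X Y) (Mor_top (ract P a ` X) (ract Q a ` Y)) (conj_map G P Q a X)"
  unfolding continuous_map_into_Mor_top
proof (intro conjI ballI)
  show "conj_map G P Q a X f \<in> Mor (ract P a ` X) (ract Q a ` Y)" if "f \<in> topspace (Mor_top X Y)" for f
    using conj_map_Mor [OF P Q a X Y] that by simp
  fix y assume "y \<in> ract P a ` X"
  then obtain x where x: "x \<in> X" and y: "y = ract P a x" by auto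
  have "continuous_map (Mor_top X Y) euclidean (\<lambda>f. restrict (ract Q a) Y (f x))"
  proof (rule continuous_map_Mor_eval [where F = "\<lambda>_. restrict (ract Q a) Y"])
    show "continuous_map (Mor_top X Y) (Mor_top Y (ract Q a ` Y)) (\<lambda>_. restrict (ract Q a) Y)"
      by (rule continuous_map_Mor_const [OF rep_restrict_Mor [OF Q a Y order_refl]])
    show "continuous_map (Mor_top X Y) euclidean (\<lambda>f. f x)"
      by (rule continuous_map_Mor_point [OF x continuous_map_id [unfolded id_def]])
  qed (use x Y in \<open>auto intro: Mor_mem\<close>)
  then show "continuous_map (Mor_top X Y) euclidean (\<lambda>f. conj_map G P Q a X f y)"
    by (rule continuous_map_eq) (use x X a P in \<open>auto simp: y conj_map_apply Mor_mem\<close>)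
qed

end

subsection \<open>Sums of representations\<close>

lemma rspace_sum [simp]: "rspace (P \<oplus>\<^sub>r Q) = rspace P \<times> rspace Q"
  and ract_sum: "ract (P \<oplus>\<^sub>r Q) g = map_prod (ract P g) (ract Q g)"
  and ract_sum_apply [simp]: "ract (P \<oplus>\<^sub>r Q) g (x, y) = (ract P g x, ract Q g y)"
  by (simp_all add: rep_sum_def)

lemma ract_sum_image [simp]: "ract (P \<oplus>\<^sub>r Q) g ` (X \<times> Y) = (ract P g ` X) \<times> (ract Q g ` Y)"
  by (force simp: ract_sum)

lemma orthogonal_rep_sum:
  assumes P: "orthogonal_rep G P" and Q: "orthogonal_rep G Q"
  shows "orthogonal_rep G (P \<oplus>\<^sub>r Q)"
  unfolding orthogonal_rep_def
proof (intro conjI ballI)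
  show "subspace (rspace (P \<oplus>\<^sub>r Q))"
    using rep_subspace [OF P] rep_subspace [OF Q] by (simp add: subspace_Times)
  fix g assume g: "g \<in> carrier G"
  have lin: "ract R g (a *\<^sub>R x + b *\<^sub>R y) = a *\<^sub>R ract R g x + b *\<^sub>R ract R g y"
    if "orthogonal_rep G R" "x \<in> rspace R" "y \<in> rspace R" for R :: "('a, 'x::real_inner) rep" and x y a b
    using Mor_lin [OF rep_Mor [OF that(1) g] that(2,3)] that rep_subspace [OF that(1)]
    by (simp add: subspace_add subspace_scale)
  have nrm: "norm (ract R g x) = norm x"
    if "orthogonal_rep G R" "x \<in> rspace R" for R :: "('a, 'x::real_inner) rep" and x
    using Mor_norm [OF rep_Mor [OF that(1) g] that(2)] that by simp
  show "restrict (ract (P \<oplus>\<^sub>r Q) g) (rspace (P \<oplus>\<^sub>r Q)) \<in> Mor (rspace (P \<oplus>\<^sub>r Q)) (rspace (P \<oplus>\<^sub>r Q))"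
    by (rule MorI)
      (use P Q g rep_subspace [OF P] rep_subspace [OF Q] in
        \<open>auto simp: rep_mem lin nrm norm_Pair subspace_add subspace_scale\<close>)
qed (use P Q in \<open>auto simp: rep_one rep_mult\<close>)

lemma map_sum_Mor:
  assumes f: "f \<in> Mor W W'" and g: "g \<in> Mor U U'" and W: "subspace W" and U: "subspace U"
  shows "map_sum W U f g \<in> Mor (W \<times> U) (W' \<times> U')"
  by (rule MorI)
    (use W U Mor_mem [OF f] Mor_mem [OF g] Mor_lin [OF f] Mor_lin [OF g] Mor_norm [OF f] Mor_norm [OF g]
      in \<open>auto simp: map_sum_def norm_Pair subspace_add subspace_scale\<close>)

lemma map_sum_cong:
  "(\<And>w. w \<in> W \<Longrightarrow> f w = f' w) \<Longrightarrow> (\<And>u. u \<in> U \<Longrightarrow> g u = g' u) \<Longrightarrow>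
    map_sum W U f g = map_sum W U f' g'"
  by (auto simp: map_sum_def restrict_def fun_eq_iff)

lemma map_sum_id_left_Mor:
  "g \<in> Mor U U' \<Longrightarrow> subspace W \<Longrightarrow> subspace U \<Longrightarrow> map_sum W U (\<lambda>w. w) g \<in> Mor (W \<times> U) (W \<times> U')"
  using map_sum_Mor [OF Mor_id [OF order_refl], of W g U U'] map_sum_cong [of W "\<lambda>w\<in>W. w" "\<lambda>w. w" U g g]
  by simp

lemma map_sum_id_right_Mor:
  "f \<in> Mor W W' \<Longrightarrow> subspace W \<Longrightarrow> subspace U \<Longrightarrow> map_sum W U f (\<lambda>u. u) \<in> Mor (W \<times> U) (W' \<times> U)"
  using map_sum_Mor [OF _ Mor_id [OF order_refl], of f W W' U] map_sum_cong [of W f f U "\<lambda>u\<in>U. u" "\<lambda>u. u"]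
  by simp

lemma continuous_map_map_sum:
  assumes W: "subspace W" and U: "subspace U"
  shows "continuous_map (Mor_top W W') (Mor_top (W \<times> U) (W' \<times> U)) (\<lambda>f. map_sum W U f (\<lambda>u. u))"
  unfolding continuous_map_into_Mor_top
proof (intro conjI ballI)
  fix z assume z: "z \<in> W \<times> U"
  then have "continuous_map (Mor_top W W') (euclidean) (\<lambda>f. f (fst z))"
    by (intro continuous_map_Mor_point [OF _ continuous_map_id [unfolded id_def]]) auto
  then have "continuous_map (Mor_top W W') euclidean (\<lambda>f. (f (fst z), snd z))"
    by (simp add: continuous_map_atin tendsto_Pair)
  then show "continuous_map (Mor_top W W') euclidean (\<lambda>f. map_sum W U f (\<lambda>u. u) z)"
    using z by (simp add: map_sum_def map_prod_def case_prod_unfold)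
qed (use assms in \<open>auto intro: map_sum_id_right_Mor\<close>)

context group
begin

lemma conj_map_sum:
  assumes P: "orthogonal_rep G P" and Q: "orthogonal_rep G Q" and a: "a \<in> carrier G"
    and W: "W \<subseteq> rspace P" and U: "U \<subseteq> rspace Q"
  shows "conj_map G (P \<oplus>\<^sub>r Q) (P \<oplus>\<^sub>r Q) a (W \<times> U) (map_sum W U f g) =
    map_sum (ract P a ` W) (ract Q a ` U) (conj_map G P P a W f) (conj_map G Q Q a U g)"
proof (rule extensionalityI [of _ "ract (P \<oplus>\<^sub>r Q) a ` (W \<times> U)"])
  fix y assume "y \<in> ract (P \<oplus>\<^sub>r Q) a ` (W \<times> U)"
  then obtain w u where wu: "w \<in> W" "u \<in> U" and y: "y = ract (P \<oplus>\<^sub>r Q) a (w, u)" by auto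
  have "W \<times> U \<subseteq> rspace (P \<oplus>\<^sub>r Q)" using W U by auto
  from conj_map_apply [OF orthogonal_rep_sum [OF P Q] a this, of "(w, u)" _ "map_sum W U f g"] wu
  have "conj_map G (P \<oplus>\<^sub>r Q) (P \<oplus>\<^sub>r Q) a (W \<times> U) (map_sum W U f g) y = (ract P a (f w), ract Q a (g u))"
    by (simp add: y map_sum_def)
  then show "conj_map G (P \<oplus>\<^sub>r Q) (P \<oplus>\<^sub>r Q) a (W \<times> U) (map_sum W U f g) y =
    map_sum (ract P a ` W) (ract Q a ` U) (conj_map G P P a W f) (conj_map G Q Q a U g) y"
    using wu a P Q W U by (simp add: y map_sum_def conj_map_apply)
qed (auto simp: conj_map_def map_sum_def)

end

section \<open>The orbit category acting on representations\<close>

lemma complete_universe_rep: "complete_universe G \<U> \<Longrightarrow> orthogonal_rep G \<U>"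
  by (simp add: complete_universe_def)

lemma RepD:
  assumes "W \<in> Rep \<U> H"
  shows "subspace W" "fin_dim W" "W \<subseteq> rspace \<U>"
  using assms by (auto simp: Rep_def)

context group
begin

lemma Rep_image_eq:
  assumes U: "orthogonal_rep G \<U>" and H: "subgroup H G" and W: "W \<in> Rep \<U> H" and h: "h \<in> H"
  shows "ract \<U> h ` W = W"
proof
  show "ract \<U> h ` W \<subseteq> W" using W h by (auto simp: Rep_def)
  have "ract \<U> (inv h) ` W \<subseteq> W" using W subgroup.m_inv_closed [OF H h] by (auto simp: Rep_def)
  then have "ract \<U> h ` ract \<U> (inv h) ` W \<subseteq> ract \<U> h ` W" by blast
  then show "W \<subseteq> ract \<U> h ` W"
    using rep_image_inv_right [OF U _ RepD(3) [OF W], of h] subgroup.mem_carrier [OF H h] by simp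
qed

lemma orbit_mapD:
  assumes "orbit_map G a K H"
  shows "a \<in> carrier G" "subgroup K G" "subgroup H G" "\<And>k. k \<in> K \<Longrightarrow> a \<otimes> k \<otimes> inv a \<in> H"
  using assms by (auto simp: orbit_map_def)

lemma orbit_map_self: "subgroup H G \<Longrightarrow> h \<in> H \<Longrightarrow> orbit_map G h H H"
  unfolding orbit_map_def
  by (auto dest: subgroup.mem_carrier simp: subgroup.m_closed subgroup.m_inv_closed)

text \<open>A map of orbits \<open>G/K \<rightarrow> G/H\<close> induces \<open>Rep\<^sub>H \<rightarrow> Rep\<^sub>K\<close>: the subgroup \<open>K\<close> acts on \<open>a\<inverse>Z\<close> through its
  conjugate \<open>aKa\<inverse> \<le> H\<close>.\<close>

lemma Rep_pull:
  assumes U: "orthogonal_rep G \<U>" and o: "orbit_map G a K H" and Z: "Z \<in> Rep \<U> H"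
  shows "ract \<U> (inv a) ` Z \<in> Rep \<U> K"
proof -
  note o = orbit_mapD [OF o]
  note Z' = RepD [OF Z]
  have ia: "inv a \<in> carrier G" using o by simp
  have "ract \<U> k ` ract \<U> (inv a) ` Z \<subseteq> ract \<U> (inv a) ` Z" if "k \<in> K" for k
  proof -
    have k: "k \<in> carrier G" by (rule subgroup.mem_carrier [OF o(2) that])
    have "k \<otimes> inv a = inv a \<otimes> (a \<otimes> k \<otimes> inv a)"
      using o k by (simp add: m_assoc [symmetric])
    then have "ract \<U> k ` ract \<U> (inv a) ` Z = ract \<U> (inv a) ` ract \<U> (a \<otimes> k \<otimes> inv a) ` Z"
      using o k ia Z' U by (metis m_closed rep_image_mult)
    then show ?thesis using Rep_image_eq [OF U o(3) Z o(4) [OF that]] by simp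
  qed
  then show ?thesis
    using rep_image_subspace [OF U ia Z'(1,3)] rep_image_fin_dim [OF U ia Z'(2,3)]
      rep_image_subset [OF U ia Z'(3)]
    by (simp add: Rep_def)
qed

end

text \<open>A complete universe contains trivial representations of every finite dimension, so every
  finite-dimensional inner product space is isometric to an object of \<open>Rep\<^sub>H\<close> that is fixed pointwise
  by the whole group.\<close>

lemma trivial_model:
  fixes X :: "'b::real_inner set" and \<U> :: "('g, 'v::real_inner) rep"
  assumes U: "complete_universe G \<U>" and X: "fin_dim X"
  obtains Z i j where "Z \<in> Rep \<U> (carrier G)" "\<And>g z. g \<in> carrier G \<Longrightarrow> z \<in> Z \<Longrightarrow> ract \<U> g z = z"
    "i \<in> Mor X Z" "j \<in> Mor Z X" "\<And>x. x \<in> X \<Longrightarrow> j (i x) = x" "\<And>z. z \<in> Z \<Longrightarrow> i (j z) = z"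
proof -
  obtain d b where b: "orthonormal d b" "span (b ` {..<d}) = X"
    using fin_dim_orthonormal_basis [OF X] by blast
  have "orthogonal_matrix_rep G d (\<lambda>g i j. if i = j then 1 else 0)"
  proof -
    have "(\<Sum>k<d. (if k = i then 1 else 0) * (if k = j then 1 else 0)) = (if i = j then 1 else (0::real))"
      "(\<Sum>k<d. (if i = k then 1 else 0) * (if k = j then 1 else 0)) = (if i = j then 1 else (0::real))"
      if "i < d" "j < d" for i j
      using that by (simp_all add: if_distrib [of "\<lambda>x. x * _"] sum.delta sum.delta' cong: if_cong)
    then show ?thesis by (simp add: orthogonal_matrix_rep_def)
  qed
  then have "\<exists>e :: nat \<Rightarrow> nat \<Rightarrow> 'v.
      (\<forall>k. \<forall>i<d. e k i \<in> rspace \<U>) \<and>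
      (\<forall>k l. \<forall>i<d. \<forall>j<d. inner (e k i) (e l j) = (if k = l \<and> i = j then 1 else 0)) \<and>
      (\<forall>g\<in>carrier G. \<forall>k. \<forall>j<d. ract \<U> g (e k j) = (\<Sum>i<d. (if i = j then 1 else 0) *\<^sub>R e k i))"
    using U unfolding complete_universe_def by (elim conjE allE) (erule (1) mp)
  then obtain e :: "nat \<Rightarrow> nat \<Rightarrow> 'v" where
    e1: "\<forall>k. \<forall>i<d. e k i \<in> rspace \<U>" and
    e2: "\<forall>k l. \<forall>i<d. \<forall>j<d. inner (e k i) (e l j) = (if k = l \<and> i = j then 1 else 0)" and
    e3: "\<forall>g\<in>carrier G. \<forall>k. \<forall>j<d. ract \<U> g (e k j) = (\<Sum>i<d. (if i = j then 1 else 0) *\<^sub>R e k i)"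
    by (elim exE conjE) (rule that)
  have e: "\<And>k i. i < d \<Longrightarrow> e k i \<in> rspace \<U>" using e1 by simp
  \<comment> \<open>One of the copies of the trivial representation suffices; the copy with index 0 is taken.\<close>
  define Z where "Z = span (e 0 ` {..<d})"
  have oe: "orthonormal d (e 0)" using e2 by (simp add: orthonormal_def)
  have Ur: "orthogonal_rep G \<U>" by (rule complete_universe_rep [OF U])
  have ZU: "Z \<subseteq> rspace \<U>"
    unfolding Z_def by (rule span_minimal) (use e rep_subspace [OF Ur] in auto)
  have fix_e: "ract \<U> g (e 0 j) = e 0 j" if "g \<in> carrier G" "j < d" for g j
    using bspec [OF e3 that(1)] that(2) by (simp add: if_distrib if_distribR cong: if_cong)
  have "z \<in> rspace \<U> \<and> ract \<U> g z = z" if g: "g \<in> carrier G" and z: "z \<in> Z" for g z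
    using z unfolding Z_def
  proof (induction rule: span_induct_alt)
    case base
    then show ?case
      using Mor_zero [OF rep_Mor [OF Ur g]] rep_subspace [OF Ur] by (simp add: subspace_0)
  next
    case (step c x y)
    then have xy: "x \<in> rspace \<U>" "y \<in> rspace \<U>" using e by auto
    have "ract \<U> g (c *\<^sub>R x + 1 *\<^sub>R y) = c *\<^sub>R ract \<U> g x + 1 *\<^sub>R ract \<U> g y"
      using Mor_lin [OF rep_Mor [OF Ur g] xy, of c 1] xy rep_subspace [OF Ur]
      by (simp add: subspace_add subspace_scale)
    moreover have "ract \<U> g x = x" using step g fix_e by auto
    ultimately show ?case using step xy rep_subspace [OF Ur]
      by (simp add: subspace_add subspace_scale)
  qed
  then have fix_Z: "\<And>g z. g \<in> carrier G \<Longrightarrow> z \<in> Z \<Longrightarrow> ract \<U> g z = z" by blast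
  show thesis
  proof
    show "Z \<in> Rep \<U> (carrier G)"
      using ZU fix_Z by (auto simp: Rep_def Z_def fin_dim_def)
    show "frame_map d b (e 0) \<in> Mor X Z" "frame_map d (e 0) b \<in> Mor Z X"
      using frame_map_Mor [OF b(1) oe] frame_map_Mor [OF oe b(1)] b(2) by (auto simp: Z_def)
  qed (use b frame_map_inverse [OF b(1) oe] frame_map_inverse [OF oe b(1)] fix_Z in \<open>auto simp: Z_def\<close>)
qed

section \<open>Equivariant Weiss functors\<close>

locale weiss_functor = group G for G :: "('g, 'm) monoid_scheme" (structure) +
  fixes \<U> :: "('g, 'v::real_inner) rep" and E :: "('g, 'v, 'p) weiss"
  assumes universe: "complete_universe G \<U>" and one_morphism: "one_morphism G \<U> E"
begin

lemma universe_rep: "orthogonal_rep G \<U>"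
  by (rule complete_universe_rep [OF universe])

lemma functorD: "subgroup H G \<Longrightarrow> enriched_functor G \<U> H (obj E H) (mor E H)"
  using one_morphism by (simp add: one_morphism_def)

lemma pointed: "subgroup H G \<Longrightarrow> W \<in> Rep \<U> H \<Longrightarrow> pointed_gspace G H (obj E H W)"
  using functorD unfolding enriched_functor_def by blast

lemma pt0_mem: "subgroup H G \<Longrightarrow> W \<in> Rep \<U> H \<Longrightarrow> pt0 (obj E H W) \<in> topspace (tp (obj E H W))"
  using pointed by (simp add: pointed_gspace_def)

lemma mor_cont: "subgroup H G \<Longrightarrow> W \<in> Rep \<U> H \<Longrightarrow> W' \<in> Rep \<U> H \<Longrightarrow>
    continuous_map (prod_topology (Mor_top W W') (tp (obj E H W))) (tp (obj E H W'))
      (\<lambda>(f, x). mor E H W W' f x)"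
  using functorD unfolding enriched_functor_def by blast

lemma mor_mem:
  assumes "subgroup H G" "W \<in> Rep \<U> H" "W' \<in> Rep \<U> H" "f \<in> Mor W W'" "x \<in> topspace (tp (obj E H W))"
  shows "mor E H W W' f x \<in> topspace (tp (obj E H W'))"
  using continuous_map_funspace [OF mor_cont [OF assms(1-3)]] assms(4,5) by (auto simp: Pi_iff)

lemma mor_pt0: "subgroup H G \<Longrightarrow> W \<in> Rep \<U> H \<Longrightarrow> W' \<in> Rep \<U> H \<Longrightarrow> f \<in> Mor W W' \<Longrightarrow>
    mor E H W W' f (pt0 (obj E H W)) = pt0 (obj E H W')"
  using functorD unfolding enriched_functor_def by blast

lemma mor_id: "subgroup H G \<Longrightarrow> W \<in> Rep \<U> H \<Longrightarrow> x \<in> topspace (tp (obj E H W)) \<Longrightarrow>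
    mor E H W W (\<lambda>w\<in>W. w) x = x"
  using functorD unfolding enriched_functor_def by blast

lemma mor_comp:
  "subgroup H G \<Longrightarrow> W \<in> Rep \<U> H \<Longrightarrow> W' \<in> Rep \<U> H \<Longrightarrow> W'' \<in> Rep \<U> H \<Longrightarrow> f \<in> Mor W W' \<Longrightarrow>
    g \<in> Mor W' W'' \<Longrightarrow> x \<in> topspace (tp (obj E H W)) \<Longrightarrow>
    mor E H W W'' (compose W g f) x = mor E H W' W'' g (mor E H W W' f x)"
  using functorD unfolding enriched_functor_def by blast

lemma cmp_homeo:
  "orbit_map G a K H \<Longrightarrow> V \<in> Rep \<U> K \<Longrightarrow> ract \<U> a ` V \<in> Rep \<U> H \<Longrightarrow>
    homeomorphic_map (tp (obj E K V)) (tp (obj E H (ract \<U> a ` V))) (cmp E a K H V)"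
  using one_morphism [unfolded one_morphism_def, THEN conjunct2, THEN conjunct1, rule_format, of a K H V] by simp

lemma cmp_mem:
  assumes "orbit_map G a K H" "V \<in> Rep \<U> K" "ract \<U> a ` V \<in> Rep \<U> H" "x \<in> topspace (tp (obj E K V))"
  shows "cmp E a K H V x \<in> topspace (tp (obj E H (ract \<U> a ` V)))"
  using homeomorphic_imp_surjective_map [OF cmp_homeo [OF assms(1-3)]] assms(4) by blast

lemma cmp_pt0:
  "orbit_map G a K H \<Longrightarrow> V \<in> Rep \<U> K \<Longrightarrow> ract \<U> a ` V \<in> Rep \<U> H \<Longrightarrow>
    cmp E a K H V (pt0 (obj E K V)) = pt0 (obj E H (ract \<U> a ` V))"
  using one_morphism [unfolded one_morphism_def, THEN conjunct2, THEN conjunct1, rule_format, of a K H V] by simp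

lemma cmp_mor:
  "orbit_map G a K H \<Longrightarrow> V \<in> Rep \<U> K \<Longrightarrow> V' \<in> Rep \<U> K \<Longrightarrow> ract \<U> a ` V \<in> Rep \<U> H \<Longrightarrow>
    ract \<U> a ` V' \<in> Rep \<U> H \<Longrightarrow> f \<in> Mor V V' \<Longrightarrow> x \<in> topspace (tp (obj E K V)) \<Longrightarrow>
    cmp E a K H V' (mor E K V V' f x) =
      mor E H (ract \<U> a ` V) (ract \<U> a ` V') (conj_map G \<U> \<U> a V f) (cmp E a K H V x)"
  using one_morphism [unfolded one_morphism_def, THEN conjunct2, THEN conjunct2, THEN conjunct1, rule_format, of a K H V V' f x] by simp

lemma cmp_cmp:
  "orbit_map G b L K \<Longrightarrow> orbit_map G a K H \<Longrightarrow> V \<in> Rep \<U> L \<Longrightarrow> ract \<U> b ` V \<in> Rep \<U> K \<Longrightarrow>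
    ract \<U> (a \<otimes> b) ` V \<in> Rep \<U> H \<Longrightarrow> x \<in> topspace (tp (obj E L V)) \<Longrightarrow>
    cmp E (a \<otimes> b) L H V x = cmp E a K H (ract \<U> b ` V) (cmp E b L K V x)"
  using one_morphism [unfolded one_morphism_def, THEN conjunct2, THEN conjunct2, THEN conjunct2, THEN conjunct1, rule_format, of b L K a H V x] by simp

lemma cmp_act:
  "subgroup H G \<Longrightarrow> h \<in> H \<Longrightarrow> V \<in> Rep \<U> H \<Longrightarrow> x \<in> topspace (tp (obj E H V)) \<Longrightarrow>
    cmp E h H H V x = act (obj E H V) h x"
  using one_morphism [unfolded one_morphism_def, THEN conjunct2, THEN conjunct2, THEN conjunct2, THEN conjunct2, rule_format, of h H V x] by simp

end

section \<open>The right Kan extension\<close>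

lemma topspace_kan_top: "topspace (kan_top \<U> E H X) = Kan ` kan_set \<U> E H X"
  by (auto simp: kan_top_def topspace_pullback_topology kan_set_def)

lemma kan_fam_set: "p \<in> topspace (kan_top \<U> E H X) \<Longrightarrow> kan_fam p \<in> kan_set \<U> E H X"
  and kan_fam_Kan: "p \<in> topspace (kan_top \<U> E H X) \<Longrightarrow> Kan (kan_fam p) = p"
  by (auto simp: topspace_kan_top)

lemma kan_fam_cmaps:
  "p \<in> topspace (kan_top \<U> E H X) \<Longrightarrow> Z \<in> Rep \<U> H \<Longrightarrow>
    kan_fam p Z \<in> cmaps (Mor_top X Z) (tp (obj E H Z))"
  by (drule kan_fam_set) (auto simp: kan_set_def)

lemma kan_fam_mem:
  "p \<in> topspace (kan_top \<U> E H X) \<Longrightarrow> Z \<in> Rep \<U> H \<Longrightarrow> f \<in> Mor X Z \<Longrightarrow>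
    kan_fam p Z f \<in> topspace (tp (obj E H Z))"
  using kan_fam_cmaps [of p \<U> E H X Z] by (auto simp: cmaps_def continuous_map_def)

lemma kan_fam_natural:
  "p \<in> topspace (kan_top \<U> E H X) \<Longrightarrow> Z \<in> Rep \<U> H \<Longrightarrow> Z' \<in> Rep \<U> H \<Longrightarrow> u \<in> Mor Z Z' \<Longrightarrow> f \<in> Mor X Z \<Longrightarrow>
    kan_fam p Z' (compose X u f) = mor E H Z Z' u (kan_fam p Z f)"
  by (drule kan_fam_set) (auto simp: kan_set_def)

text \<open>A point of the Kan extension is determined by the values of its family, because the families are
  extensional in both arguments.\<close>

lemma kan_restrict_eq:
  assumes p: "p \<in> topspace (kan_top \<U> E H X)"
    and h: "\<And>Z f. Z \<in> Rep \<U> H \<Longrightarrow> f \<in> Mor X Z \<Longrightarrow> h Z f = kan_fam p Z f"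
  shows "Kan (\<lambda>Z\<in>Rep \<U> H. \<lambda>f\<in>Mor X Z. h Z f) = p"
proof -
  have "(\<lambda>Z\<in>Rep \<U> H. \<lambda>f\<in>Mor X Z. h Z f) = kan_fam p"
  proof (rule extensionalityI)
    show "kan_fam p \<in> extensional (Rep \<U> H)"
      using kan_fam_set [OF p] by (simp add: kan_set_def PiE_def)
    fix Z assume Z: "Z \<in> Rep \<U> H"
    have "kan_fam p Z \<in> extensional (Mor X Z)"
      using kan_fam_cmaps [OF p Z] by (simp add: cmaps_def)
    then show "(\<lambda>Z\<in>Rep \<U> H. \<lambda>f\<in>Mor X Z. h Z f) Z = kan_fam p Z"
      using Z h by (auto intro: extensionalityI)
  qed simp
  then show ?thesis using kan_fam_Kan [OF p] by simp
qed

lemma continuous_map_kan_fam: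
  assumes Z: "Z \<in> Rep \<U> H" and f: "f \<in> Mor X Z"
  shows "continuous_map (kan_top \<U> E H X) (tp (obj E H Z)) (\<lambda>p. kan_fam p Z f)"
proof -
  have "continuous_map (product_topology (\<lambda>Z. compact_open_topology (Mor_top X Z) (tp (obj E H Z))) (Rep \<U> H))
      (tp (obj E H Z)) ((\<lambda>k. k f) \<circ> (\<lambda>x. x Z))"
    by (rule continuous_map_compose [OF continuous_map_product_projection [OF Z] continuous_map_eval_at])
      (simp add: f)
  from continuous_map_pullback [OF this] show ?thesis
    unfolding kan_top_def by (simp add: o_def)
qed

text \<open>The universal property of the end as a topological statement: by currying, a jointly continuous
  family of natural transformations is a continuous map into the Kan extension.\<close>

lemma continuous_map_into_kan:
  assumes X: "subspace X"
    and cont: "\<And>Z. Z \<in> Rep \<U> H \<Longrightarrow>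
      continuous_map (prod_topology P (Mor_top X Z)) (tp (obj E H Z)) (\<lambda>(p, f). h p Z f)"
    and nat: "\<And>p Z Z' u f. p \<in> topspace P \<Longrightarrow> Z \<in> Rep \<U> H \<Longrightarrow> Z' \<in> Rep \<U> H \<Longrightarrow> u \<in> Mor Z Z' \<Longrightarrow>
      f \<in> Mor X Z \<Longrightarrow> h p Z' (compose X u f) = mor E H Z Z' u (h p Z f)"
  shows "continuous_map P (kan_top \<U> E H X) (\<lambda>p. Kan (\<lambda>Z\<in>Rep \<U> H. \<lambda>f\<in>Mor X Z. h p Z f))"
proof -
  have curry: "continuous_map P (compact_open_topology (Mor_top X Z) (tp (obj E H Z)))
      (\<lambda>p. \<lambda>f\<in>Mor X Z. h p Z f)" if "Z \<in> Rep \<U> H" for Z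
    using continuous_map_curry [OF cont [OF that]] by simp
  have cm: "(\<lambda>f\<in>Mor X Z. h p Z f) \<in> cmaps (Mor_top X Z) (tp (obj E H Z))"
    if "p \<in> topspace P" "Z \<in> Rep \<U> H" for p Z
    using continuous_map_funspace [OF curry [OF that(2)]] that(1) by auto
  show ?thesis
    unfolding kan_top_def
  proof (rule continuous_map_pullback')
    show "continuous_map P (product_topology (\<lambda>Z. compact_open_topology (Mor_top X Z) (tp (obj E H Z))) (Rep \<U> H))
        (kan_fam \<circ> (\<lambda>p. Kan (\<lambda>Z\<in>Rep \<U> H. \<lambda>f\<in>Mor X Z. h p Z f)))"
      by (simp add: o_def continuous_map_componentwise curry image_subset_iff)
    show "topspace P \<subseteq> (\<lambda>p. Kan (\<lambda>Z\<in>Rep \<U> H. \<lambda>f\<in>Mor X Z. h p Z f)) -` Kan ` kan_set \<U> E H X"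
    proof
      fix p assume p: "p \<in> topspace P"
      have "(\<lambda>Z\<in>Rep \<U> H. \<lambda>f\<in>Mor X Z. h p Z f) \<in> kan_set \<U> E H X"
        unfolding kan_set_def using cm [OF p] nat [OF p]
        by (auto simp: Mor_compose [OF _ _ X])
      then show "p \<in> (\<lambda>p. Kan (\<lambda>Z\<in>Rep \<U> H. \<lambda>f\<in>Mor X Z. h p Z f)) -` Kan ` kan_set \<U> E H X"
        by blast
    qed
  qed
qed

lemma kan_memI:
  assumes X: "subspace X"
    and cont: "\<And>Z. Z \<in> Rep \<U> H \<Longrightarrow> continuous_map (Mor_top X Z) (tp (obj E H Z)) (h Z)"
    and nat: "\<And>Z Z' u f. Z \<in> Rep \<U> H \<Longrightarrow> Z' \<in> Rep \<U> H \<Longrightarrow> u \<in> Mor Z Z' \<Longrightarrow>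
      f \<in> Mor X Z \<Longrightarrow> h Z' (compose X u f) = mor E H Z Z' u (h Z f)"
  shows "Kan (\<lambda>Z\<in>Rep \<U> H. \<lambda>f\<in>Mor X Z. h Z f) \<in> topspace (kan_top \<U> E H X)"
proof -
  \<comment> \<open>A single point is a family over the one-point space.\<close>
  have c: "continuous_map (prod_topology (discrete_topology {()}) (Mor_top X Z)) (tp (obj E H Z)) (\<lambda>(p, f). h Z f)"
    if "Z \<in> Rep \<U> H" for Z
    using continuous_map_compose [OF continuous_map_snd cont [OF that]] by (simp add: o_def case_prod_unfold)
  have "continuous_map (discrete_topology {()}) (kan_top \<U> E H X)
      (\<lambda>p. Kan (\<lambda>Z\<in>Rep \<U> H. \<lambda>f\<in>Mor X Z. h Z f))"
    by (rule continuous_map_into_kan [OF X c nat])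
  from continuous_map_funspace [OF this] show ?thesis by auto
qed

locale kan_functor = weiss_functor G \<U> E
  for G :: "('g, 'm) monoid_scheme" (structure) and \<U> :: "('g, 'v::real_inner) rep"
    and E :: "('g, 'v, ('x, 'v, 'a::real_inner) point) weiss"
begin

text \<open>The isometric model of \<open>X\<close> lies in \<open>Rep\<^sub>H\<close> for all subgroups \<open>H\<close> simultaneously and does not move
  under \<open>G\<close>, which makes it possible to compare Kan extensions for different subgroups.\<close>

lemma kan_model:
  fixes X :: "('v \<times> 'a) set"
  assumes "fin_dim X"
  obtains Z i j where "\<And>H. subgroup H G \<Longrightarrow> Z \<in> Rep \<U> H" "\<And>g. g \<in> carrier G \<Longrightarrow> ract \<U> g ` Z = Z"
    "i \<in> Mor X Z" "j \<in> Mor Z X" "\<And>x. x \<in> X \<Longrightarrow> j (i x) = x" "\<And>z. z \<in> Z \<Longrightarrow> i (j z) = z"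
proof -
  obtain Z i j where *: "Z \<in> Rep \<U> (carrier G)" "\<And>g z. g \<in> carrier G \<Longrightarrow> z \<in> Z \<Longrightarrow> ract \<U> g z = z"
    "i \<in> Mor X Z" "j \<in> Mor Z X" "\<And>x. x \<in> X \<Longrightarrow> j (i x) = x" "\<And>z. z \<in> Z \<Longrightarrow> i (j z) = z"
    using trivial_model [OF universe assms] by metis
  show thesis
  proof (rule that [of Z i j])
    show "Z \<in> Rep \<U> H" if "subgroup H G" for H
      using *(1) subgroup.subset [OF that] unfolding Rep_def by blast
  qed (use * in \<open>auto simp: image_iff\<close>)
qed

text \<open>The Yoneda lemma. Although \<open>X\<close> need not be invariant, it is isomorphic to an object \<open>Z0\<close> of \<open>Rep\<^sub>H\<close>
  since morphisms of \<open>Rep\<^sub>H\<close> are not required to be equivariant; a natural transformation out of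
  \<open>Mor(X, -)\<close> is then determined by its value at an isomorphism \<open>i\<close>.\<close>

lemma kan_yoneda:
  assumes H: "subgroup H G" and X: "subspace X" and p: "p \<in> topspace (kan_top \<U> E H X)"
    and Z0: "Z0 \<in> Rep \<U> H" and ij: "i \<in> Mor X Z0" "j \<in> Mor Z0 X" "\<And>x. x \<in> X \<Longrightarrow> j (i x) = x"
    and Z: "Z \<in> Rep \<U> H" and f: "f \<in> Mor X Z"
  shows "kan_fam p Z f = mor E H Z0 Z (compose Z0 f j) (kan_fam p Z0 i)"
proof -
  have "compose Z0 f j \<in> Mor Z0 Z" by (rule Mor_compose [OF ij(2) f RepD(1) [OF Z0]])
  from kan_fam_natural [OF p Z0 Z this ij(1)]
  have "kan_fam p Z (compose X (compose Z0 f j) i) = mor E H Z0 Z (compose Z0 f j) (kan_fam p Z0 i)" .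
  moreover have "compose X (compose Z0 f j) i = f"
    by (rule extensionalityI [of _ X])
      (use f ij in \<open>auto simp: compose_def Mor_mem Mor_ext\<close>)
  ultimately show ?thesis by simp
qed

text \<open>The Yoneda description expresses evaluation through the jointly continuous functoriality of \<open>E\<close>.\<close>

lemma kan_eval_joint:
  assumes H: "subgroup H G" and X: "fin_dim X" and Z: "Z \<in> Rep \<U> H"
  shows "continuous_map (prod_topology (kan_top \<U> E H X) (Mor_top X Z)) (tp (obj E H Z))
    (\<lambda>(p, f). kan_fam p Z f)"
proof -
  obtain Z0 i j where Z0: "Z0 \<in> Rep \<U> H" and ij: "i \<in> Mor X Z0" "j \<in> Mor Z0 X" "\<And>x. x \<in> X \<Longrightarrow> j (i x) = x"
    using kan_model [OF X] H by metis
  let ?P = "prod_topology (kan_top \<U> E H X) (Mor_top X Z)"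
  have sX: "subspace X" by (rule fin_dim_subspace [OF X])
  have c1: "continuous_map ?P (Mor_top Z0 Z) (\<lambda>q. compose Z0 (snd q) j)"
    by (rule continuous_map_Mor_compose [OF continuous_map_snd continuous_map_Mor_const [OF ij(2)] RepD(1) [OF Z0] sX])
  have c2: "continuous_map ?P (tp (obj E H Z0)) (\<lambda>q. kan_fam (fst q) Z0 i)"
    using continuous_map_compose [OF continuous_map_fst continuous_map_kan_fam [OF Z0 ij(1)]]
    by (simp add: o_def)
  show ?thesis
    by (rule continuous_map_eq [OF continuous_map_apply2 [OF mor_cont [OF H Z0 Z] c1 c2]])
      (use kan_yoneda [OF H sX _ Z0 ij Z] in auto)
qed

text \<open>The inverse sends \<open>y\<close> to the transformation \<open>f \<mapsto> E(f i\<inverse>) y\<close>.\<close>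

lemma kan_eval_homeo:
  assumes H: "subgroup H G" and X: "subspace X" and Z0: "Z0 \<in> Rep \<U> H"
    and ij: "i \<in> Mor X Z0" "j \<in> Mor Z0 X" "\<And>x. x \<in> X \<Longrightarrow> j (i x) = x" "\<And>z. z \<in> Z0 \<Longrightarrow> i (j z) = z"
  shows "homeomorphic_map (kan_top \<U> E H X) (tp (obj E H Z0)) (\<lambda>p. kan_fam p Z0 i)"
proof -
  define g where "g y = Kan (\<lambda>Z\<in>Rep \<U> H. \<lambda>f\<in>Mor X Z. mor E H Z0 Z (compose Z0 f j) y)" for y
  have sZ0: "subspace Z0" by (rule RepD(1) [OF Z0])
  have g: "continuous_map (tp (obj E H Z0)) (kan_top \<U> E H X) g"
    unfolding g_def
  proof (rule continuous_map_into_kan [OF X])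
    fix Z assume Z: "Z \<in> Rep \<U> H"
    let ?P = "prod_topology (tp (obj E H Z0)) (Mor_top X Z)"
    have "continuous_map ?P (Mor_top Z0 Z) (\<lambda>q. compose Z0 (snd q) j)"
      by (rule continuous_map_Mor_compose [OF continuous_map_snd continuous_map_Mor_const [OF ij(2)] sZ0 X])
    from continuous_map_apply2 [OF mor_cont [OF H Z0 Z] this continuous_map_fst]
    show "continuous_map ?P (tp (obj E H Z)) (\<lambda>(y, f). mor E H Z0 Z (compose Z0 f j) y)"
      by (simp add: case_prod_unfold)
  next
    fix y Z Z' u f
    assume y: "y \<in> topspace (tp (obj E H Z0))" and Z: "Z \<in> Rep \<U> H" "Z' \<in> Rep \<U> H"
      and u: "u \<in> Mor Z Z'" and f: "f \<in> Mor X Z"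
    have "compose Z0 (compose X u f) j = compose Z0 u (compose Z0 f j)"
      using ij by (auto simp: compose_def fun_eq_iff Mor_mem)
    then show "mor E H Z0 Z' (compose Z0 (compose X u f) j) y = mor E H Z Z' u (mor E H Z0 Z (compose Z0 f j) y)"
      using mor_comp [OF H Z0 Z Mor_compose [OF ij(2) f sZ0] u y] by simp
  qed
  have "homeomorphic_maps (kan_top \<U> E H X) (tp (obj E H Z0)) (\<lambda>p. kan_fam p Z0 i) g"
    unfolding homeomorphic_maps_def
  proof (intro conjI ballI)
    show "continuous_map (kan_top \<U> E H X) (tp (obj E H Z0)) (\<lambda>p. kan_fam p Z0 i)"
      by (rule continuous_map_kan_fam [OF Z0 ij(1)])
    show "g (kan_fam p Z0 i) = p" if p: "p \<in> topspace (kan_top \<U> E H X)" for p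
      unfolding g_def
      by (rule kan_restrict_eq [OF p]) (rule kan_yoneda [OF H X p Z0 ij(1-3), symmetric])
    show "kan_fam (g y) Z0 i = y" if y: "y \<in> topspace (tp (obj E H Z0))" for y
    proof -
      have "compose Z0 i j = (\<lambda>z\<in>Z0. z)" using ij by (auto simp: compose_def)
      then show ?thesis using Z0 ij(1) mor_id [OF H Z0 y] by (simp add: g_def)
    qed
  qed (rule g)
  then show ?thesis by (rule homeomorphic_maps_imp_map)
qed

lemma kan_base_mem:
  assumes "subgroup H G" "subspace X"
  shows "kan_base \<U> E H X \<in> topspace (kan_top \<U> E H X)"
  unfolding kan_base_def
  by (rule kan_memI [OF assms(2)]) (use assms pt0_mem mor_pt0 in auto)

lemma kan_mor_continuous:
  assumes H: "subgroup H G" and X: "fin_dim X" and X': "subspace X'"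
  shows "continuous_map (prod_topology (Mor_top X X') (kan_top \<U> E H X)) (kan_top \<U> E H X')
    (\<lambda>(m, p). kan_mor \<U> H X X' m p)"
proof -
  have sX: "subspace X" by (rule fin_dim_subspace [OF X])
  have "continuous_map (prod_topology (Mor_top X X') (kan_top \<U> E H X)) (kan_top \<U> E H X')
     (\<lambda>q. Kan (\<lambda>Z\<in>Rep \<U> H. \<lambda>f\<in>Mor X' Z. kan_fam (snd q) Z (compose X f (fst q))))"
  proof (rule continuous_map_into_kan [OF X'])
    fix Z assume Z: "Z \<in> Rep \<U> H"
    let ?P = "prod_topology (prod_topology (Mor_top X X') (kan_top \<U> E H X)) (Mor_top X' Z)"
    have c: "continuous_map ?P (Mor_top X Z) (\<lambda>q. compose X (snd q) (fst (fst q)))"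
      by (rule continuous_map_Mor_compose [OF continuous_map_snd continuous_map_fst_fst sX X'])
    have "continuous_map ?P (kan_top \<U> E H X) (\<lambda>q. snd (fst q))"
      by (rule continuous_map_snd_fst)
    from continuous_map_apply2 [OF kan_eval_joint [OF H X Z] this c]
    show "continuous_map ?P (tp (obj E H Z)) (\<lambda>(q, f). kan_fam (snd q) Z (compose X f (fst q)))"
      by (simp add: case_prod_unfold)
  next
    fix q Z Z' u f
    assume q: "q \<in> topspace (prod_topology (Mor_top X X') (kan_top \<U> E H X))" and Z: "Z \<in> Rep \<U> H" "Z' \<in> Rep \<U> H"
      and u: "u \<in> Mor Z Z'" and f: "f \<in> Mor X' Z"
    obtain m p where [simp]: "q = (m, p)" by (cases q)
    have m: "m \<in> Mor X X'" and p: "p \<in> topspace (kan_top \<U> E H X)" using q by auto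
    have "compose X (compose X' u f) m = compose X u (compose X f m)"
      using m by (auto simp: compose_def fun_eq_iff Mor_mem)
    then show "kan_fam (snd q) Z' (compose X (compose X' u f) (fst q)) =
        mor E H Z Z' u (kan_fam (snd q) Z (compose X f (fst q)))"
      using kan_fam_natural [OF p Z u Mor_compose [OF m f sX]] by simp
  qed
  then show ?thesis by (simp add: kan_mor_def case_prod_unfold)
qed

lemma kan_mor_mem:
  assumes "subgroup H G" "fin_dim X" "subspace X'" "m \<in> Mor X X'" "p \<in> topspace (kan_top \<U> E H X)"
  shows "kan_mor \<U> H X X' m p \<in> topspace (kan_top \<U> E H X')"
  using continuous_map_funspace [OF kan_mor_continuous [OF assms(1-3)]] assms(4,5) by (auto simp: Pi_iff)

lemma kan_mor_base:
  assumes "subgroup H G" "subspace X" "m \<in> Mor X X'"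
  shows "kan_mor \<U> H X X' m (kan_base \<U> E H X) = kan_base \<U> E H X'"
  unfolding kan_mor_def kan_base_def
  using Mor_compose [OF assms(3) _ assms(2)] by (auto simp: restrict_def fun_eq_iff)

end

lemma kan_mor_comp:
  fixes p :: "('x, 'v::real_inner, 'a::real_inner) point"
  assumes "subspace X" "m \<in> Mor X X'" "m' \<in> Mor X' X''" "subspace X'"
  shows "kan_mor \<U> H X' X'' m' (kan_mor \<U> H X X' m p) = kan_mor \<U> H X X'' (compose X m' m) p"
proof -
  have eq: "compose X (compose X' f m') m = compose X f (compose X m' m)" for f :: "'v \<times> 'a \<Rightarrow> 'v"
    using assms by (auto simp: compose_def fun_eq_iff Mor_mem)
  show ?thesis
    unfolding kan_mor_def by (intro arg_cong [where f = Kan] restrict_ext)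
      (simp add: eq Mor_compose [OF assms(3) _ assms(4)])
qed

lemma kan_mor_id:
  fixes p :: "('x, 'v::real_inner, 'a::real_inner) point"
  assumes p: "p \<in> topspace (kan_top \<U> E H X)" and m: "\<And>x. x \<in> X \<Longrightarrow> m x = x"
  shows "kan_mor \<U> H X X m p = p"
  unfolding kan_mor_def
proof (rule kan_restrict_eq [OF p])
  fix Z and f :: "'v \<times> 'a \<Rightarrow> 'v" assume f: "f \<in> Mor X Z"
  have "compose X f m = f"
    by (rule extensionalityI [of _ X]) (use f m in \<open>auto simp: compose_def Mor_ext\<close>)
  then show "kan_fam p Z (compose X f m) = kan_fam p Z f" by simp
qed

subsection \<open>Comparison maps of the Kan extension\<close>

context kan_functor
begin

context
  fixes \<beta> :: "('g, 'a) rep" and a K H X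
  assumes \<beta>: "orthogonal_rep G \<beta>" and o: "orbit_map G a K H"
    and X: "fin_dim X" and XU: "X \<subseteq> rspace (\<U> \<oplus>\<^sub>r \<beta>)"
begin

abbreviation (input) "gX g \<equiv> ract (\<U> \<oplus>\<^sub>r \<beta>) g ` X"

lemma sum_rep: "orthogonal_rep G (\<U> \<oplus>\<^sub>r \<beta>)"
  by (rule orthogonal_rep_sum [OF universe_rep \<beta>])

lemmas orbit_rules = orbit_mapD [OF o]

lemma source_subspace: "subspace X" by (rule fin_dim_subspace [OF X])

lemma translate_subspace: "subspace (gX a)" and translate_ambient: "gX a \<subseteq> rspace (\<U> \<oplus>\<^sub>r \<beta>)"
  using rep_image_fin_dim [OF sum_rep orbit_rules(1) X XU] rep_image_subset [OF sum_rep orbit_rules(1) XU]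
  by (auto dest: fin_dim_subspace)

lemma pull_conj_Mor:
  assumes Z: "Z \<in> Rep \<U> H" and f: "f \<in> Mor (gX a) Z"
  shows "conj_map G (\<U> \<oplus>\<^sub>r \<beta>) \<U> (inv a) (gX a) f \<in> Mor X (ract \<U> (inv a) ` Z)"
  using conj_map_Mor [OF sum_rep universe_rep _ translate_subspace translate_ambient RepD(1,3) [OF Z] f, of "inv a"]
    rep_image_inv_left [OF sum_rep orbit_rules(1) XU] orbit_rules(1) by simp

lemma push_pull: "Z \<in> Rep \<U> H \<Longrightarrow> ract \<U> a ` ract \<U> (inv a) ` Z = Z"
  by (rule rep_image_inv_right [OF universe_rep orbit_rules(1) RepD(3)])

lemma kan_cmp_fam:
  "Z \<in> Rep \<U> H \<Longrightarrow> f \<in> Mor (gX a) Z \<Longrightarrow>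
    kan_fam (kan_cmp G \<U> \<beta> E a K H X p) Z f =
      cmp E a K H (ract \<U> (inv a) ` Z)
         (kan_fam p (ract \<U> (inv a) ` Z) (conj_map G (\<U> \<oplus>\<^sub>r \<beta>) \<U> (inv a) (gX a) f))"
  by (simp add: kan_cmp_def)

lemma kan_cmp_continuous:
  "continuous_map (kan_top \<U> E K X) (kan_top \<U> E H (gX a)) (kan_cmp G \<U> \<beta> E a K H X)"
  unfolding kan_cmp_def
proof (rule continuous_map_into_kan [OF translate_subspace])
  fix Z assume Z: "Z \<in> Rep \<U> H"
  let ?Z = "ract \<U> (inv a) ` Z"
  have Z': "?Z \<in> Rep \<U> K" by (rule Rep_pull [OF universe_rep o Z])
  let ?P = "prod_topology (kan_top \<U> E K X) (Mor_top (gX a) Z)"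
  have "continuous_map (Mor_top (gX a) Z) (Mor_top X ?Z) (conj_map G (\<U> \<oplus>\<^sub>r \<beta>) \<U> (inv a) (gX a))"
    using continuous_map_conj_map [OF sum_rep universe_rep _ translate_subspace translate_ambient RepD(1,3) [OF Z], of "inv a"]
      rep_image_inv_left [OF sum_rep orbit_rules(1) XU] orbit_rules(1) by simp
  from continuous_map_compose [OF continuous_map_snd this]
  have c: "continuous_map ?P (Mor_top X ?Z) (\<lambda>q. conj_map G (\<U> \<oplus>\<^sub>r \<beta>) \<U> (inv a) (gX a) (snd q))"
    by (simp add: o_def)
  have "continuous_map (tp (obj E K ?Z)) (tp (obj E H Z)) (cmp E a K H ?Z)"
    using homeomorphic_imp_continuous_map [OF cmp_homeo [OF o Z']] push_pull [OF Z] Z by simp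
  from continuous_map_compose [OF continuous_map_apply2 [OF kan_eval_joint [OF orbit_rules(2) X Z'] continuous_map_fst c] this]
  show "continuous_map ?P (tp (obj E H Z)) (\<lambda>(p, f). cmp E a K H ?Z
         (kan_fam p ?Z (conj_map G (\<U> \<oplus>\<^sub>r \<beta>) \<U> (inv a) (gX a) f)))"
    by (simp add: o_def case_prod_unfold)
next
  fix p Z Z' u f
  assume p: "p \<in> topspace (kan_top \<U> E K X)" and Z: "Z \<in> Rep \<U> H" and Z': "Z' \<in> Rep \<U> H"
    and u: "u \<in> Mor Z Z'" and f: "f \<in> Mor (gX a) Z"
  let ?c = "conj_map G (\<U> \<oplus>\<^sub>r \<beta>) \<U> (inv a) (gX a)" and ?u = "conj_map G \<U> \<U> (inv a) Z u"
  let ?Z = "ract \<U> (inv a) ` Z" and ?Z' = "ract \<U> (inv a) ` Z'"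
  have ia: "inv a \<in> carrier G" using orbit_rules(1) by simp
  have Zr: "?Z \<in> Rep \<U> K" "?Z' \<in> Rep \<U> K" by (auto intro: Rep_pull [OF universe_rep o] Z Z')
  have u': "?u \<in> Mor ?Z ?Z'"
    by (rule conj_map_Mor [OF universe_rep universe_rep ia RepD(1,3) [OF Z] RepD(1,3) [OF Z'] u])
  have "f \<in> gX a \<rightarrow> Z" using Mor_mem [OF f] by blast
  from conj_map_compose [OF sum_rep universe_rep ia translate_ambient RepD(3) [OF Z] this]
  have "?c (compose (gX a) u f) = compose X ?u (?c f)"
    using rep_image_inv_left [OF sum_rep orbit_rules(1) XU] by simp
  then have "kan_fam p ?Z' (?c (compose (gX a) u f)) = mor E K ?Z ?Z' ?u (kan_fam p ?Z (?c f))"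
    using kan_fam_natural [OF p Zr u' pull_conj_Mor [OF Z f]] by simp
  moreover have "conj_map G \<U> \<U> a ?Z ?u = u"
    by (rule conj_map_inv(2) [OF universe_rep universe_rep orbit_rules(1) RepD(3) [OF Z] u RepD(3) [OF Z']])
  ultimately show "cmp E a K H ?Z' (kan_fam p ?Z' (?c (compose (gX a) u f))) =
      mor E H Z Z' u (cmp E a K H ?Z (kan_fam p ?Z (?c f)))"
    using cmp_mor [OF o Zr _ _ u' kan_fam_mem [OF p Zr(1) pull_conj_Mor [OF Z f]]] push_pull Z Z' by simp
qed

lemma kan_cmp_mem: "p \<in> topspace (kan_top \<U> E K X) \<Longrightarrow>
    kan_cmp G \<U> \<beta> E a K H X p \<in> topspace (kan_top \<U> E H (gX a))"
  using continuous_map_funspace [OF kan_cmp_continuous] by blast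

lemma kan_cmp_base: "kan_cmp G \<U> \<beta> E a K H X (kan_base \<U> E K X) = kan_base \<U> E H (gX a)"
proof -
  have "kan_fam (kan_cmp G \<U> \<beta> E a K H X (kan_base \<U> E K X)) Z f = kan_fam (kan_base \<U> E H (gX a)) Z f"
    if Z: "Z \<in> Rep \<U> H" and f: "f \<in> Mor (gX a) Z" for Z f
    using Z f pull_conj_Mor [OF Z f] Rep_pull [OF universe_rep o Z] cmp_pt0 [OF o Rep_pull [OF universe_rep o Z]] push_pull [OF Z]
    by (simp add: kan_cmp_fam) (simp add: kan_base_def)
  from kan_restrict_eq [OF kan_base_mem [OF orbit_rules(3) translate_subspace] this]
  show ?thesis by (simp add: kan_cmp_def cong: restrict_cong)
qed

text \<open>The Kan extensions for \<open>K\<close> and \<open>H\<close> are ends over different categories. Evaluated at a common model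
  \<open>Z\<close> of \<open>X\<close> and \<open>aX\<close>, however, both are values of \<open>E\<close> at \<open>Z\<close>, and the comparison of Kan extensions becomes
  the comparison map of \<open>E\<close> at \<open>Z\<close>.\<close>

lemma kan_cmp_homeo:
  "homeomorphic_map (kan_top \<U> E K X) (kan_top \<U> E H (gX a)) (kan_cmp G \<U> \<beta> E a K H X)"
proof -
  obtain Z i j where Z: "\<And>H. subgroup H G \<Longrightarrow> Z \<in> Rep \<U> H" "\<And>g. g \<in> carrier G \<Longrightarrow> ract \<U> g ` Z = Z"
    and ij: "i \<in> Mor X Z" "j \<in> Mor Z X" "\<And>x. x \<in> X \<Longrightarrow> j (i x) = x" "\<And>z. z \<in> Z \<Longrightarrow> i (j z) = z"
    using kan_model [OF X] by metis
  have ia: "inv a \<in> carrier G" using orbit_rules(1) by simp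
  note ZH = Z(1) [OF orbit_rules(3)] and ZK = Z(1) [OF orbit_rules(2)]
  let ?i = "conj_map G (\<U> \<oplus>\<^sub>r \<beta>) \<U> a X i" and ?j = "conj_map G \<U> (\<U> \<oplus>\<^sub>r \<beta>) a Z j"
  have i': "?i \<in> Mor (gX a) Z"
    using conj_map_Mor [OF sum_rep universe_rep orbit_rules(1) source_subspace XU RepD(1,3) [OF ZH] ij(1)] Z(2) orbit_rules(1) by simp
  have j': "?j \<in> Mor Z (gX a)"
    using conj_map_Mor [OF universe_rep sum_rep orbit_rules(1) RepD(1,3) [OF ZH] source_subspace XU ij(2)] Z(2) orbit_rules(1) by simp
  have ji: "?j (?i x) = x" if "x \<in> gX a" for x
    using that ij(3) Mor_mem [OF ij(1)] 
    by (auto simp del: ract_sum_apply simp: conj_map_apply [OF sum_rep orbit_rules(1) XU] conj_map_apply [OF universe_rep orbit_rules(1) RepD(3) [OF ZH]])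
  have ij': "?i (?j z) = z" if "z \<in> Z" for z
  proof -
    have "z \<in> ract \<U> a ` Z" using that Z(2) [OF orbit_rules(1)] by simp
    then obtain w where w: "w \<in> Z" "z = ract \<U> a w" by blast
    then show ?thesis
      using ij(4) Mor_mem [OF ij(2)]
      by (simp del: ract_sum_apply add: conj_map_apply [OF sum_rep orbit_rules(1) XU] conj_map_apply [OF universe_rep orbit_rules(1) RepD(3) [OF ZH]])
  qed
  have ev1: "homeomorphic_map (kan_top \<U> E K X) (tp (obj E K Z)) (\<lambda>p. kan_fam p Z i)"
    by (rule kan_eval_homeo [OF orbit_rules(2) source_subspace ZK ij])
  have ev2: "homeomorphic_map (kan_top \<U> E H (gX a)) (tp (obj E H Z)) (\<lambda>p. kan_fam p Z ?i)"
    by (rule kan_eval_homeo [OF orbit_rules(3) translate_subspace ZH i' j' ji ij'])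
  have c: "homeomorphic_map (tp (obj E K Z)) (tp (obj E H Z)) (cmp E a K H Z)"
    using cmp_homeo [OF o ZK] Z(2) orbit_rules(1) ZH by simp
  obtain g where g: "homeomorphic_maps (kan_top \<U> E H (gX a)) (tp (obj E H Z)) (\<lambda>p. kan_fam p Z ?i) g"
    using ev2 homeomorphic_map_maps by blast
  then have "homeomorphic_map (tp (obj E H Z)) (kan_top \<U> E H (gX a)) g"
    using homeomorphic_maps_map by blast
  from homeomorphic_map_compose [OF homeomorphic_map_compose [OF ev1 c] this]
  show ?thesis
  proof (rule homeomorphic_map_eq)
    fix p assume p: "p \<in> topspace (kan_top \<U> E K X)"
    have "kan_fam (kan_cmp G \<U> \<beta> E a K H X p) Z ?i = cmp E a K H Z (kan_fam p Z i)"
      using kan_cmp_fam [OF ZH i'] conj_map_inv(1) [OF sum_rep universe_rep orbit_rules(1) XU ij(1) RepD(3) [OF ZH]]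
        Z(2) [OF ia] by simp
    moreover have "g (kan_fam (kan_cmp G \<U> \<beta> E a K H X p) Z ?i) = kan_cmp G \<U> \<beta> E a K H X p"
      using g kan_cmp_mem [OF p] by (simp add: homeomorphic_maps_def)
    ultimately show "(g \<circ> (cmp E a K H Z \<circ> (\<lambda>p. kan_fam p Z i))) p = kan_cmp G \<U> \<beta> E a K H X p"
      by simp
  qed
qed

lemma kan_cmp_mor:
  assumes X': "subspace X'" "X' \<subseteq> rspace (\<U> \<oplus>\<^sub>r \<beta>)" and m: "m \<in> Mor X X'"
  shows "kan_cmp G \<U> \<beta> E a K H X' (kan_mor \<U> K X X' m p) =
    kan_mor \<U> H (gX a) (ract (\<U> \<oplus>\<^sub>r \<beta>) a ` X') (conj_map G (\<U> \<oplus>\<^sub>r \<beta>) (\<U> \<oplus>\<^sub>r \<beta>) a X m) (kan_cmp G \<U> \<beta> E a K H X p)"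
proof -
  let ?X' = "ract (\<U> \<oplus>\<^sub>r \<beta>) a ` X'" and ?m = "conj_map G (\<U> \<oplus>\<^sub>r \<beta>) (\<U> \<oplus>\<^sub>r \<beta>) a X m"
  have ia: "inv a \<in> carrier G" using orbit_rules(1) by simp
  have X'a: "subspace ?X'" "?X' \<subseteq> rspace (\<U> \<oplus>\<^sub>r \<beta>)"
    using rep_image_subspace [OF sum_rep orbit_rules(1) X'] rep_image_subset [OF sum_rep orbit_rules(1) X'(2)] by auto
  have m': "?m \<in> Mor (gX a) ?X'"
    by (rule conj_map_Mor [OF sum_rep sum_rep orbit_rules(1) source_subspace XU X' m])
  have "cmp E a K H (ract \<U> (inv a) ` Z) (kan_fam (kan_mor \<U> K X X' m p) (ract \<U> (inv a) ` Z)
        (conj_map G (\<U> \<oplus>\<^sub>r \<beta>) \<U> (inv a) ?X' f)) =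
      kan_fam (kan_cmp G \<U> \<beta> E a K H X p) Z (compose (gX a) f ?m)"
    if Z: "Z \<in> Rep \<U> H" and f: "f \<in> Mor ?X' Z" for Z f
  proof -
    have fm: "compose (gX a) f ?m \<in> Mor (gX a) Z" by (rule Mor_compose [OF m' f translate_subspace])
    have f': "conj_map G (\<U> \<oplus>\<^sub>r \<beta>) \<U> (inv a) ?X' f \<in> Mor X' (ract \<U> (inv a) ` Z)"
      using conj_map_Mor [OF sum_rep universe_rep ia X'a RepD(1,3) [OF Z] f]
        rep_image_inv_left [OF sum_rep orbit_rules(1) X'(2)] by simp
    have "?m \<in> gX a \<rightarrow> ?X'" using Mor_mem [OF m'] by blast
    from conj_map_compose [OF sum_rep sum_rep ia translate_ambient X'a(2) this, of \<U> f]
    have "conj_map G (\<U> \<oplus>\<^sub>r \<beta>) \<U> (inv a) (gX a) (compose (gX a) f ?m) =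
        compose X (conj_map G (\<U> \<oplus>\<^sub>r \<beta>) \<U> (inv a) ?X' f) m"
      using rep_image_inv_left [OF sum_rep orbit_rules(1) XU]
        conj_map_inv(1) [OF sum_rep sum_rep orbit_rules(1) XU m X'(2)] by simp
    then show ?thesis
      using f' Rep_pull [OF universe_rep o Z] kan_cmp_fam [OF Z fm, of p] by (simp add: kan_mor_def)
  qed
  then show ?thesis
    unfolding kan_cmp_def [where X = X'] kan_mor_def [where X' = ?X'] by (simp cong: restrict_cong)
qed

end

lemma kan_cmp_cmp:
  assumes \<beta>: "orthogonal_rep G \<beta>" and o: "orbit_map G b L K" "orbit_map G a K H" 
    and X: "fin_dim X" "X \<subseteq> rspace (\<U> \<oplus>\<^sub>r \<beta>)" and p: "p \<in> topspace (kan_top \<U> E L X)"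
  shows "kan_cmp G \<U> \<beta> E (a \<otimes> b) L H X p =
    kan_cmp G \<U> \<beta> E a K H (ract (\<U> \<oplus>\<^sub>r \<beta>) b ` X) (kan_cmp G \<U> \<beta> E b L K X p)"
proof -
  have ab: "a \<in> carrier G" "b \<in> carrier G" using o by (auto simp: orbit_map_def)
  have P: "orthogonal_rep G (\<U> \<oplus>\<^sub>r \<beta>)" by (rule orthogonal_rep_sum [OF universe_rep \<beta>])
  let ?bX = "ract (\<U> \<oplus>\<^sub>r \<beta>) b ` X"
  have bX: "fin_dim ?bX" "?bX \<subseteq> rspace (\<U> \<oplus>\<^sub>r \<beta>)"
    using rep_image_fin_dim [OF P ab(2) X] rep_image_subset [OF P ab(2) X(2)] by auto
  let ?abX = "ract (\<U> \<oplus>\<^sub>r \<beta>) (a \<otimes> b) ` X"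
  have abX: "?abX = ract (\<U> \<oplus>\<^sub>r \<beta>) a ` ?bX" by (rule rep_image_mult [OF P ab X(2)])
  have abX': "?abX \<subseteq> rspace (\<U> \<oplus>\<^sub>r \<beta>)" using rep_image_subset [OF P _ X(2)] ab by simp
  have "cmp E (a \<otimes> b) L H (ract \<U> (inv (a \<otimes> b)) ` Z)
         (kan_fam p (ract \<U> (inv (a \<otimes> b)) ` Z) (conj_map G (\<U> \<oplus>\<^sub>r \<beta>) \<U> (inv (a \<otimes> b)) ?abX f)) =
      cmp E a K H (ract \<U> (inv a) ` Z) (kan_fam (kan_cmp G \<U> \<beta> E b L K X p) (ract \<U> (inv a) ` Z)
         (conj_map G (\<U> \<oplus>\<^sub>r \<beta>) \<U> (inv a) ?abX f))"
    if Z: "Z \<in> Rep \<U> H" and f: "f \<in> Mor ?abX Z" for Z f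
  proof -
    let ?aZ = "ract \<U> (inv a) ` Z" and ?baZ = "ract \<U> (inv b) ` ract \<U> (inv a) ` Z"
    let ?f = "conj_map G (\<U> \<oplus>\<^sub>r \<beta>) \<U> (inv a) ?abX f"
    have aZ: "?aZ \<in> Rep \<U> K" by (rule Rep_pull [OF universe_rep o(2) Z])
    have baZ: "?baZ \<in> Rep \<U> L" by (rule Rep_pull [OF universe_rep o(1) aZ])
    have Zab: "ract \<U> (inv (a \<otimes> b)) ` Z = ?baZ"
      using rep_image_mult [OF universe_rep, of "inv b" "inv a" Z] RepD(3) [OF Z] ab
      by (simp add: inv_mult_group)
    have f': "?f \<in> Mor ?bX ?aZ"
      unfolding abX by (rule pull_conj_Mor [OF \<beta> o(2) bX Z f [unfolded abX]])
    have "f \<in> ?abX \<rightarrow> rspace \<U>" using Mor_mem [OF f] RepD(3) [OF Z] by blast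
    from conj_map_mult [OF P universe_rep _ _ abX' this, of "inv a" "inv b"]
    have ff: "conj_map G (\<U> \<oplus>\<^sub>r \<beta>) \<U> (inv (a \<otimes> b)) ?abX f = conj_map G (\<U> \<oplus>\<^sub>r \<beta>) \<U> (inv b) ?bX ?f"
      using ab rep_image_inv_left [OF P ab(1) bX(2)] by (simp add: inv_mult_group abX)
    have f'': "conj_map G (\<U> \<oplus>\<^sub>r \<beta>) \<U> (inv b) ?bX ?f \<in> Mor X ?baZ"
      by (rule pull_conj_Mor [OF \<beta> o(1) X aZ f'])
    have bb: "ract \<U> b ` ?baZ = ?aZ" by (rule rep_image_inv_right [OF universe_rep ab(2) RepD(3) [OF aZ]])
    have aa: "ract \<U> (a \<otimes> b) ` ?baZ = Z"
      using rep_image_mult [OF universe_rep ab RepD(3) [OF baZ]] bb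
        rep_image_inv_right [OF universe_rep ab(1) RepD(3) [OF Z]] by simp
    show ?thesis
      using cmp_cmp [OF o baZ, unfolded bb aa, OF aZ Z kan_fam_mem [OF p baZ f'']]
      by (simp add: Zab ff kan_cmp_fam [OF \<beta> o(1) X aZ f'])
  qed
  then show ?thesis
    unfolding kan_cmp_def [where a = "a \<otimes> b"] kan_cmp_def [where a = a] abX [symmetric]
    by (simp cong: restrict_cong)
qed

lemma kan_cmp_act:
  assumes \<beta>: "orthogonal_rep G \<beta>" and H: "subgroup H G" "h \<in> H"
    and X: "fin_dim X" "X \<subseteq> rspace (\<U> \<oplus>\<^sub>r \<beta>)" and p: "p \<in> topspace (kan_top \<U> E H X)"
  shows "kan_cmp G \<U> \<beta> E h H H X p = kan_act G \<U> \<beta> E H h X p"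
proof -
  have o: "orbit_map G h H H" by (rule orbit_map_self [OF H])
  have "cmp E h H H (ract \<U> (inv h) ` Z)
         (kan_fam p (ract \<U> (inv h) ` Z) (conj_map G (\<U> \<oplus>\<^sub>r \<beta>) \<U> (inv h) (ract (\<U> \<oplus>\<^sub>r \<beta>) h ` X) f)) =
      act (obj E H Z) h (kan_fam p Z (conj_map G (\<U> \<oplus>\<^sub>r \<beta>) \<U> (inv h) (ract (\<U> \<oplus>\<^sub>r \<beta>) h ` X) f))"
    if Z: "Z \<in> Rep \<U> H" and f: "f \<in> Mor (ract (\<U> \<oplus>\<^sub>r \<beta>) h ` X) Z" for Z f
  proof -
    have "ract \<U> (inv h) ` Z = Z"
      by (rule Rep_image_eq [OF universe_rep H(1) Z subgroup.m_inv_closed [OF H]])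
    then show ?thesis
      using cmp_act [OF H Z kan_fam_mem [OF p Z]] pull_conj_Mor [OF \<beta> o X Z f] by simp
  qed
  then show ?thesis unfolding kan_cmp_def kan_act_def by (simp cong: restrict_cong)
qed

end

section \<open>2-morphisms and the Kan extension\<close>

locale weiss_two_cell = weiss_functor G \<U> E + F: weiss_functor G \<U> F
  for G :: "('g, 'm) monoid_scheme" (structure) and \<U> :: "('g, 'v::real_inner) rep"
    and E F :: "('g, 'v, 'p) weiss" +
  fixes \<eta> :: "('g, 'v, 'p) two_cell"
  assumes two_morphism: "two_morphism G \<U> E F \<eta>"
begin

lemma two_cont: "subgroup H G \<Longrightarrow> W \<in> Rep \<U> H \<Longrightarrow>
    continuous_map (tp (obj E H W)) (tp (obj F H W)) (\<eta> H W)"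
  and two_pt0: "subgroup H G \<Longrightarrow> W \<in> Rep \<U> H \<Longrightarrow> \<eta> H W (pt0 (obj E H W)) = pt0 (obj F H W)"
  using two_morphism unfolding two_morphism_def by simp_all

lemma two_mem: "subgroup H G \<Longrightarrow> W \<in> Rep \<U> H \<Longrightarrow> x \<in> topspace (tp (obj E H W)) \<Longrightarrow>
    \<eta> H W x \<in> topspace (tp (obj F H W))"
  using continuous_map_funspace [OF two_cont] by blast

lemma two_mor: "subgroup H G \<Longrightarrow> W \<in> Rep \<U> H \<Longrightarrow> W' \<in> Rep \<U> H \<Longrightarrow> f \<in> Mor W W' \<Longrightarrow>
    x \<in> topspace (tp (obj E H W)) \<Longrightarrow> \<eta> H W' (mor E H W W' f x) = mor F H W W' f (\<eta> H W x)"
  using two_morphism unfolding two_morphism_def by simp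

lemma two_cmp: "orbit_map G a K H \<Longrightarrow> V \<in> Rep \<U> K \<Longrightarrow> ract \<U> a ` V \<in> Rep \<U> H \<Longrightarrow>
    x \<in> topspace (tp (obj E K V)) \<Longrightarrow> \<eta> H (ract \<U> a ` V) (cmp E a K H V x) = cmp F a K H V (\<eta> K V x)"
  using two_morphism unfolding two_morphism_def by simp

end

locale kan_two_cell = weiss_two_cell G \<U> E F \<eta> + kan_functor G \<U> E + F: kan_functor G \<U> F
  for G :: "('g, 'm) monoid_scheme" (structure) and \<U> :: "('g, 'v::real_inner) rep"
    and E F :: "('g, 'v, ('x, 'v, 'a::real_inner) point) weiss" and \<eta>
begin

lemma kan_two_continuous:
  assumes H: "subgroup H G" and X: "fin_dim X"
  shows "continuous_map (kan_top \<U> E H X) (kan_top \<U> F H X) (kan_two \<U> \<eta> H X)"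
  unfolding kan_two_def
proof (rule continuous_map_into_kan [OF fin_dim_subspace [OF X]])
  fix Z assume Z: "Z \<in> Rep \<U> H"
  from continuous_map_compose [OF kan_eval_joint [OF H X Z] two_cont [OF H Z]]
  show "continuous_map (prod_topology (kan_top \<U> E H X) (Mor_top X Z)) (tp (obj F H Z))
      (\<lambda>(p, f). \<eta> H Z (kan_fam p Z f))"
    by (simp add: o_def case_prod_unfold)
qed (use H in \<open>simp add: kan_fam_natural two_mor kan_fam_mem\<close>)

lemma kan_two_base:
  "subgroup H G \<Longrightarrow> kan_two \<U> \<eta> H X (kan_base \<U> E H X) = kan_base \<U> F H X"
  unfolding kan_two_def kan_base_def by (intro arg_cong [where f = Kan] restrict_ext) (simp add: two_pt0)

lemma kan_two_mor:
  assumes "subspace X" "m \<in> Mor X X'"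
  shows "kan_two \<U> \<eta> H X' (kan_mor \<U> H X X' m p) = kan_mor \<U> H X X' m (kan_two \<U> \<eta> H X p)"
  unfolding kan_two_def kan_mor_def
  by (intro arg_cong [where f = Kan] restrict_ext) (simp add: Mor_compose [OF assms(2) _ assms(1)])

lemma kan_two_cmp:
  assumes \<beta>: "orthogonal_rep G \<beta>" and o: "orbit_map G a K H" 
    and X: "fin_dim X" "X \<subseteq> rspace (\<U> \<oplus>\<^sub>r \<beta>)" and p: "p \<in> topspace (kan_top \<U> E K X)"
  shows "kan_two \<U> \<eta> H (ract (\<U> \<oplus>\<^sub>r \<beta>) a ` X) (kan_cmp G \<U> \<beta> E a K H X p) =
    kan_cmp G \<U> \<beta> F a K H X (kan_two \<U> \<eta> K X p)"
proof -
  have "\<eta> H Z (kan_fam (kan_cmp G \<U> \<beta> E a K H X p) Z f) =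
      cmp F a K H (ract \<U> (inv a) ` Z) (kan_fam (kan_two \<U> \<eta> K X p) (ract \<U> (inv a) ` Z)
        (conj_map G (\<U> \<oplus>\<^sub>r \<beta>) \<U> (inv a) (ract (\<U> \<oplus>\<^sub>r \<beta>) a ` X) f))"
    if Z: "Z \<in> Rep \<U> H" and f: "f \<in> Mor (ract (\<U> \<oplus>\<^sub>r \<beta>) a ` X) Z" for Z f
  proof -
    have aZ: "ract \<U> (inv a) ` Z \<in> Rep \<U> K" by (rule Rep_pull [OF universe_rep o Z])
    have f': "conj_map G (\<U> \<oplus>\<^sub>r \<beta>) \<U> (inv a) (ract (\<U> \<oplus>\<^sub>r \<beta>) a ` X) f \<in> Mor X (ract \<U> (inv a) ` Z)"
      by (rule pull_conj_Mor [OF \<beta> o X Z f])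
    show ?thesis
      using two_cmp [OF o aZ, unfolded push_pull [OF \<beta> o X Z], OF Z kan_fam_mem [OF p aZ f']] aZ f'
      by (simp add: kan_cmp_fam [OF \<beta> o X Z f] kan_two_def)
  qed
  then show ?thesis
    unfolding kan_two_def [where H = H] kan_cmp_def [where E = F] by (simp cong: restrict_cong)
qed

end

lemma kan_two_comp: "kan_two \<U> \<theta> H X (kan_two \<U> \<eta> H X p) = kan_two \<U> (\<theta> \<circ>\<^sub>2 \<eta>) H X p"
  unfolding kan_two_def two_cell_comp_def
  by (intro arg_cong [where f = Kan] restrict_ext) simp

lemma kan_two_cong:
  assumes "p \<in> topspace (kan_top \<U> E H X)"
    and "\<And>Z x. Z \<in> Rep \<U> H \<Longrightarrow> x \<in> topspace (tp (obj E H Z)) \<Longrightarrow> \<eta> H Z x = \<theta> H Z x"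
  shows "kan_two \<U> \<eta> H X p = kan_two \<U> \<theta> H X p"
  unfolding kan_two_def
  by (intro arg_cong [where f = Kan] restrict_ext) (simp add: assms kan_fam_mem [OF assms(1)])

lemma kan_two_id:
  assumes "p \<in> topspace (kan_top \<U> E H X)"
  shows "kan_two \<U> (\<lambda>H Z x. x) H X p = p"
  unfolding kan_two_def by (rule kan_restrict_eq [OF assms]) simp

section \<open>Nerves of categories of subspaces\<close>

lemma mem_nerve:
  "z \<in> nerve C n \<longleftrightarrow>
     fst z \<in> {..n} \<rightarrow>\<^sub>E C \<and>
     snd z \<in> (\<Pi>\<^sub>E (i, j)\<in>{(i, j). i \<le> j \<and> j \<le> n}. Mor (fst z i) (fst z j)) \<and>
     (\<forall>i\<le>n. snd z (i, i) = (\<lambda>x\<in>fst z i. x)) \<and>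
     (\<forall>i j k. i \<le> j \<and> j \<le> k \<and> k \<le> n \<longrightarrow>
        snd z (i, k) = compose (fst z i) (snd z (j, k)) (snd z (i, j)))"
  unfolding nerve_def by (cases z) (simp only: mem_Collect_eq case_prod_conv fst_conv snd_conv)

lemma
  assumes "z \<in> nerve C n"
  shows nerve_obj: "\<And>i. i \<le> n \<Longrightarrow> fst z i \<in> C"
    and nerve_Mor: "\<And>i j. i \<le> j \<Longrightarrow> j \<le> n \<Longrightarrow> snd z (i, j) \<in> Mor (fst z i) (fst z j)"
    and nerve_ext: "fst z \<in> extensional {..n}" "snd z \<in> extensional {(i, j). i \<le> j \<and> j \<le> n}"
    and nerve_id: "\<And>i. i \<le> n \<Longrightarrow> snd z (i, i) = (\<lambda>x\<in>fst z i. x)"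
    and nerve_comp: "\<And>i j k. i \<le> j \<Longrightarrow> j \<le> k \<Longrightarrow> k \<le> n \<Longrightarrow>
      snd z (i, k) = compose (fst z i) (snd z (j, k)) (snd z (i, j))"
proof -
  note z = assms [unfolded mem_nerve]
  note 1 = z [THEN conjunct1] and 2 = z [THEN conjunct2, THEN conjunct1]
    and 3 = z [THEN conjunct2, THEN conjunct2, THEN conjunct1]
    and 4 = z [THEN conjunct2, THEN conjunct2, THEN conjunct2]
  show "\<And>i. i \<le> n \<Longrightarrow> fst z i \<in> C" using 1 by (auto dest: PiE_mem)
  show "\<And>i j. i \<le> j \<Longrightarrow> j \<le> n \<Longrightarrow> snd z (i, j) \<in> Mor (fst z i) (fst z j)"
    using PiE_mem [OF 2] by fastforce
  show "fst z \<in> extensional {..n}" "snd z \<in> extensional {(i, j). i \<le> j \<and> j \<le> n}"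
    using 1 2 by (simp_all add: PiE_def)
  show "\<And>i. i \<le> n \<Longrightarrow> snd z (i, i) = (\<lambda>x\<in>fst z i. x)" using 3 by blast
  show "\<And>i j k. i \<le> j \<Longrightarrow> j \<le> k \<Longrightarrow> k \<le> n \<Longrightarrow>
      snd z (i, k) = compose (fst z i) (snd z (j, k)) (snd z (i, j))" using 4 by blast
qed

lemma nerveI:
  assumes "\<And>i. i \<le> n \<Longrightarrow> fst z i \<in> C" "\<And>i j. i \<le> j \<Longrightarrow> j \<le> n \<Longrightarrow> snd z (i, j) \<in> Mor (fst z i) (fst z j)"
    and "fst z \<in> extensional {..n}" "snd z \<in> extensional {(i, j). i \<le> j \<and> j \<le> n}"
    and "\<And>i. i \<le> n \<Longrightarrow> snd z (i, i) = (\<lambda>x\<in>fst z i. x)"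
    and "\<And>i j k. i \<le> j \<Longrightarrow> j \<le> k \<Longrightarrow> k \<le> n \<Longrightarrow>
      snd z (i, k) = compose (fst z i) (snd z (j, k)) (snd z (i, j))"
  shows "z \<in> nerve C n"
  unfolding mem_nerve
proof (intro conjI)
  show "fst z \<in> {..n} \<rightarrow>\<^sub>E C" using assms(1,3) by (auto simp: PiE_iff)
  show "snd z \<in> (\<Pi>\<^sub>E (i, j)\<in>{(i, j). i \<le> j \<and> j \<le> n}. Mor (fst z i) (fst z j))"
    using assms(2,4) by (auto simp: PiE_iff)
qed (use assms(5,6) in blast)+

lemma nerve_mono: "C \<subseteq> D \<Longrightarrow> nerve C n \<subseteq> nerve D n"
proof
  fix z assume "C \<subseteq> D" and z: "z \<in> nerve C n"
  then show "z \<in> nerve D n"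
    using nerve_obj [OF z] by (intro nerveI nerve_Mor [OF z] nerve_ext [OF z] nerve_id [OF z] nerve_comp [OF z]) auto
qed

lemma monotone_mapD:
  assumes "monotone_map m n \<theta>"
  shows "\<And>i. i \<le> m \<Longrightarrow> \<theta> i \<le> n" "\<And>i j. i \<le> j \<Longrightarrow> j \<le> m \<Longrightarrow> \<theta> i \<le> \<theta> j"
  using assms by (auto simp: monotone_map_def mono_on_def)

lemma nerve_pull_fst: "i \<le> m \<Longrightarrow> fst (nerve_pull m \<theta> z) i = fst z (\<theta> i)"
  by (simp add: nerve_pull_def case_prod_unfold)

lemma nerve_pull_snd: "i \<le> j \<Longrightarrow> j \<le> m \<Longrightarrow> snd (nerve_pull m \<theta> z) (i, j) = snd z (\<theta> i, \<theta> j)"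
  by (simp add: nerve_pull_def case_prod_unfold)

lemma nerve_pull_mem:
  assumes \<theta>: "monotone_map m n \<theta>" and z: "z \<in> nerve C n"
  shows "nerve_pull m \<theta> z \<in> nerve C m"
proof -
  note t = monotone_mapD [OF \<theta>]
  show ?thesis
  proof (rule nerveI)
    show "snd (nerve_pull m \<theta> z) (i, k) = compose (fst (nerve_pull m \<theta> z) i)
        (snd (nerve_pull m \<theta> z) (j, k)) (snd (nerve_pull m \<theta> z) (i, j))"
      if "i \<le> j" "j \<le> k" "k \<le> m" for i j k
      using nerve_comp [OF z t(2) t(2) t(1), OF that(1) _ that(2,3) that(3)] that
      by (simp add: nerve_pull_fst nerve_pull_snd)
    show "snd (nerve_pull m \<theta> z) (i, j) \<in> Mor (fst (nerve_pull m \<theta> z) i) (fst (nerve_pull m \<theta> z) j)"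
      if "i \<le> j" "j \<le> m" for i j
      using nerve_Mor [OF z t(2) t(1), OF that that(2)] that
      by (simp add: nerve_pull_fst nerve_pull_snd)
    show "fst (nerve_pull m \<theta> z) i \<in> C" if "i \<le> m" for i
      using nerve_obj [OF z t(1) [OF that]] that by (simp add: nerve_pull_fst)
    show "snd (nerve_pull m \<theta> z) (i, i) = (\<lambda>x\<in>fst (nerve_pull m \<theta> z) i. x)" if "i \<le> m" for i
      using nerve_id [OF z t(1) [OF that]] that by (simp add: nerve_pull_fst nerve_pull_snd)
  qed (simp_all add: nerve_pull_def case_prod_unfold)
qed

text \<open>The sum of the coordinates over all fibres of \<open>\<theta>\<close> is the total sum.\<close>

lemma simplex_push_mem:
  assumes \<theta>: "monotone_map m n \<theta>" and t: "t \<in> standard_simplex m"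
  shows "simplex_push m \<theta> t \<in> standard_simplex n"
proof -
  have t0: "\<And>i. 0 \<le> t i" and t1: "(\<Sum>i\<le>m. t i) = 1" using t by (auto simp: standard_simplex_def)
  have le1: "simplex_push m \<theta> t j \<le> 1" for j
  proof -
    have "(\<Sum>i | i \<le> m \<and> \<theta> i = j. t i) \<le> (\<Sum>i\<le>m. t i)"
      by (rule sum_mono2) (auto simp: t0)
    then show ?thesis by (simp add: simplex_push_def t1)
  qed
  have ge0: "0 \<le> simplex_push m \<theta> t j" for j
    unfolding simplex_push_def by (rule sum_nonneg) (simp add: t0)
  have z: "simplex_push m \<theta> t j = 0" if "j > n" for j
  proof -
    have "{i. i \<le> m \<and> \<theta> i = j} = {}" using monotone_mapD(1) [OF \<theta>] that by fastforce
    then show ?thesis unfolding simplex_push_def by (simp only: sum.empty)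
  qed
  have "(\<Sum>j\<le>n. simplex_push m \<theta> t j) = (\<Sum>j\<le>n. \<Sum>i | i \<in> {..m} \<and> \<theta> i = j. t i)"
    by (simp add: simplex_push_def)
  also have "\<dots> = (\<Sum>i\<le>m. t i)"
    by (rule sum.group) (use monotone_mapD(1) [OF \<theta>] in auto)
  finally show ?thesis using le1 ge0 z t1 by (simp add: standard_simplex_def)
qed

section \<open>Totalizations\<close>

lemma topspace_simplex_top [simp]: "topspace (simplex_top n) = standard_simplex n"
  by (simp add: simplex_top_def)

lemma neighbourhood_base_simplex_top: "neighbourhood_base_of (compactin (simplex_top n)) (simplex_top n)"
proof -
  have "compact_space (simplex_top n)"
    unfolding simplex_top_def by (rule compact_space_subtopology [OF compactin_standard_simplex])
  moreover have "Hausdorff_space (simplex_top n)"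
    unfolding simplex_top_def by (intro Hausdorff_space_subtopology) (simp add: Hausdorff_space_product_topology)
  ultimately show ?thesis
    using locally_compact_space_neighbourhood_base compact_imp_locally_compact_space by blast
qed

lemma cosimp_top_fst: "cosimp_top C F n = product_topology (\<lambda>z. F (fst z n)) (nerve C n)"
  by (simp add: cosimp_top_def case_prod_unfold)

lemma topspace_holim_top: "topspace (holim_top C F Fm) = Tot ` tot_set C F Fm"
  by (auto simp: holim_top_def topspace_pullback_topology tot_set_def)

lemma tot_fam_set: "p \<in> topspace (holim_top C F Fm) \<Longrightarrow> tot_fam p \<in> tot_set C F Fm"
  and tot_fam_Tot: "p \<in> topspace (holim_top C F Fm) \<Longrightarrow> Tot (tot_fam p) = p"
  by (auto simp: topspace_holim_top)

lemma tot_fam_cmaps: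
  "p \<in> topspace (holim_top C F Fm) \<Longrightarrow> tot_fam p n \<in> cmaps (simplex_top n) (cosimp_top C F n)"
  by (drule tot_fam_set) (simp add: tot_set_def)

lemma tot_fam_PiE:
  assumes "p \<in> topspace (holim_top C F Fm)" "t \<in> standard_simplex n"
  shows "tot_fam p n t \<in> (\<Pi>\<^sub>E z\<in>nerve C n. topspace (F (fst z n)))"
proof -
  have "continuous_map (simplex_top n) (cosimp_top C F n) (tot_fam p n)"
    using tot_fam_cmaps [OF assms(1)] by (simp add: cmaps_def)
  from continuous_map_funspace [OF this] assms(2) show ?thesis
    by (auto simp: cosimp_top_fst Pi_iff)
qed

lemma tot_fam_mem:
  "p \<in> topspace (holim_top C F Fm) \<Longrightarrow> t \<in> standard_simplex n \<Longrightarrow> z \<in> nerve C n \<Longrightarrow>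
    tot_fam p n t z \<in> topspace (F (fst z n))"
  using tot_fam_PiE by (blast dest: PiE_mem)

lemma tot_fam_push:
  assumes p: "p \<in> topspace (holim_top C F Fm)" and \<theta>: "monotone_map m n \<theta>"
    and t: "t \<in> standard_simplex m" and z: "z \<in> nerve C n"
  shows "tot_fam p n (simplex_push m \<theta> t) z =
    Fm (fst z (\<theta> m)) (fst z n) (snd z (\<theta> m, n)) (tot_fam p m t (nerve_pull m \<theta> z))"
proof -
  have "tot_fam p n (simplex_push m \<theta> t) = cosimp_push C Fm m n \<theta> (tot_fam p m t)"
    using tot_fam_set [OF p] \<theta> t by (simp add: tot_set_def)
  then show ?thesis using z by (simp add: cosimp_push_def case_prod_unfold)
qed

lemma tot_build_cong:
  assumes "\<And>n t z. t \<in> standard_simplex n \<Longrightarrow> z \<in> nerve C n \<Longrightarrow> k n t z = k' n t z"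
  shows "tot_build C k = tot_build C k'"
  unfolding tot_build_def using assms by (intro arg_cong [where f = Tot] ext restrict_ext)

lemma tot_build_eq:
  assumes p: "p \<in> topspace (holim_top C F Fm)"
    and "\<And>n t z. t \<in> standard_simplex n \<Longrightarrow> z \<in> nerve C n \<Longrightarrow> k n t z = tot_fam p n t z"
  shows "tot_build C k = p"
proof -
  have "tot_build C k = tot_build C (tot_fam p)" by (rule tot_build_cong) (rule assms(2))
  also have "\<dots> = Tot (tot_fam p)"
    unfolding tot_build_def
  proof (rule arg_cong [where f = Tot], rule ext)
    fix n
    have ext: "tot_fam p n \<in> extensional (standard_simplex n)"
      using tot_fam_cmaps [OF p, of n] by (simp add: cmaps_def)
    have "tot_fam p n t \<in> extensional (nerve C n)" if "t \<in> standard_simplex n" for t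
      using tot_fam_PiE [OF p that] by (simp add: PiE_def)
    then have "(\<lambda>t\<in>standard_simplex n. \<lambda>z\<in>nerve C n. tot_fam p n t z) = tot_fam p n"
      by (intro extensionalityI [OF restrict_extensional ext]) (simp add: extensional_restrict)
    then show "(\<lambda>t\<in>standard_simplex n. \<lambda>z\<in>nerve C n. tot_fam p n t z) = tot_fam p n" .
  qed
  finally show ?thesis using tot_fam_Tot [OF p] by simp
qed

lemma tot_fam_build [simp]:
  "t \<in> standard_simplex n \<Longrightarrow> z \<in> nerve C n \<Longrightarrow> tot_fam (tot_build C k) n t z = k n t z"
  by (simp add: tot_build_def)

text \<open>Evaluation is jointly continuous in the point of the simplex since simplices are compact.\<close>

lemma continuous_map_tot_fam:
  assumes z: "z \<in> nerve C n"
  shows "continuous_map (prod_topology (holim_top C F Fm) (simplex_top n)) (F (fst z n))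
    (\<lambda>(p, t). tot_fam p n t z)"
proof -
  let ?CO = "\<lambda>n. compact_open_topology (simplex_top n) (cosimp_top C F n)"
  have "continuous_map (holim_top C F Fm) (?CO n) ((\<lambda>\<phi>. \<phi> n) \<circ> tot_fam)"
    unfolding holim_top_def
    by (rule continuous_map_pullback) (rule continuous_map_product_projection, simp)
  from continuous_map_compose [OF continuous_map_fst this]
  have "continuous_map (prod_topology (holim_top C F Fm) (simplex_top n)) (?CO n) (\<lambda>q. tot_fam (fst q) n)"
    by (simp add: o_def)
  from continuous_map_apply2 [OF continuous_map_eval [OF neighbourhood_base_simplex_top] this continuous_map_snd]
  have "continuous_map (prod_topology (holim_top C F Fm) (simplex_top n)) (cosimp_top C F n)
      (\<lambda>q. tot_fam (fst q) n (snd q))" .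
  from continuous_map_compose [OF this [unfolded cosimp_top_fst] continuous_map_product_projection [OF z]]
  show ?thesis by (simp add: o_def case_prod_unfold)
qed

text \<open>A totalization is an end as well, so that currying yields continuous maps into it. The strings
  index a plain product, hence continuity is tested one string at a time.\<close>

lemma continuous_map_into_holim:
  assumes cont: "\<And>n z. z \<in> nerve C n \<Longrightarrow>
      continuous_map (prod_topology P (simplex_top n)) (F (fst z n)) (\<lambda>(p, t). k p n t z)"
    and push: "\<And>p m n \<theta> t z. p \<in> topspace P \<Longrightarrow> monotone_map m n \<theta> \<Longrightarrow> t \<in> standard_simplex m \<Longrightarrow>
      z \<in> nerve C n \<Longrightarrow> k p n (simplex_push m \<theta> t) z =
        Fm (fst z (\<theta> m)) (fst z n) (snd z (\<theta> m, n)) (k p m t (nerve_pull m \<theta> z))"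
  shows "continuous_map P (holim_top C F Fm) (\<lambda>p. tot_build C (k p))"
proof -
  let ?CO = "\<lambda>n. compact_open_topology (simplex_top n) (cosimp_top C F n)"
  let ?k = "\<lambda>p n. \<lambda>t\<in>standard_simplex n. \<lambda>z\<in>nerve C n. k p n t z"
  have "continuous_map (prod_topology P (simplex_top n)) (cosimp_top C F n)
      (\<lambda>(p, t). \<lambda>z\<in>nerve C n. k p n t z)" for n
    using cont by (auto simp: cosimp_top_fst continuous_map_componentwise case_prod_unfold)
  from continuous_map_curry [OF this]
  have curry: "continuous_map P (?CO n) (\<lambda>p. ?k p n)" for n by simp
  show ?thesis
    unfolding holim_top_def
  proof (rule continuous_map_pullback')
    show "continuous_map P (product_topology ?CO UNIV) (tot_fam \<circ> (\<lambda>p. tot_build C (k p)))"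
      using curry by (simp add: o_def tot_build_def continuous_map_componentwise_UNIV)
    show "topspace P \<subseteq> (\<lambda>p. tot_build C (k p)) -` Tot ` tot_set C F Fm"
    proof
      fix p assume p: "p \<in> topspace P"
      have "?k p \<in> tot_set C F Fm"
        unfolding tot_set_def
      proof (intro CollectI conjI allI impI ballI)
        show "?k p n \<in> cmaps (simplex_top n) (cosimp_top C F n)" for n
          using continuous_map_funspace [OF curry [of n]] p by auto
        show "?k p n (simplex_push m \<theta> t) = cosimp_push C Fm m n \<theta> (?k p m t)"
          if "monotone_map m n \<theta>" "t \<in> standard_simplex m" for m n \<theta> t
        proof -
          have "(\<lambda>z\<in>nerve C n. k p n (simplex_push m \<theta> t) z) =
              (\<lambda>z\<in>nerve C n. Fm (fst z (\<theta> m)) (fst z n) (snd z (\<theta> m, n)) (?k p m t (nerve_pull m \<theta> z)))"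
            by (rule restrict_ext) (simp add: push [OF p that] that nerve_pull_mem [OF that(1)])
          then show ?thesis
            unfolding cosimp_push_def using simplex_push_mem [OF that] by (simp add: case_prod_unfold)
        qed
      qed
      then show "p \<in> (\<lambda>p. tot_build C (k p)) -` Tot ` tot_set C F Fm" by (simp add: tot_build_def)
    qed
  qed
qed

text \<open>The one construction behind all structure on \<open>\<tau>\<close>: a reindexing \<open>r\<close> of strings together with natural maps
  \<open>\<kappa> U : F(\<rho> U) \<rightarrow> F'(U)\<close>, depending continuously on a parameter in \<open>S\<close>, induces a map of homotopy
  limits. The action of isometries (with \<open>S\<close> a morphism space), the comparison maps (with \<open>r\<close> the
  conjugation of strings), the effect on 2-morphisms and the restriction to subrepresentations are
  instances. Of the naturality squares only those ending at the last object of a string matter, as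
  the cosimplicial structure maps use no others.\<close>

lemma holim_map_joint:
  assumes r: "\<And>n z. z \<in> nerve D n \<Longrightarrow> r n z \<in> nerve C n"
    and r_pull: "\<And>m n \<theta> z. monotone_map m n \<theta> \<Longrightarrow> z \<in> nerve D n \<Longrightarrow>
      r m (nerve_pull m \<theta> z) = nerve_pull m \<theta> (r n z)"
    and r_obj: "\<And>n z i. z \<in> nerve D n \<Longrightarrow> i \<le> n \<Longrightarrow> fst (r n z) i = \<rho> (fst z i)"
    and \<kappa>: "\<And>U. U \<in> D \<Longrightarrow> continuous_map (prod_topology S (F (\<rho> U))) (F' U) (\<lambda>(s, x). \<kappa> s U x)"
    and nat: "\<And>s n z i x. s \<in> topspace S \<Longrightarrow> z \<in> nerve D n \<Longrightarrow> i \<le> n \<Longrightarrow>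
      x \<in> topspace (F (\<rho> (fst z i))) \<Longrightarrow>
      \<kappa> s (fst z n) (Fm (\<rho> (fst z i)) (\<rho> (fst z n)) (snd (r n z) (i, n)) x) =
        F'm (fst z i) (fst z n) (snd z (i, n)) (\<kappa> s (fst z i) x)"
  shows "continuous_map (prod_topology S (holim_top C F Fm)) (holim_top D F' F'm)
    (\<lambda>(s, p). tot_build D (\<lambda>n t z. \<kappa> s (fst z n) (tot_fam p n t (r n z))))"
proof -
  have "continuous_map (prod_topology S (holim_top C F Fm)) (holim_top D F' F'm)
      (\<lambda>q. tot_build D (\<lambda>n t z. \<kappa> (fst q) (fst z n) (tot_fam (snd q) n t (r n z))))"
  proof (rule continuous_map_into_holim)
    fix n z assume z: "z \<in> nerve D n"
    let ?P = "prod_topology (prod_topology S (holim_top C F Fm)) (simplex_top n)"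
    have "continuous_map ?P (F (fst (r n z) n)) (\<lambda>q. tot_fam (snd (fst q)) n (snd q) (r n z))"
      by (rule continuous_map_apply2 [OF continuous_map_tot_fam [OF r [OF z]] continuous_map_snd_fst continuous_map_snd])
    then have "continuous_map ?P (F (\<rho> (fst z n))) (\<lambda>q. tot_fam (snd (fst q)) n (snd q) (r n z))"
      using r_obj [OF z] by simp
    from continuous_map_apply2 [OF \<kappa> [OF nerve_obj [OF z order_refl]] continuous_map_fst_fst this]
    show "continuous_map ?P (F' (fst z n)) (\<lambda>(q, t). \<kappa> (fst q) (fst z n) (tot_fam (snd q) n t (r n z)))"
      by (simp add: case_prod_unfold)
  next
    fix q m n \<theta> t z
    assume q: "q \<in> topspace (prod_topology S (holim_top C F Fm))" and \<theta>: "monotone_map m n \<theta>"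
      and t: "t \<in> standard_simplex m" and z: "z \<in> nerve D n"
    obtain s p where [simp]: "q = (s, p)" by (cases q)
    have s: "s \<in> topspace S" and p: "p \<in> topspace (holim_top C F Fm)" using q by auto
    have \<theta>m: "\<theta> m \<le> n" using monotone_mapD(1) [OF \<theta>] by simp
    have pull: "nerve_pull m \<theta> z \<in> nerve D m" by (rule nerve_pull_mem [OF \<theta> z])
    have "tot_fam p m t (r m (nerve_pull m \<theta> z)) \<in> topspace (F (\<rho> (fst z (\<theta> m))))"
      using tot_fam_mem [OF p t r [OF pull]] r_obj [OF pull order_refl] by (simp add: nerve_pull_fst)
    from nat [OF s z \<theta>m this]
    show "\<kappa> (fst q) (fst z n) (tot_fam (snd q) n (simplex_push m \<theta> t) (r n z)) =
        F'm (fst z (\<theta> m)) (fst z n) (snd z (\<theta> m, n))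
          (\<kappa> (fst q) (fst (nerve_pull m \<theta> z) m) (tot_fam (snd q) m t (r m (nerve_pull m \<theta> z))))"
      using tot_fam_push [OF p \<theta> t r [OF z]] r_obj [OF z] \<theta>m
      by (simp add: r_pull [OF \<theta> z] nerve_pull_fst)
  qed
  then show ?thesis by (simp add: case_prod_unfold)
qed

lemma holim_map:
  assumes r: "\<And>n z. z \<in> nerve D n \<Longrightarrow> r n z \<in> nerve C n"
    and r_pull: "\<And>m n \<theta> z. monotone_map m n \<theta> \<Longrightarrow> z \<in> nerve D n \<Longrightarrow>
      r m (nerve_pull m \<theta> z) = nerve_pull m \<theta> (r n z)"
    and r_obj: "\<And>n z i. z \<in> nerve D n \<Longrightarrow> i \<le> n \<Longrightarrow> fst (r n z) i = \<rho> (fst z i)"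
    and \<kappa>: "\<And>U. U \<in> D \<Longrightarrow> continuous_map (F (\<rho> U)) (F' U) (\<kappa> U)"
    and nat: "\<And>n z i x. z \<in> nerve D n \<Longrightarrow> i \<le> n \<Longrightarrow> x \<in> topspace (F (\<rho> (fst z i))) \<Longrightarrow>
      \<kappa> (fst z n) (Fm (\<rho> (fst z i)) (\<rho> (fst z n)) (snd (r n z) (i, n)) x) =
        F'm (fst z i) (fst z n) (snd z (i, n)) (\<kappa> (fst z i) x)"
  shows "continuous_map (holim_top C F Fm) (holim_top D F' F'm)
    (\<lambda>p. tot_build D (\<lambda>n t z. \<kappa> (fst z n) (tot_fam p n t (r n z))))"
proof -
  \<comment> \<open>The parameter space is a point.\<close>
  have "continuous_map (prod_topology (discrete_topology {()}) (F (\<rho> U))) (F' U) (\<lambda>(s, x). \<kappa> U x)"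
    if "U \<in> D" for U
    using continuous_map_compose [OF continuous_map_snd \<kappa> [OF that]] by (simp add: o_def case_prod_unfold)
  then have "continuous_map (prod_topology (discrete_topology {()}) (holim_top C F Fm)) (holim_top D F' F'm)
      (\<lambda>(s, p). tot_build D (\<lambda>n t z. \<kappa> (fst z n) (tot_fam p n t (r n z))))"
    by (intro holim_map_joint [where \<kappa> = "\<lambda>_. \<kappa>" and \<rho> = \<rho> and F = F and Fm = Fm and F' = F' and F'm = F'm]
        r r_pull r_obj nat)
  moreover have "continuous_map (holim_top C F Fm) (prod_topology (discrete_topology {()}) (holim_top C F Fm)) (\<lambda>p. ((), p))"
    by (intro continuous_map_pairedI) auto
  ultimately show ?thesis by (force dest: continuous_map_compose simp: o_def)
qed

section \<open>Strings of nonzero subspaces of a representation\<close>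

lemma vcatD:
  assumes "U \<in> vcat \<beta>"
  shows "subspace U" "U \<subseteq> rspace \<beta>" "U \<noteq> {0}"
  using assms by (auto simp: vcat_def)

lemma nerve_conj_fst: "i \<le> n \<Longrightarrow> fst (nerve_conj G \<beta> a n z) i = ract \<beta> a ` fst z i"
  by (simp add: nerve_conj_def case_prod_unfold)

lemma nerve_conj_snd: "i \<le> j \<Longrightarrow> j \<le> n \<Longrightarrow>
    snd (nerve_conj G \<beta> a n z) (i, j) = conj_map G \<beta> \<beta> a (fst z i) (snd z (i, j))"
  by (simp add: nerve_conj_def case_prod_unfold)

lemma nerve_conj_pull:
  assumes "monotone_map m n \<theta>"
  shows "nerve_conj G \<beta> a m (nerve_pull m \<theta> z) = nerve_pull m \<theta> (nerve_conj G \<beta> a n z)"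
  using monotone_mapD [OF assms]
  by (auto simp: nerve_conj_def nerve_pull_def case_prod_unfold intro!: restrict_ext)

context group
begin

context
  fixes \<beta> assumes \<beta>: "orthogonal_rep G \<beta>"
begin

lemma vcat_image:
  assumes a: "a \<in> carrier G" and U: "U \<in> vcat \<beta>"
  shows "ract \<beta> a ` U \<in> vcat \<beta>"
proof -
  note U' = vcatD [OF U]
  have "ract \<beta> a ` U \<noteq> {0}"
  proof
    assume 0: "ract \<beta> a ` U = {0}"
    have "U = ract \<beta> (inv a) ` {0}"
      using rep_image_inv_left [OF \<beta> a U'(2)] 0 by simp
    moreover have "ract \<beta> (inv a) 0 = 0"
      using Mor_zero [OF rep_Mor [OF \<beta>, of "inv a"] rep_subspace [OF \<beta>]] a subspace_0 [OF rep_subspace [OF \<beta>]] by simp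
    ultimately show False using U'(3) by simp
  qed
  then show ?thesis
    using rep_image_subspace [OF \<beta> a U'(1,2)] rep_image_subset [OF \<beta> a U'(2)] by (simp add: vcat_def)
qed

lemma nerve_conj_mem:
  assumes a: "a \<in> carrier G" and z: "z \<in> nerve (vcat \<beta>) n"
  shows "nerve_conj G \<beta> a n z \<in> nerve (vcat \<beta>) n"
proof -
  have c: "subspace (fst z i)" "fst z i \<subseteq> rspace \<beta>" if "i \<le> n" for i
    using vcatD [OF nerve_obj [OF z that]] by auto
  show ?thesis
  proof (rule nerveI)
    show "fst (nerve_conj G \<beta> a n z) i \<in> vcat \<beta>" if "i \<le> n" for i
      using vcat_image [OF a nerve_obj [OF z that]] that by (simp add: nerve_conj_fst)
    show "snd (nerve_conj G \<beta> a n z) (i, j) \<in> Mor (fst (nerve_conj G \<beta> a n z) i) (fst (nerve_conj G \<beta> a n z) j)"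
      if "i \<le> j" "j \<le> n" for i j
      using conj_map_Mor [OF \<beta> \<beta> a c c nerve_Mor [OF z that]] that by (simp add: nerve_conj_fst nerve_conj_snd)
    show "snd (nerve_conj G \<beta> a n z) (i, i) = (\<lambda>x\<in>fst (nerve_conj G \<beta> a n z) i. x)" if "i \<le> n" for i
      using that c(2) [OF that] nerve_id [OF z that] conj_map_id [OF \<beta> a]
      by (simp add: nerve_conj_fst nerve_conj_snd)
    show "snd (nerve_conj G \<beta> a n z) (i, k) = compose (fst (nerve_conj G \<beta> a n z) i)
        (snd (nerve_conj G \<beta> a n z) (j, k)) (snd (nerve_conj G \<beta> a n z) (i, j))"
      if ijk: "i \<le> j" "j \<le> k" "k \<le> n" for i j k
    proof -
      have "snd z (i, j) \<in> fst z i \<rightarrow> fst z j" using nerve_Mor [OF z ijk(1)] ijk by (auto dest: Mor_mem)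
      from conj_map_compose [OF \<beta> \<beta> a c(2) c(2) this, of \<beta> "snd z (j, k)"] show ?thesis
        using ijk nerve_comp [OF z ijk] by (simp add: nerve_conj_fst nerve_conj_snd)
    qed
  qed (simp_all add: nerve_conj_def case_prod_unfold)
qed

lemma nerve_conj_mult:
  assumes a: "a \<in> carrier G" "b \<in> carrier G" and z: "z \<in> nerve (vcat \<beta>) n"
  shows "nerve_conj G \<beta> b n (nerve_conj G \<beta> a n z) = nerve_conj G \<beta> (b \<otimes> a) n z"
proof (rule prod_eqI)
  have c: "fst z i \<subseteq> rspace \<beta>" if "i \<le> n" for i
    using vcatD [OF nerve_obj [OF z that]] by auto
  show "fst (nerve_conj G \<beta> b n (nerve_conj G \<beta> a n z)) = fst (nerve_conj G \<beta> (b \<otimes> a) n z)"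
    by (rule extensionalityI [of _ "{..n}"])
      (use rep_image_mult [OF \<beta> a(2,1) c] in \<open>auto simp: nerve_conj_def case_prod_unfold\<close>)
  show "snd (nerve_conj G \<beta> b n (nerve_conj G \<beta> a n z)) = snd (nerve_conj G \<beta> (b \<otimes> a) n z)"
  proof (rule extensionalityI [of _ "{(i, j). i \<le> j \<and> j \<le> n}"])
    fix ij assume "ij \<in> {(i, j). i \<le> j \<and> j \<le> n}"
    then obtain i j where [simp]: "ij = (i, j)" and ij: "i \<le> j" "j \<le> n" by blast
    have "snd z (i, j) \<in> fst z i \<rightarrow> rspace \<beta>"
      using Mor_mem [OF nerve_Mor [OF z ij]] c [OF ij(2)] by blast
    then show "snd (nerve_conj G \<beta> b n (nerve_conj G \<beta> a n z)) ij = snd (nerve_conj G \<beta> (b \<otimes> a) n z) ij"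
      using conj_map_mult [OF \<beta> \<beta> a c] ij by (simp add: nerve_conj_snd nerve_conj_fst)
  qed (simp_all add: nerve_conj_def case_prod_unfold)
qed

lemma nerve_conj_one:
  assumes z: "z \<in> nerve (vcat \<beta>) n"
  shows "nerve_conj G \<beta> \<one> n z = z"
proof (rule prod_eqI)
  have c: "fst z i \<subseteq> rspace \<beta>" if "i \<le> n" for i
    using vcatD [OF nerve_obj [OF z that]] by auto
  show "fst (nerve_conj G \<beta> \<one> n z) = fst z"
    by (rule extensionalityI [of _ "{..n}"])
      (use rep_image_one [OF \<beta> c] nerve_ext [OF z] in \<open>auto simp: nerve_conj_def case_prod_unfold\<close>)
  show "snd (nerve_conj G \<beta> \<one> n z) = snd z"
  proof (rule extensionalityI [of _ "{(i, j). i \<le> j \<and> j \<le> n}"])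
    fix ij assume "ij \<in> {(i, j). i \<le> j \<and> j \<le> n}"
    then obtain i j where [simp]: "ij = (i, j)" and ij: "i \<le> j" "j \<le> n" by blast
    then show "snd (nerve_conj G \<beta> \<one> n z) ij = snd z ij"
      using conj_map_one [OF \<beta> \<beta> c nerve_Mor [OF z ij] c] ij by (simp add: nerve_conj_snd)
  qed (use nerve_ext [OF z] in \<open>simp_all add: nerve_conj_def case_prod_unfold\<close>)
qed

end

end

section \<open>The action as a comparison map\<close>

text \<open>Elements of \<open>H\<close> represent the identity of \<open>G/H\<close>, and their comparison maps are the action. Thus every
  equivariance condition is an instance of naturality or functoriality of comparison maps, and
  verifying the axioms of a 1-morphism reduces to the conditions below, in which the action occurs
  only once.\<close>

lemma (in group) one_morphismI:
  assumes U: "orthogonal_rep G \<U>"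
    and pt: "\<And>H W. subgroup H G \<Longrightarrow> W \<in> Rep \<U> H \<Longrightarrow> pt0 (obj E H W) \<in> topspace (tp (obj E H W))"
    and mor: "\<And>H W W'. subgroup H G \<Longrightarrow> W \<in> Rep \<U> H \<Longrightarrow> W' \<in> Rep \<U> H \<Longrightarrow>
      continuous_map (prod_topology (Mor_top W W') (tp (obj E H W))) (tp (obj E H W')) (\<lambda>(f, x). mor E H W W' f x)"
    and mor_pt: "\<And>H W W' f. subgroup H G \<Longrightarrow> W \<in> Rep \<U> H \<Longrightarrow> W' \<in> Rep \<U> H \<Longrightarrow> f \<in> Mor W W' \<Longrightarrow>
      mor E H W W' f (pt0 (obj E H W)) = pt0 (obj E H W')"
    and mor_id: "\<And>H W x. subgroup H G \<Longrightarrow> W \<in> Rep \<U> H \<Longrightarrow> x \<in> topspace (tp (obj E H W)) \<Longrightarrow>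
      mor E H W W (\<lambda>w\<in>W. w) x = x"
    and mor_comp: "\<And>H W W' W'' f g x. subgroup H G \<Longrightarrow> W \<in> Rep \<U> H \<Longrightarrow> W' \<in> Rep \<U> H \<Longrightarrow> W'' \<in> Rep \<U> H \<Longrightarrow>
      f \<in> Mor W W' \<Longrightarrow> g \<in> Mor W' W'' \<Longrightarrow> x \<in> topspace (tp (obj E H W)) \<Longrightarrow>
      mor E H W W'' (compose W g f) x = mor E H W' W'' g (mor E H W W' f x)"
    and homeo: "\<And>a K H V. orbit_map G a K H \<Longrightarrow> V \<in> Rep \<U> K \<Longrightarrow> ract \<U> a ` V \<in> Rep \<U> H \<Longrightarrow>
      homeomorphic_map (tp (obj E K V)) (tp (obj E H (ract \<U> a ` V))) (cmp E a K H V)"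
    and cmp_pt: "\<And>a K H V. orbit_map G a K H \<Longrightarrow> V \<in> Rep \<U> K \<Longrightarrow> ract \<U> a ` V \<in> Rep \<U> H \<Longrightarrow>
      cmp E a K H V (pt0 (obj E K V)) = pt0 (obj E H (ract \<U> a ` V))"
    and cmp_mor: "\<And>a K H V V' f x. orbit_map G a K H \<Longrightarrow> V \<in> Rep \<U> K \<Longrightarrow> V' \<in> Rep \<U> K \<Longrightarrow>
      ract \<U> a ` V \<in> Rep \<U> H \<Longrightarrow> ract \<U> a ` V' \<in> Rep \<U> H \<Longrightarrow> f \<in> Mor V V' \<Longrightarrow> x \<in> topspace (tp (obj E K V)) \<Longrightarrow>
      cmp E a K H V' (mor E K V V' f x) =
      mor E H (ract \<U> a ` V) (ract \<U> a ` V') (conj_map G \<U> \<U> a V f) (cmp E a K H V x)"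
    and cmp_cmp: "\<And>a b L K H V x. orbit_map G b L K \<Longrightarrow> orbit_map G a K H \<Longrightarrow> V \<in> Rep \<U> L \<Longrightarrow>
      ract \<U> b ` V \<in> Rep \<U> K \<Longrightarrow> ract \<U> (a \<otimes> b) ` V \<in> Rep \<U> H \<Longrightarrow> x \<in> topspace (tp (obj E L V)) \<Longrightarrow>
      cmp E (a \<otimes> b) L H V x = cmp E a K H (ract \<U> b ` V) (cmp E b L K V x)"
    and act: "\<And>H V h x. subgroup H G \<Longrightarrow> h \<in> H \<Longrightarrow> V \<in> Rep \<U> H \<Longrightarrow> x \<in> topspace (tp (obj E H V)) \<Longrightarrow>
      cmp E h H H V x = act (obj E H V) h x"
  shows "one_morphism G \<U> E"
proof -
  have selfh: "homeomorphic_map (tp (obj E H W)) (tp (obj E H W)) (cmp E h H H W)"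
    if "subgroup H G" "W \<in> Rep \<U> H" "h \<in> H" for H W h
    using homeo [OF orbit_map_self [OF that(1,3)] that(2)] that(2) Rep_image_eq [OF U that] by simp
  have self_mem: "cmp E h H H W x \<in> topspace (tp (obj E H W))"
    if "subgroup H G" "W \<in> Rep \<U> H" "h \<in> H" "x \<in> topspace (tp (obj E H W))" for H W h x
    using homeomorphic_imp_surjective_map [OF selfh [OF that(1-3)]] that(4) by blast
  have self_mult: "cmp E (h \<otimes> k) H H W x = cmp E h H H W (cmp E k H H W x)"
    if "subgroup H G" "W \<in> Rep \<U> H" "h \<in> H" "k \<in> H" "x \<in> topspace (tp (obj E H W))" for H W h k x
    using cmp_cmp [OF orbit_map_self [OF that(1,4)] orbit_map_self [OF that(1,3)] that(2) _ _ that(5)]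
      Rep_image_eq [OF U that(1,2)] that subgroup.m_closed [OF that(1)] by simp
  have pointed: "pointed_gspace G H (obj E H W)" if H: "subgroup H G" and W: "W \<in> Rep \<U> H" for H W
    unfolding pointed_gspace_def
  proof (intro conjI ballI)
    fix h assume h: "h \<in> H"
    show "continuous_map (tp (obj E H W)) (tp (obj E H W)) (act (obj E H W) h)"
      by (rule continuous_map_eq [OF homeomorphic_imp_continuous_map [OF selfh [OF H W h]]])
        (rule act [OF H h W])
    show "act (obj E H W) h (pt0 (obj E H W)) = pt0 (obj E H W)"
      using cmp_pt [OF orbit_map_self [OF H h] W] Rep_image_eq [OF U H W h] W act [OF H h W pt [OF H W]] by simp
    fix k x assume k: "k \<in> H" and x: "x \<in> topspace (tp (obj E H W))"
    show "act (obj E H W) (h \<otimes> k) x = act (obj E H W) h (act (obj E H W) k x)"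
      using self_mult [OF H W h k x] act [OF H _ W x] act [OF H h W self_mem [OF H W k x]] h k
        subgroup.m_closed [OF H] by simp
  next
    fix x assume x: "x \<in> topspace (tp (obj E H W))"
    have 1: "\<one> \<in> H" by (rule subgroup.one_closed [OF H])
    \<comment> \<open>The comparison map of the unit is idempotent and injective, hence the identity.\<close>
    have "cmp E \<one> H H W (cmp E \<one> H H W x) = cmp E \<one> H H W x"
      using self_mult [OF H W 1 1 x] by simp
    then have "cmp E \<one> H H W x = x"
      using homeomorphic_imp_injective_map [OF selfh [OF H W 1]] self_mem [OF H W 1 x] x by (simp add: inj_on_eq_iff)
    then show "act (obj E H W) \<one> x = x" using act [OF H 1 W x] by simp
  qed (rule pt [OF H W])
  have mor_equiv: "mor E H W W' (conj_map G \<U> \<U> h W f) (act (obj E H W) h x) = act (obj E H W') h (mor E H W W' f x)"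
    if H: "subgroup H G" and W: "W \<in> Rep \<U> H" "W' \<in> Rep \<U> H" and h: "h \<in> H" and f: "f \<in> Mor W W'"
      and x: "x \<in> topspace (tp (obj E H W))" for H W W' h f x
  proof -
    have fx: "mor E H W W' f x \<in> topspace (tp (obj E H W'))"
      using continuous_map_funspace [OF mor [OF H W]] f x by (auto simp: Pi_iff)
    have "cmp E h H H W' (mor E H W W' f x) = mor E H W W' (conj_map G \<U> \<U> h W f) (cmp E h H H W x)"
      using cmp_mor [OF orbit_map_self [OF H h] W _ _ f x] Rep_image_eq [OF U H _ h] W by simp
    then show ?thesis
      unfolding act [OF H h W(1) x] act [OF H h W(2) fx] by (rule sym)
  qed
  have cmp_equiv: "cmp E a K H V (act (obj E K V) k x) =
      act (obj E H (ract \<U> a ` V)) (a \<otimes> k \<otimes> inv a) (cmp E a K H V x)"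
    if o: "orbit_map G a K H" and V: "V \<in> Rep \<U> K" "ract \<U> a ` V \<in> Rep \<U> H" and k: "k \<in> K"
      and x: "x \<in> topspace (tp (obj E K V))" for a K H V k x
  proof -
    note D = orbit_mapD [OF o]
    have kG: "k \<in> carrier G" by (rule subgroup.mem_carrier [OF D(2) k])
    have akV: "ract \<U> (a \<otimes> k) ` V = ract \<U> a ` V"
      using rep_image_mult [OF U D(1) kG RepD(3) [OF V(1)]] Rep_image_eq [OF U D(2) V(1) k] by simp
    have ax: "cmp E a K H V x \<in> topspace (tp (obj E H (ract \<U> a ` V)))"
      using homeomorphic_imp_surjective_map [OF homeo [OF o V]] x by blast
    have "cmp E a K H V (act (obj E K V) k x) = cmp E (a \<otimes> k) K H V x"
      using cmp_cmp [OF orbit_map_self [OF D(2) k] o V(1) _ _ x] act [OF D(2) k V(1) x]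
        Rep_image_eq [OF U D(2) V(1) k] akV V by simp
    moreover have "act (obj E H (ract \<U> a ` V)) (a \<otimes> k \<otimes> inv a) (cmp E a K H V x) =
        cmp E (a \<otimes> k \<otimes> inv a \<otimes> a) K H V x"
      using cmp_cmp [OF o orbit_map_self [OF D(3) D(4) [OF k]] V _ x] act [OF D(3) D(4) [OF k] V(2) ax] akV V D(1) kG
      by (simp add: m_assoc)
    moreover have "a \<otimes> k \<otimes> inv a \<otimes> a = a \<otimes> k" using D(1) kG by (simp add: m_assoc)
    ultimately show ?thesis by simp
  qed
  have "enriched_functor G \<U> H (obj E H) (mor E H)" if "subgroup H G" for H
    unfolding enriched_functor_def
    using pointed [OF that] mor [OF that] mor_pt [OF that] mor_equiv [OF that] mor_id [OF that] mor_comp [OF that]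
    by simp
  then show ?thesis
    unfolding one_morphism_def
    using homeo cmp_pt cmp_equiv cmp_mor cmp_cmp act
    by (intro conjI allI impI ballI) simp_all
qed

text \<open>Likewise, compatibility with comparison maps contains the equivariance of a 2-morphism.\<close>

lemma two_morphismI:
  assumes E: "weiss_functor G \<U> E" and F: "weiss_functor G \<U> F"
    and cont: "\<And>H W. subgroup H G \<Longrightarrow> W \<in> Rep \<U> H \<Longrightarrow> continuous_map (tp (obj E H W)) (tp (obj F H W)) (\<eta> H W)"
    and pt: "\<And>H W. subgroup H G \<Longrightarrow> W \<in> Rep \<U> H \<Longrightarrow> \<eta> H W (pt0 (obj E H W)) = pt0 (obj F H W)"
    and mor: "\<And>H W W' f x. subgroup H G \<Longrightarrow> W \<in> Rep \<U> H \<Longrightarrow> W' \<in> Rep \<U> H \<Longrightarrow> f \<in> Mor W W' \<Longrightarrow>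
      x \<in> topspace (tp (obj E H W)) \<Longrightarrow> \<eta> H W' (mor E H W W' f x) = mor F H W W' f (\<eta> H W x)"
    and cmp: "\<And>a K H V x. orbit_map G a K H \<Longrightarrow> V \<in> Rep \<U> K \<Longrightarrow> ract \<U> a ` V \<in> Rep \<U> H \<Longrightarrow>
      x \<in> topspace (tp (obj E K V)) \<Longrightarrow> \<eta> H (ract \<U> a ` V) (cmp E a K H V x) = cmp F a K H V (\<eta> K V x)"
  shows "two_morphism G \<U> E F \<eta>"
proof -
  interpret E: weiss_functor G \<U> E by (rule E)
  interpret F: weiss_functor G \<U> F by (rule F)
  have "\<eta> H W (act (obj E H W) h x) = act (obj F H W) h (\<eta> H W x)"
    if H: "subgroup H G" and W: "W \<in> Rep \<U> H" and h: "h \<in> H" and x: "x \<in> topspace (tp (obj E H W))" for H W h x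
  proof -
    have "\<eta> H W x \<in> topspace (tp (obj F H W))" using continuous_map_funspace [OF cont [OF H W]] x by blast
    then show ?thesis
      using cmp [OF E.orbit_map_self [OF H h] W _ x] E.Rep_image_eq [OF E.universe_rep H W h] W
        E.cmp_act [OF H h W x] F.cmp_act [OF H h W] by simp
  qed
  then show ?thesis
    unfolding two_morphism_def using E.one_morphism F.one_morphism cont pt mor cmp by simp
qed

section \<open>The functor tau\<close>

locale tau_functor = kan_functor G \<U> E
  for G :: "('g, 'm) monoid_scheme" (structure) and \<U> :: "('g, 'v::real_inner) rep"
    and E :: "('g, 'v, ('x, 'v, 'a::real_inner) point) weiss" +
  fixes \<beta> :: "('g, 'a) rep"
  assumes finite_rep: "finite_rep G \<beta>"
begin

lemma \<beta>_rep: "orthogonal_rep G \<beta>" and fin_dim_\<beta>: "fin_dim (rspace \<beta>)"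
  using finite_rep by (auto simp: finite_rep_def)

lemma fin_dim_vcat: "U \<in> vcat \<beta> \<Longrightarrow> fin_dim U"
  using fin_dim_subset [OF fin_dim_\<beta>] vcatD by blast

lemma Rep_Times:
  assumes "W \<in> Rep \<U> H" "U \<in> vcat \<beta>"
  shows "fin_dim (W \<times> U)" "subspace (W \<times> U)" "W \<times> U \<subseteq> rspace (\<U> \<oplus>\<^sub>r \<beta>)"
  using fin_dim_Times [OF RepD(2) [OF assms(1)] fin_dim_vcat [OF assms(2)]] RepD [OF assms(1)] vcatD [OF assms(2)]
  by (auto dest: fin_dim_subspace)

lemma tau_tp: "tp (obj (tau G \<U> \<beta> E) H W) =
    holim_top (vcat \<beta>) (\<lambda>U. kan_top \<U> E H (W \<times> U))
      (\<lambda>U U' m. kan_mor \<U> H (W \<times> U) (W \<times> U') (map_sum W U (\<lambda>w. w) m))"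
  by (simp add: tau_def tau_obj_def)

lemma tau_pt0: "pt0 (obj (tau G \<U> \<beta> E) H W) = tot_build (vcat \<beta>) (\<lambda>n t z. kan_base \<U> E H (W \<times> fst z n))"
  by (simp add: tau_def tau_obj_def case_prod_unfold)

lemma tau_act: "act (obj (tau G \<U> \<beta> E) H W) h p = tot_build (vcat \<beta>) (\<lambda>n t z.
    kan_act G \<U> \<beta> E H h (W \<times> ract \<beta> (inv h) ` fst z n) (tot_fam p n t (nerve_conj G \<beta> (inv h) n z)))"
  by (simp add: tau_def tau_obj_def case_prod_unfold)

lemma tau_mor: "mor (tau G \<U> \<beta> E) H W W' g p = tot_build (vcat \<beta>) (\<lambda>n t z.
    kan_mor \<U> H (W \<times> fst z n) (W' \<times> fst z n) (map_sum W (fst z n) g (\<lambda>u. u)) (tot_fam p n t z))"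
  by (simp add: tau_def case_prod_unfold)

lemma tau_cmp: "cmp (tau G \<U> \<beta> E) a K H V p = tot_build (vcat \<beta>) (\<lambda>n t z.
    kan_cmp G \<U> \<beta> E a K H (V \<times> ract \<beta> (inv a) ` fst z n) (tot_fam p n t (nerve_conj G \<beta> (inv a) n z)))"
  by (simp add: tau_def case_prod_unfold)

lemma tau_fam_mem:
  "p \<in> topspace (tp (obj (tau G \<U> \<beta> E) H W)) \<Longrightarrow> t \<in> standard_simplex n \<Longrightarrow> z \<in> nerve (vcat \<beta>) n \<Longrightarrow>
    tot_fam p n t z \<in> topspace (kan_top \<U> E H (W \<times> fst z n))"
  using tot_fam_mem [of p "vcat \<beta>" "\<lambda>U. kan_top \<U> E H (W \<times> U)"] by (simp add: tau_tp)

lemma vcat_last: "z \<in> nerve (vcat \<beta>) n \<Longrightarrow> fst z n \<in> vcat \<beta>"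
  by (rule nerve_obj) auto

lemma incl_Mor: "W \<in> Rep \<U> H \<Longrightarrow> U \<in> vcat \<beta> \<Longrightarrow> m \<in> Mor U U' \<Longrightarrow>
    map_sum W U (\<lambda>w. w) m \<in> Mor (W \<times> U) (W \<times> U')"
  using RepD vcatD by (intro map_sum_id_left_Mor) blast+

lemma ext_Mor: "W \<in> Rep \<U> H \<Longrightarrow> U \<in> vcat \<beta> \<Longrightarrow> g \<in> Mor W W' \<Longrightarrow>
    map_sum W U g (\<lambda>u. u) \<in> Mor (W \<times> U) (W' \<times> U)"
  using RepD vcatD by (intro map_sum_id_right_Mor) blast+

text \<open>The constant family at the base points is a point of the homotopy limit. It is obtained as a
  continuous family over the one-point space.\<close>

lemma tau_pt0_mem:
  assumes H: "subgroup H G" and W: "W \<in> Rep \<U> H"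
  shows "pt0 (obj (tau G \<U> \<beta> E) H W) \<in> topspace (tp (obj (tau G \<U> \<beta> E) H W))"
proof -
  have "continuous_map (discrete_topology {()}) (tp (obj (tau G \<U> \<beta> E) H W))
      (\<lambda>_. tot_build (vcat \<beta>) (\<lambda>n t z. kan_base \<U> E H (W \<times> fst z n)))"
    unfolding tau_tp
  proof (rule continuous_map_into_holim)
    show "continuous_map (prod_topology (discrete_topology {()}) (simplex_top n))
        (kan_top \<U> E H (W \<times> fst z n)) (\<lambda>(p, t). kan_base \<U> E H (W \<times> fst z n))"
      if "z \<in> nerve (vcat \<beta>) n" for n z
      using kan_base_mem [OF H Rep_Times(2) [OF W vcat_last [OF that]]] by (simp add: case_prod_unfold)
    show "kan_base \<U> E H (W \<times> fst z n) = kan_mor \<U> H (W \<times> fst z (\<theta> m)) (W \<times> fst z n)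
        (map_sum W (fst z (\<theta> m)) (\<lambda>w. w) (snd z (\<theta> m, n))) (kan_base \<U> E H (W \<times> fst (nerve_pull m \<theta> z) m))"
      if "monotone_map m n \<theta>" "z \<in> nerve (vcat \<beta>) n" for m n \<theta> z
    proof -
      have \<theta>m: "\<theta> m \<le> n" using monotone_mapD(1) [OF that(1)] by simp
      have U: "fst z (\<theta> m) \<in> vcat \<beta>" by (rule nerve_obj [OF that(2) \<theta>m])
      from kan_mor_base [OF H Rep_Times(2) [OF W U] incl_Mor [OF W U nerve_Mor [OF that(2) \<theta>m order_refl]]]
      show ?thesis by (simp add: nerve_pull_fst)
    qed
  qed
  from continuous_map_funspace [OF this] show ?thesis by (auto simp: tau_pt0)
qed

text \<open>The two ways of composing \<open>W \<oplus> U \<rightarrow> W' \<oplus> U'\<close> from \<open>f\<close> and the last morphism of a string agree, which is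
  the naturality that is required for a map of homotopy limits.\<close>

lemma tau_mor_continuous:
  assumes H: "subgroup H G" and W: "W \<in> Rep \<U> H" "W' \<in> Rep \<U> H"
  shows "continuous_map (prod_topology (Mor_top W W') (tp (obj (tau G \<U> \<beta> E) H W)))
    (tp (obj (tau G \<U> \<beta> E) H W')) (\<lambda>(f, x). mor (tau G \<U> \<beta> E) H W W' f x)"
  unfolding tau_tp tau_mor
proof (rule holim_map_joint [where r = "\<lambda>n z. z" and \<rho> = "\<lambda>U. U"
      and \<kappa> = "\<lambda>f U. kan_mor \<U> H (W \<times> U) (W' \<times> U) (map_sum W U f (\<lambda>u. u))"])
  fix U assume U: "U \<in> vcat \<beta>"
  let ?P = "prod_topology (Mor_top W W') (kan_top \<U> E H (W \<times> U))"
  have "continuous_map ?P (Mor_top (W \<times> U) (W' \<times> U)) (\<lambda>q. map_sum W U (fst q) (\<lambda>u. u))"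
    using continuous_map_compose [OF continuous_map_fst continuous_map_map_sum [OF RepD(1) [OF W(1)] vcatD(1) [OF U]]]
    by (simp add: o_def)
  from continuous_map_apply2 [OF kan_mor_continuous [OF H Rep_Times(1) [OF W(1) U] Rep_Times(2) [OF W(2) U]] this continuous_map_snd]
  show "continuous_map ?P (kan_top \<U> E H (W' \<times> U))
      (\<lambda>(f, x). kan_mor \<U> H (W \<times> U) (W' \<times> U) (map_sum W U f (\<lambda>u. u)) x)"
    by (simp add: case_prod_unfold)
next
  fix f n i x and z :: "'a nchain"
  assume "f \<in> topspace (Mor_top W W')" and z: "z \<in> nerve (vcat \<beta>) n" and i: "i \<le> n"
  then have f: "f \<in> Mor W W'" by simp
  let ?U = "fst z i" and ?U' = "fst z n" and ?m = "snd z (i, n)"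
  have U: "?U \<in> vcat \<beta>" "?U' \<in> vcat \<beta>" and m: "?m \<in> Mor ?U ?U'"
    using nerve_obj [OF z] nerve_Mor [OF z i] i by auto
  have "compose (W \<times> ?U) (map_sum W ?U' f (\<lambda>u. u)) (map_sum W ?U (\<lambda>w. w) ?m) = map_sum W ?U f ?m"
    "compose (W \<times> ?U) (map_sum W' ?U (\<lambda>w. w) ?m) (map_sum W ?U f (\<lambda>u. u)) = map_sum W ?U f ?m"
    using Mor_mem [OF f] Mor_mem [OF m] by (auto simp: compose_def map_sum_def restrict_def fun_eq_iff)
  then show "kan_mor \<U> H (W \<times> ?U') (W' \<times> ?U') (map_sum W ?U' f (\<lambda>u. u))
        (kan_mor \<U> H (W \<times> ?U) (W \<times> ?U') (map_sum W ?U (\<lambda>w. w) ?m) x) =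
      kan_mor \<U> H (W' \<times> ?U) (W' \<times> ?U') (map_sum W' ?U (\<lambda>w. w) ?m)
        (kan_mor \<U> H (W \<times> ?U) (W' \<times> ?U) (map_sum W ?U f (\<lambda>u. u)) x)"
    by (simp add: kan_mor_comp [OF Rep_Times(2) [OF W(1) U(1)] incl_Mor [OF W(1) U(1) m] ext_Mor [OF W(1) U(2) f] Rep_Times(2) [OF W(1) U(2)]]
      kan_mor_comp [OF Rep_Times(2) [OF W(1) U(1)] ext_Mor [OF W(1) U(1) f] incl_Mor [OF W(2) U(1) m] Rep_Times(2) [OF W(2) U(1)]])
qed auto

lemma tau_mor_pt0:
  assumes "subgroup H G" "W \<in> Rep \<U> H" "W' \<in> Rep \<U> H" "f \<in> Mor W W'"
  shows "mor (tau G \<U> \<beta> E) H W W' f (pt0 (obj (tau G \<U> \<beta> E) H W)) = pt0 (obj (tau G \<U> \<beta> E) H W')"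
  unfolding tau_mor tau_pt0
proof (rule tot_build_cong)
  fix n t and z :: "'a nchain" assume t: "t \<in> standard_simplex n" and z: "z \<in> nerve (vcat \<beta>) n"
  from kan_mor_base [OF assms(1) Rep_Times(2) [OF assms(2) vcat_last [OF z]] ext_Mor [OF assms(2) vcat_last [OF z] assms(4)]]
  show "kan_mor \<U> H (W \<times> fst z n) (W' \<times> fst z n) (map_sum W (fst z n) f (\<lambda>u. u))
      (tot_fam (tot_build (vcat \<beta>) (\<lambda>n t z. kan_base \<U> E H (W \<times> fst z n))) n t z) = kan_base \<U> E H (W' \<times> fst z n)"
    using t z by simp
qed

lemma tau_mor_id:
  assumes "W \<in> Rep \<U> H" "p \<in> topspace (tp (obj (tau G \<U> \<beta> E) H W))"
  shows "mor (tau G \<U> \<beta> E) H W W (\<lambda>w\<in>W. w) p = p"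
  unfolding tau_mor
proof (rule tot_build_eq [OF assms(2) [unfolded tau_tp]])
  fix n t and z :: "'a nchain" assume t: "t \<in> standard_simplex n" and z: "z \<in> nerve (vcat \<beta>) n"
  show "kan_mor \<U> H (W \<times> fst z n) (W \<times> fst z n) (map_sum W (fst z n) (\<lambda>w\<in>W. w) (\<lambda>u. u)) (tot_fam p n t z) = tot_fam p n t z"
    by (rule kan_mor_id [OF tau_fam_mem [OF assms(2) t z]]) (auto simp: map_sum_def)
qed

lemma tau_mor_comp:
  assumes W: "W \<in> Rep \<U> H" "W' \<in> Rep \<U> H" and f: "f \<in> Mor W W'" and g: "g \<in> Mor W' W''"
  shows "mor (tau G \<U> \<beta> E) H W W'' (compose W g f) p = mor (tau G \<U> \<beta> E) H W' W'' g (mor (tau G \<U> \<beta> E) H W W' f p)"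
  unfolding tau_mor
proof (rule tot_build_cong)
  fix n t and z :: "'a nchain" assume t: "t \<in> standard_simplex n" and z: "z \<in> nerve (vcat \<beta>) n"
  let ?U = "fst z n"
  have U: "?U \<in> vcat \<beta>" by (rule vcat_last [OF z])
  have "compose (W \<times> ?U) (map_sum W' ?U g (\<lambda>u. u)) (map_sum W ?U f (\<lambda>u. u)) = map_sum W ?U (compose W g f) (\<lambda>u. u)"
    using Mor_mem [OF f] by (auto simp: compose_def map_sum_def restrict_def fun_eq_iff)
  then show "kan_mor \<U> H (W \<times> ?U) (W'' \<times> ?U) (map_sum W ?U (compose W g f) (\<lambda>u. u)) (tot_fam p n t z) =
      kan_mor \<U> H (W' \<times> ?U) (W'' \<times> ?U) (map_sum W' ?U g (\<lambda>u. u)) (tot_fam (tot_build (vcat \<beta>)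
        (\<lambda>n t z. kan_mor \<U> H (W \<times> fst z n) (W' \<times> fst z n) (map_sum W (fst z n) f (\<lambda>u. u)) (tot_fam p n t z))) n t z)"
    using t z
    by (simp add: kan_mor_comp [OF Rep_Times(2) [OF W(1) U] ext_Mor [OF W(1) U f] ext_Mor [OF W(2) U g] Rep_Times(2) [OF W(2) U]])
qed

context
  fixes a K H V
  assumes o: "orbit_map G a K H" and V: "V \<in> Rep \<U> K" and aV: "ract \<U> a ` V \<in> Rep \<U> H"
begin

lemma ga: "a \<in> carrier G" "inv a \<in> carrier G" and subK: "subgroup K G"
  using orbit_mapD [OF o] by auto

lemma vcat_push_pull [simp]: "U \<in> vcat \<beta> \<Longrightarrow> ract \<beta> a ` ract \<beta> (inv a) ` U = U"
  and vcat_pull_push [simp]: "U \<in> vcat \<beta> \<Longrightarrow> ract \<beta> (inv a) ` ract \<beta> a ` U = U"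
  by (rule rep_image_inv_right [OF \<beta>_rep ga(1) vcatD(2)], assumption)
    (rule rep_image_inv_left [OF \<beta>_rep ga(1) vcatD(2)], assumption)

lemma tau_pull_vcat: "U \<in> vcat \<beta> \<Longrightarrow> ract \<beta> (inv a) ` U \<in> vcat \<beta>"
  using vcat_image [OF \<beta>_rep] ga by auto

lemma tau_kan_cmp_homeo:
  "U \<in> vcat \<beta> \<Longrightarrow> homeomorphic_map (kan_top \<U> E K (V \<times> U)) (kan_top \<U> E H (ract \<U> a ` V \<times> ract \<beta> a ` U))
    (kan_cmp G \<U> \<beta> E a K H (V \<times> U))"
  using kan_cmp_homeo [OF \<beta>_rep o Rep_Times(1,3) [OF V]] by simp

text \<open>The conjugate of \<open>1 \<oplus> m\<close> is \<open>1 \<oplus> ama\<inverse>\<close>.\<close>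

lemma tau_kan_cmp_mor:
  assumes U: "U \<in> vcat \<beta>" "U' \<in> vcat \<beta>" and m: "m \<in> Mor U U'"
  shows "kan_cmp G \<U> \<beta> E a K H (V \<times> U') (kan_mor \<U> K (V \<times> U) (V \<times> U') (map_sum V U (\<lambda>w. w) m) p) =
    kan_mor \<U> H (ract \<U> a ` V \<times> ract \<beta> a ` U) (ract \<U> a ` V \<times> ract \<beta> a ` U')
      (map_sum (ract \<U> a ` V) (ract \<beta> a ` U) (\<lambda>w. w) (conj_map G \<beta> \<beta> a U m)) (kan_cmp G \<U> \<beta> E a K H (V \<times> U) p)"
proof -
  have "conj_map G (\<U> \<oplus>\<^sub>r \<beta>) (\<U> \<oplus>\<^sub>r \<beta>) a (V \<times> U) (map_sum V U (\<lambda>w. w) m) =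
      map_sum (ract \<U> a ` V) (ract \<beta> a ` U) (\<lambda>w. w) (conj_map G \<beta> \<beta> a U m)"
    unfolding conj_map_sum [OF universe_rep \<beta>_rep ga(1) RepD(3) [OF V] vcatD(2) [OF U(1)]]
    by (rule map_sum_cong) (use conj_map_apply [OF universe_rep ga(1) RepD(3) [OF V]] in auto)
  then show ?thesis
    using kan_cmp_mor [OF \<beta>_rep o Rep_Times(1,3) [OF V U(1)] Rep_Times(2,3) [OF V U(2)] incl_Mor [OF V U(1) m]] by simp
qed

text \<open>Strings of subspaces are permuted by conjugation with \<open>a\<close>, and the comparison maps of the Kan
  extension are homeomorphisms. Their inverses \<open>g U\<close> are natural too, so that they induce an inverse
  \<open>\<Psi>\<close>, which conjugates strings by \<open>a\<close> in place of \<open>a\<inverse>\<close>. Inverting \<open>cmp\<close> directly is not possible since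
  there is in general no map of orbits from \<open>G/H\<close> back to \<open>G/K\<close>.\<close>

lemma tau_cmp_homeo:
  "homeomorphic_map (tp (obj (tau G \<U> \<beta> E) K V)) (tp (obj (tau G \<U> \<beta> E) H (ract \<U> a ` V))) (cmp (tau G \<U> \<beta> E) a K H V)"
proof -
  let ?aV = "ract \<U> a ` V"
  have "\<forall>U\<in>vcat \<beta>. \<exists>g. homeomorphic_maps (kan_top \<U> E K (V \<times> U)) (kan_top \<U> E H (?aV \<times> ract \<beta> a ` U))
      (kan_cmp G \<U> \<beta> E a K H (V \<times> U)) g"
    using tau_kan_cmp_homeo homeomorphic_map_maps by blast
  from bchoice [OF this] obtain g where
    g: "\<And>U. U \<in> vcat \<beta> \<Longrightarrow> homeomorphic_maps (kan_top \<U> E K (V \<times> U))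
      (kan_top \<U> E H (?aV \<times> ract \<beta> a ` U)) (kan_cmp G \<U> \<beta> E a K H (V \<times> U)) (g U)" by blast
  have gl: "g U (kan_cmp G \<U> \<beta> E a K H (V \<times> U) x) = x" if "U \<in> vcat \<beta>" "x \<in> topspace (kan_top \<U> E K (V \<times> U))" for U x
    using g [OF that(1)] that(2) by (simp add: homeomorphic_maps_def)
  have gr: "kan_cmp G \<U> \<beta> E a K H (V \<times> U) (g U y) = y" "g U y \<in> topspace (kan_top \<U> E K (V \<times> U))"
    if "U \<in> vcat \<beta>" "y \<in> topspace (kan_top \<U> E H (?aV \<times> ract \<beta> a ` U))" for U y
    using g [OF that(1)] that(2) continuous_map_funspace [of "kan_top \<U> E H (?aV \<times> ract \<beta> a ` U)"]
    by (auto simp: homeomorphic_maps_def)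
  define \<Psi> where "\<Psi> q = tot_build (vcat \<beta>) (\<lambda>n t z. g (fst z n) (tot_fam q n t (nerve_conj G \<beta> a n z)))" for q
  have "homeomorphic_maps (tp (obj (tau G \<U> \<beta> E) K V)) (tp (obj (tau G \<U> \<beta> E) H ?aV)) (cmp (tau G \<U> \<beta> E) a K H V) \<Psi>"
    unfolding homeomorphic_maps_def
  proof (intro conjI ballI)
    show "continuous_map (tp (obj (tau G \<U> \<beta> E) K V)) (tp (obj (tau G \<U> \<beta> E) H ?aV)) (cmp (tau G \<U> \<beta> E) a K H V)"
      unfolding tau_tp tau_cmp
    proof (rule holim_map [where r = "nerve_conj G \<beta> (inv a)" and \<rho> = "\<lambda>U. ract \<beta> (inv a) ` U"
          and \<kappa> = "\<lambda>U. kan_cmp G \<U> \<beta> E a K H (V \<times> ract \<beta> (inv a) ` U)"])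
      show "continuous_map (kan_top \<U> E K (V \<times> ract \<beta> (inv a) ` U)) (kan_top \<U> E H (?aV \<times> U))
          (kan_cmp G \<U> \<beta> E a K H (V \<times> ract \<beta> (inv a) ` U))" if "U \<in> vcat \<beta>" for U
        using homeomorphic_imp_continuous_map [OF tau_kan_cmp_homeo [OF tau_pull_vcat [OF that]]] that by simp
      fix n i x and z :: "'a nchain" assume z: "z \<in> nerve (vcat \<beta>) n" and i: "i \<le> n"
      let ?U = "fst z i" and ?U' = "fst z n" and ?m = "snd z (i, n)"
      have U: "?U \<in> vcat \<beta>" "?U' \<in> vcat \<beta>" and m: "?m \<in> Mor ?U ?U'"
        using nerve_obj [OF z] nerve_Mor [OF z i] i by auto
      have m': "conj_map G \<beta> \<beta> (inv a) ?U ?m \<in> Mor (ract \<beta> (inv a) ` ?U) (ract \<beta> (inv a) ` ?U')"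
        by (rule conj_map_Mor [OF \<beta>_rep \<beta>_rep ga(2) vcatD(1,2) [OF U(1)] vcatD(1,2) [OF U(2)] m])
      show "kan_cmp G \<U> \<beta> E a K H (V \<times> ract \<beta> (inv a) ` ?U') (kan_mor \<U> K (V \<times> ract \<beta> (inv a) ` ?U)
            (V \<times> ract \<beta> (inv a) ` ?U') (map_sum V (ract \<beta> (inv a) ` ?U) (\<lambda>w. w) (snd (nerve_conj G \<beta> (inv a) n z) (i, n))) x) =
          kan_mor \<U> H (?aV \<times> ?U) (?aV \<times> ?U') (map_sum ?aV ?U (\<lambda>w. w) ?m)
            (kan_cmp G \<U> \<beta> E a K H (V \<times> ract \<beta> (inv a) ` ?U) x)"
        using tau_kan_cmp_mor [OF tau_pull_vcat [OF U(1)] tau_pull_vcat [OF U(2)] m'] U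
          conj_map_inv(2) [OF \<beta>_rep \<beta>_rep ga(1) vcatD(2) [OF U(1)] m vcatD(2) [OF U(2)]] i
        by (simp add: nerve_conj_snd)
    qed (use ga in \<open>auto intro: nerve_conj_mem [OF \<beta>_rep] simp: nerve_conj_pull nerve_conj_fst\<close>)
    show "continuous_map (tp (obj (tau G \<U> \<beta> E) H ?aV)) (tp (obj (tau G \<U> \<beta> E) K V)) \<Psi>"
      unfolding tau_tp \<Psi>_def
    proof (rule holim_map [where r = "nerve_conj G \<beta> a" and \<rho> = "\<lambda>U. ract \<beta> a ` U" and \<kappa> = g])
      show "continuous_map (kan_top \<U> E H (?aV \<times> ract \<beta> a ` U)) (kan_top \<U> E K (V \<times> U)) (g U)" if "U \<in> vcat \<beta>" for U
        using g [OF that] by (simp add: homeomorphic_maps_def)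
      fix n i x and z :: "'a nchain" assume z: "z \<in> nerve (vcat \<beta>) n" and i: "i \<le> n"
        and x: "x \<in> topspace (kan_top \<U> E H (?aV \<times> ract \<beta> a ` fst z i))"
      let ?U = "fst z i" and ?U' = "fst z n" and ?m = "snd z (i, n)"
      have U: "?U \<in> vcat \<beta>" "?U' \<in> vcat \<beta>" and m: "?m \<in> Mor ?U ?U'"
        using nerve_obj [OF z] nerve_Mor [OF z i] i by auto
      let ?y = "kan_mor \<U> K (V \<times> ?U) (V \<times> ?U') (map_sum V ?U (\<lambda>w. w) ?m) (g ?U x)"
      \<comment> \<open>Naturality of the inverses: apply the naturality of the comparison maps to the preimage of x.\<close>
      have "?y \<in> topspace (kan_top \<U> E K (V \<times> ?U'))"
        by (rule kan_mor_mem [OF subK Rep_Times(1) [OF V U(1)] Rep_Times(2) [OF V U(2)] incl_Mor [OF V U(1) m] gr(2) [OF U(1) x]])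
      from gl [OF U(2) this]
      show "g ?U' (kan_mor \<U> H (?aV \<times> ract \<beta> a ` ?U) (?aV \<times> ract \<beta> a ` ?U')
            (map_sum ?aV (ract \<beta> a ` ?U) (\<lambda>w. w) (snd (nerve_conj G \<beta> a n z) (i, n))) x) = ?y"
        using tau_kan_cmp_mor [OF U m, of "g ?U x"] gr(1) [OF U(1) x] i by (simp add: nerve_conj_snd)
    qed (use ga in \<open>auto intro: nerve_conj_mem [OF \<beta>_rep] simp: nerve_conj_pull nerve_conj_fst\<close>)
  next
    fix p assume p: "p \<in> topspace (tp (obj (tau G \<U> \<beta> E) K V))"
    show "\<Psi> (cmp (tau G \<U> \<beta> E) a K H V p) = p"
      unfolding \<Psi>_def tau_cmp
    proof (rule tot_build_eq [OF p [unfolded tau_tp]])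
      fix n t and z :: "'a nchain" assume t: "t \<in> standard_simplex n" and z: "z \<in> nerve (vcat \<beta>) n"
      show "g (fst z n) (tot_fam (tot_build (vcat \<beta>) (\<lambda>n t z. kan_cmp G \<U> \<beta> E a K H (V \<times> ract \<beta> (inv a) ` fst z n)
          (tot_fam p n t (nerve_conj G \<beta> (inv a) n z)))) n t (nerve_conj G \<beta> a n z)) = tot_fam p n t z"
        using gl [OF vcat_last [OF z] tau_fam_mem [OF p t z]] vcat_last [OF z] t ga
        by (simp add: nerve_conj_mem [OF \<beta>_rep ga(1) z] nerve_conj_fst nerve_conj_mult [OF \<beta>_rep _ _ z] nerve_conj_one [OF \<beta>_rep z])
    qed
  next
    fix q assume q: "q \<in> topspace (tp (obj (tau G \<U> \<beta> E) H ?aV))"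
    show "cmp (tau G \<U> \<beta> E) a K H V (\<Psi> q) = q"
      unfolding \<Psi>_def tau_cmp
    proof (rule tot_build_eq [OF q [unfolded tau_tp]])
      fix n t and z :: "'a nchain" assume t: "t \<in> standard_simplex n" and z: "z \<in> nerve (vcat \<beta>) n"
      show "kan_cmp G \<U> \<beta> E a K H (V \<times> ract \<beta> (inv a) ` fst z n)
          (tot_fam (tot_build (vcat \<beta>) (\<lambda>n t z. g (fst z n) (tot_fam q n t (nerve_conj G \<beta> a n z)))) n t (nerve_conj G \<beta> (inv a) n z)) =
          tot_fam q n t z"
        using gr(1) [OF tau_pull_vcat [OF vcat_last [OF z]]] tau_fam_mem [OF q t z] vcat_last [OF z] t ga
        by (simp add: nerve_conj_mem [OF \<beta>_rep ga(2) z] nerve_conj_fst nerve_conj_mult [OF \<beta>_rep _ _ z] nerve_conj_one [OF \<beta>_rep z])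
    qed
  qed
  then show ?thesis by (rule homeomorphic_maps_imp_map)
qed

lemma tau_cmp_pt0:
  "cmp (tau G \<U> \<beta> E) a K H V (pt0 (obj (tau G \<U> \<beta> E) K V)) = pt0 (obj (tau G \<U> \<beta> E) H (ract \<U> a ` V))"
  unfolding tau_cmp tau_pt0
proof (rule tot_build_cong)
  fix n t and z :: "'a nchain" assume t: "t \<in> standard_simplex n" and z: "z \<in> nerve (vcat \<beta>) n"
  show "kan_cmp G \<U> \<beta> E a K H (V \<times> ract \<beta> (inv a) ` fst z n) (tot_fam (tot_build (vcat \<beta>)
        (\<lambda>n t z. kan_base \<U> E K (V \<times> fst z n))) n t (nerve_conj G \<beta> (inv a) n z)) = kan_base \<U> E H (ract \<U> a ` V \<times> fst z n)"
    using kan_cmp_base [OF \<beta>_rep o Rep_Times(1,3) [OF V tau_pull_vcat [OF vcat_last [OF z]]]] t vcat_last [OF z]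
    by (simp add: nerve_conj_mem [OF \<beta>_rep ga(2) z] nerve_conj_fst)
qed

lemma tau_cmp_mor:
  assumes V': "V' \<in> Rep \<U> K" and f: "f \<in> Mor V V'"
  shows "cmp (tau G \<U> \<beta> E) a K H V' (mor (tau G \<U> \<beta> E) K V V' f p) =
    mor (tau G \<U> \<beta> E) H (ract \<U> a ` V) (ract \<U> a ` V') (conj_map G \<U> \<U> a V f) (cmp (tau G \<U> \<beta> E) a K H V p)"
  unfolding tau_cmp tau_mor
proof (rule tot_build_cong)
  fix n t and z :: "'a nchain" assume t: "t \<in> standard_simplex n" and z: "z \<in> nerve (vcat \<beta>) n"
  let ?U = "ract \<beta> (inv a) ` fst z n"
  have U: "?U \<in> vcat \<beta>" by (rule tau_pull_vcat [OF vcat_last [OF z]])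
  have "conj_map G (\<U> \<oplus>\<^sub>r \<beta>) (\<U> \<oplus>\<^sub>r \<beta>) a (V \<times> ?U) (map_sum V ?U f (\<lambda>u. u)) =
      map_sum (ract \<U> a ` V) (ract \<beta> a ` ?U) (conj_map G \<U> \<U> a V f) (\<lambda>u. u)"
    unfolding conj_map_sum [OF universe_rep \<beta>_rep ga(1) RepD(3) [OF V] vcatD(2) [OF U]]
    by (rule map_sum_cong) (use conj_map_apply [OF \<beta>_rep ga(1) vcatD(2) [OF U]] in auto)
  then show "kan_cmp G \<U> \<beta> E a K H (V' \<times> ?U) (tot_fam (tot_build (vcat \<beta>) (\<lambda>n t z. kan_mor \<U> K (V \<times> fst z n) (V' \<times> fst z n)
        (map_sum V (fst z n) f (\<lambda>u. u)) (tot_fam p n t z))) n t (nerve_conj G \<beta> (inv a) n z)) =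
      kan_mor \<U> H (ract \<U> a ` V \<times> fst z n) (ract \<U> a ` V' \<times> fst z n)
        (map_sum (ract \<U> a ` V) (fst z n) (conj_map G \<U> \<U> a V f) (\<lambda>u. u))
        (tot_fam (tot_build (vcat \<beta>) (\<lambda>n t z. kan_cmp G \<U> \<beta> E a K H (V \<times> ract \<beta> (inv a) ` fst z n)
          (tot_fam p n t (nerve_conj G \<beta> (inv a) n z)))) n t z)"
    using kan_cmp_mor [OF \<beta>_rep o Rep_Times(1,3) [OF V U] Rep_Times(2,3) [OF V' U] ext_Mor [OF V U f]] t z vcat_last [OF z]
    by (simp add: nerve_conj_mem [OF \<beta>_rep ga(2) z] nerve_conj_fst)
qed

end

lemma tau_cmp_cmp:
  assumes o: "orbit_map G b L K" "orbit_map G a K H" and V: "V \<in> Rep \<U> L"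
    and p: "p \<in> topspace (tp (obj (tau G \<U> \<beta> E) L V))"
  shows "cmp (tau G \<U> \<beta> E) (a \<otimes> b) L H V p =
    cmp (tau G \<U> \<beta> E) a K H (ract \<U> b ` V) (cmp (tau G \<U> \<beta> E) b L K V p)"
  unfolding tau_cmp
proof (rule tot_build_cong)
  fix n t and z :: "'a nchain" assume t: "t \<in> standard_simplex n" and z: "z \<in> nerve (vcat \<beta>) n"
  have ab: "a \<in> carrier G" "b \<in> carrier G" "inv a \<in> carrier G" "inv b \<in> carrier G" "inv b \<otimes> inv a \<in> carrier G"
    using o by (auto simp: orbit_map_def)
  have iab: "inv (a \<otimes> b) = inv b \<otimes> inv a" using ab by (simp add: inv_mult_group)
  have U: "fst z n \<in> vcat \<beta>" "ract \<beta> (inv a) ` fst z n \<in> vcat \<beta>" "ract \<beta> (inv b) ` ract \<beta> (inv a) ` fst z n \<in> vcat \<beta>"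
    using vcat_last [OF z] vcat_image [OF \<beta>_rep] ab by auto
  have im: "ract \<beta> (inv b \<otimes> inv a) ` fst z n = ract \<beta> (inv b) ` ract \<beta> (inv a) ` fst z n"
    using rep_image_mult [OF \<beta>_rep ab(4,3) vcatD(2) [OF U(1)]] .
  have az: "nerve_conj G \<beta> (inv a) n z \<in> nerve (vcat \<beta>) n" by (rule nerve_conj_mem [OF \<beta>_rep ab(3) z])
  have "tot_fam p n t (nerve_conj G \<beta> (inv b \<otimes> inv a) n z) \<in> topspace (kan_top \<U> E L (V \<times> ract \<beta> (inv b) ` ract \<beta> (inv a) ` fst z n))"
    using tau_fam_mem [OF p t nerve_conj_mem [OF \<beta>_rep ab(5) z]] by (simp add: nerve_conj_fst im)
  from kan_cmp_cmp [OF \<beta>_rep o Rep_Times(1,3) [OF V U(3)] this]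
  show "kan_cmp G \<U> \<beta> E (a \<otimes> b) L H (V \<times> ract \<beta> (inv (a \<otimes> b)) ` fst z n) (tot_fam p n t (nerve_conj G \<beta> (inv (a \<otimes> b)) n z)) =
      kan_cmp G \<U> \<beta> E a K H (ract \<U> b ` V \<times> ract \<beta> (inv a) ` fst z n) (tot_fam (tot_build (vcat \<beta>)
        (\<lambda>n t z. kan_cmp G \<U> \<beta> E b L K (V \<times> ract \<beta> (inv b) ` fst z n) (tot_fam p n t (nerve_conj G \<beta> (inv b) n z)))) n t
        (nerve_conj G \<beta> (inv a) n z))"
    using t az rep_image_inv_right [OF \<beta>_rep ab(2) vcatD(2) [OF U(2)]]
    by (simp add: iab im nerve_conj_fst nerve_conj_mult [OF \<beta>_rep ab(3,4) z])
qed

lemma tau_cmp_act: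
  assumes H: "subgroup H G" and h: "h \<in> H" and V: "V \<in> Rep \<U> H"
    and p: "p \<in> topspace (tp (obj (tau G \<U> \<beta> E) H V))"
  shows "cmp (tau G \<U> \<beta> E) h H H V p = act (obj (tau G \<U> \<beta> E) H V) h p"
  unfolding tau_cmp tau_act
proof (rule tot_build_cong)
  fix n t and z :: "'a nchain" assume t: "t \<in> standard_simplex n" and z: "z \<in> nerve (vcat \<beta>) n"
  have h': "inv h \<in> carrier G" using subgroup.mem_carrier [OF H h] by simp
  have U: "ract \<beta> (inv h) ` fst z n \<in> vcat \<beta>" by (rule vcat_image [OF \<beta>_rep h' vcat_last [OF z]])
  show "kan_cmp G \<U> \<beta> E h H H (V \<times> ract \<beta> (inv h) ` fst z n) (tot_fam p n t (nerve_conj G \<beta> (inv h) n z)) =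
      kan_act G \<U> \<beta> E H h (V \<times> ract \<beta> (inv h) ` fst z n) (tot_fam p n t (nerve_conj G \<beta> (inv h) n z))"
    by (rule kan_cmp_act [OF \<beta>_rep H h Rep_Times(1,3) [OF V U]])
      (use tau_fam_mem [OF p t nerve_conj_mem [OF \<beta>_rep h' z]] in \<open>simp add: nerve_conj_fst\<close>)
qed

theorem one_morphism_tau: "one_morphism G \<U> (tau G \<U> \<beta> E)"
  by (rule one_morphismI [OF universe_rep])
    (rule tau_pt0_mem tau_mor_continuous tau_mor_pt0 tau_mor_id tau_mor_comp tau_cmp_homeo tau_cmp_pt0
      tau_cmp_mor tau_cmp_cmp tau_cmp_act; assumption)+

end

section \<open>Functoriality of tau\<close>

context tau_functor
begin

lemma weiss_functor_tau: "weiss_functor G \<U> (tau G \<U> \<beta> E)"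
  by unfold_locales (rule universe one_morphism_tau)+

end

lemma tau_two_apply: "tau_two \<U> \<beta> \<eta> H W p =
    tot_build (vcat \<beta>) (\<lambda>n t z. kan_two \<U> \<eta> H (W \<times> fst z n) (tot_fam p n t z))"
  by (simp add: tau_two_def case_prod_unfold)

lemma tau_two_comp: "tau_two \<U> \<beta> \<theta> H W (tau_two \<U> \<beta> \<eta> H W p) = tau_two \<U> \<beta> (\<theta> \<circ>\<^sub>2 \<eta>) H W p"
  unfolding tau_two_apply by (rule tot_build_cong) (simp add: kan_two_comp)

lemma (in tau_functor) tau_two_cong:
  assumes "p \<in> topspace (tp (obj (tau G \<U> \<beta> E) H W))"
    and "\<And>Z x. Z \<in> Rep \<U> H \<Longrightarrow> x \<in> topspace (tp (obj E H Z)) \<Longrightarrow> \<eta> H Z x = \<theta> H Z x"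
  shows "tau_two \<U> \<beta> \<eta> H W p = tau_two \<U> \<beta> \<theta> H W p"
  unfolding tau_two_apply
proof (rule tot_build_cong)
  fix n t and z :: "'a nchain" assume t: "t \<in> standard_simplex n" and z: "z \<in> nerve (vcat \<beta>) n"
  show "kan_two \<U> \<eta> H (W \<times> fst z n) (tot_fam p n t z) = kan_two \<U> \<theta> H (W \<times> fst z n) (tot_fam p n t z)"
    by (rule kan_two_cong [OF tau_fam_mem [OF assms(1) t z]]) (rule assms(2))
qed

lemma (in tau_functor) tau_two_id:
  assumes p: "p \<in> topspace (tp (obj (tau G \<U> \<beta> E) H W))"
  shows "tau_two \<U> \<beta> (\<lambda>H W x. x) H W p = p"
  unfolding tau_two_apply
  by (rule tot_build_eq [OF p [unfolded tau_tp]]) (rule kan_two_id [OF tau_fam_mem [OF p]])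

locale tau_two_cell = kan_two_cell G \<U> E F \<eta> + tau_functor G \<U> E \<beta> + F: tau_functor G \<U> F \<beta>
  for G :: "('g, 'm) monoid_scheme" (structure) and \<U> :: "('g, 'v::real_inner) rep"
    and E F :: "('g, 'v, ('x, 'v, 'a::real_inner) point) weiss" and \<eta> and \<beta>
begin

theorem two_morphism_tau_two: "two_morphism G \<U> (tau G \<U> \<beta> E) (tau G \<U> \<beta> F) (tau_two \<U> \<beta> \<eta>)"
proof (rule two_morphismI [OF weiss_functor_tau F.weiss_functor_tau])
  fix H W assume H: "subgroup H G" and W: "W \<in> Rep \<U> H"
  show "continuous_map (tp (obj (tau G \<U> \<beta> E) H W)) (tp (obj (tau G \<U> \<beta> F) H W)) (tau_two \<U> \<beta> \<eta> H W)"
    unfolding tau_tp F.tau_tp tau_two_apply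
  proof (rule holim_map [where r = "\<lambda>n z. z" and \<rho> = "\<lambda>U. U" and \<kappa> = "\<lambda>U. kan_two \<U> \<eta> H (W \<times> U)"])
    show "continuous_map (kan_top \<U> E H (W \<times> U)) (kan_top \<U> F H (W \<times> U)) (kan_two \<U> \<eta> H (W \<times> U))"
      if "U \<in> vcat \<beta>" for U
      by (rule kan_two_continuous [OF H Rep_Times(1) [OF W that]])
    show "kan_two \<U> \<eta> H (W \<times> fst z n) (kan_mor \<U> H (W \<times> fst z i) (W \<times> fst z n)
          (map_sum W (fst z i) (\<lambda>w. w) (snd z (i, n))) x) =
        kan_mor \<U> H (W \<times> fst z i) (W \<times> fst z n)
          (map_sum W (fst z i) (\<lambda>w. w) (snd z (i, n))) (kan_two \<U> \<eta> H (W \<times> fst z i) x)"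
      if z: "z \<in> nerve (vcat \<beta>) n" and i: "i \<le> n" for n z i x
      by (rule kan_two_mor [OF Rep_Times(2) [OF W nerve_obj [OF z i]]
            incl_Mor [OF W nerve_obj [OF z i] nerve_Mor [OF z i order_refl]]])
  qed auto
  show "tau_two \<U> \<beta> \<eta> H W (pt0 (obj (tau G \<U> \<beta> E) H W)) = pt0 (obj (tau G \<U> \<beta> F) H W)"
    unfolding tau_two_apply tau_pt0 F.tau_pt0 by (rule tot_build_cong) (simp add: kan_two_base [OF H])
  show "tau_two \<U> \<beta> \<eta> H W' (mor (tau G \<U> \<beta> E) H W W' f p) = mor (tau G \<U> \<beta> F) H W W' f (tau_two \<U> \<beta> \<eta> H W p)"
    if W': "W' \<in> Rep \<U> H" and f: "f \<in> Mor W W'" for W' f p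
    unfolding tau_two_apply tau_mor F.tau_mor
    by (rule tot_build_cong) (simp add: kan_two_mor [OF Rep_Times(2) [OF W vcat_last] ext_Mor [OF W vcat_last f]])
next
  fix a K H V p
  assume o: "orbit_map G a K H" and V: "V \<in> Rep \<U> K" and aV: "ract \<U> a ` V \<in> Rep \<U> H"
    and p: "p \<in> topspace (tp (obj (tau G \<U> \<beta> E) K V))"
  show "tau_two \<U> \<beta> \<eta> H (ract \<U> a ` V) (cmp (tau G \<U> \<beta> E) a K H V p) = cmp (tau G \<U> \<beta> F) a K H V (tau_two \<U> \<beta> \<eta> K V p)"
    unfolding tau_two_apply tau_cmp F.tau_cmp
  proof (rule tot_build_cong)
    fix n t and z :: "'a nchain" assume t: "t \<in> standard_simplex n" and z: "z \<in> nerve (vcat \<beta>) n"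
    have ia: "inv a \<in> carrier G" using orbit_mapD(1) [OF o] by simp
    let ?U = "ract \<beta> (inv a) ` fst z n"
    have U: "?U \<in> vcat \<beta>" by (rule vcat_image [OF \<beta>_rep ia vcat_last [OF z]])
    have az: "nerve_conj G \<beta> (inv a) n z \<in> nerve (vcat \<beta>) n" by (rule nerve_conj_mem [OF \<beta>_rep ia z])
    have "tot_fam p n t (nerve_conj G \<beta> (inv a) n z) \<in> topspace (kan_top \<U> E K (V \<times> ?U))"
      using tau_fam_mem [OF p t az] by (simp add: nerve_conj_fst)
    from kan_two_cmp [OF \<beta>_rep o Rep_Times(1,3) [OF V U] this]
    show "kan_two \<U> \<eta> H (ract \<U> a ` V \<times> fst z n) (tot_fam (tot_build (vcat \<beta>) (\<lambda>n t z.
          kan_cmp G \<U> \<beta> E a K H (V \<times> ract \<beta> (inv a) ` fst z n) (tot_fam p n t (nerve_conj G \<beta> (inv a) n z)))) n t z) =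
        kan_cmp G \<U> \<beta> F a K H (V \<times> ?U) (tot_fam (tot_build (vcat \<beta>) (\<lambda>n t z.
          kan_two \<U> \<eta> K (V \<times> fst z n) (tot_fam p n t z))) n t (nerve_conj G \<beta> (inv a) n z))"
      using t z az vcat_push_pull [OF o V aV vcat_last [OF z]] by (simp add: nerve_conj_fst)
  qed
qed

end

section \<open>The unit of tau\<close>

context tau_functor
begin

text \<open>The component at \<open>U\<close> of the unit \<open>E \<rightarrow> \<tau>E\<close>: the image of \<open>x\<close> under the inclusion \<open>W \<rightarrow> W \<oplus> U\<close>, as a natural
  transformation.\<close>

definition kan_unit :: "'g set \<Rightarrow> 'v set \<Rightarrow> 'a set \<Rightarrow> ('x, 'v, 'a) point \<Rightarrow> ('x, 'v, 'a) point" where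
  "kan_unit H W U x = Kan (\<lambda>Z\<in>Rep \<U> H. \<lambda>g\<in>Mor (W \<times> U) Z. mor E H W Z (\<lambda>w\<in>W. g (w, 0)) x)"

lemma tau_unit_apply: "tau_unit \<U> \<beta> E H W x = tot_build (vcat \<beta>) (\<lambda>n t z. kan_unit H W (fst z n) x)"
  by (simp add: tau_unit_def kan_unit_def case_prod_unfold)

context
  fixes H W U
  assumes H: "subgroup H G" and W: "W \<in> Rep \<U> H" and U: "U \<in> vcat \<beta>"
begin

lemma zero_incl: "(\<lambda>w\<in>W. (w, 0)) \<in> Mor W (W \<times> U)"
  using RepD(1) [OF W] vcatD(1) [OF U]
  by (intro MorI) (auto simp: subspace_add subspace_scale subspace_0 norm_Pair)

lemma zero_restrict: "(\<lambda>w\<in>W. g (w, 0)) = compose W g (\<lambda>w\<in>W. (w, 0))"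
  by (simp add: compose_def fun_eq_iff restrict_def)

lemma zero_restrict_Mor: "g \<in> Mor (W \<times> U) Z \<Longrightarrow> (\<lambda>w\<in>W. g (w, 0)) \<in> Mor W Z"
  unfolding zero_restrict by (rule Mor_compose [OF zero_incl _ RepD(1) [OF W]])

lemma kan_unit_continuous: "continuous_map (tp (obj E H W)) (kan_top \<U> E H (W \<times> U)) (kan_unit H W U)"
  unfolding kan_unit_def
proof (rule continuous_map_into_kan [OF Rep_Times(2) [OF W U]])
  fix Z assume Z: "Z \<in> Rep \<U> H"
  let ?P = "prod_topology (tp (obj E H W)) (Mor_top (W \<times> U) Z)"
  have "continuous_map ?P (Mor_top W Z) (\<lambda>q. \<lambda>w\<in>W. snd q (w, 0))"
    unfolding zero_restrict
    by (rule continuous_map_Mor_compose [OF continuous_map_snd continuous_map_Mor_const [OF zero_incl]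
          RepD(1) [OF W] Rep_Times(2) [OF W U]])
  from continuous_map_apply2 [OF mor_cont [OF H W Z] this continuous_map_fst]
  show "continuous_map ?P (tp (obj E H Z)) (\<lambda>(x, g). mor E H W Z (\<lambda>w\<in>W. g (w, 0)) x)"
    by (simp add: case_prod_unfold)
next
  fix x Z Z' u g
  assume x: "x \<in> topspace (tp (obj E H W))" and Z: "Z \<in> Rep \<U> H" "Z' \<in> Rep \<U> H"
    and u: "u \<in> Mor Z Z'" and g: "g \<in> Mor (W \<times> U) Z"
  have "(\<lambda>w\<in>W. compose (W \<times> U) u g (w, 0)) = compose W u (\<lambda>w\<in>W. g (w, 0))"
    using vcatD(1) [OF U] by (auto simp: compose_def fun_eq_iff restrict_def subspace_0)
  then show "mor E H W Z' (\<lambda>w\<in>W. compose (W \<times> U) u g (w, 0)) x = mor E H Z Z' u (mor E H W Z (\<lambda>w\<in>W. g (w, 0)) x)"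
    using mor_comp [OF H W Z zero_restrict_Mor [OF g] u x] by simp
qed

lemma kan_unit_base: "kan_unit H W U (pt0 (obj E H W)) = kan_base \<U> E H (W \<times> U)"
  unfolding kan_unit_def kan_base_def
  by (intro arg_cong [where f = Kan] restrict_ext) (simp add: mor_pt0 [OF H W _ zero_restrict_Mor])

lemma kan_unit_incl:
  assumes U': "U' \<in> vcat \<beta>" and m: "m \<in> Mor U U'"
  shows "kan_mor \<U> H (W \<times> U) (W \<times> U') (map_sum W U (\<lambda>w. w) m) (kan_unit H W U x) = kan_unit H W U' x"
proof -
  have "(\<lambda>w\<in>W. compose (W \<times> U) f (map_sum W U (\<lambda>w. w) m) (w, 0)) = (\<lambda>w\<in>W. f (w, 0))" for f :: "'v \<times> 'a \<Rightarrow> 'v"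
    using vcatD(1) [OF U] Mor_zero [OF m vcatD(1) [OF U]]
    by (auto simp: compose_def map_sum_def fun_eq_iff restrict_def subspace_0)
  then show ?thesis
    unfolding kan_mor_def kan_unit_def
    by (intro arg_cong [where f = Kan] restrict_ext) (simp add: Mor_compose [OF incl_Mor [OF W U m] _ Rep_Times(2) [OF W U]])
qed

lemma kan_unit_mor:
  assumes W': "W' \<in> Rep \<U> H" and f: "f \<in> Mor W W'" and x: "x \<in> topspace (tp (obj E H W))"
  shows "kan_unit H W' U (mor E H W W' f x) =
    kan_mor \<U> H (W \<times> U) (W' \<times> U) (map_sum W U f (\<lambda>u. u)) (kan_unit H W U x)"
proof -
  have 0: "0 \<in> U" using vcatD(1) [OF U] by (rule subspace_0)
  have "mor E H W' Z (\<lambda>w\<in>W'. g (w, 0)) (mor E H W W' f x) =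
      mor E H W Z (\<lambda>w\<in>W. compose (W \<times> U) g (map_sum W U f (\<lambda>u. u)) (w, 0)) x"
    if Z: "Z \<in> Rep \<U> H" and g: "g \<in> Mor (W' \<times> U) Z" for Z g
  proof -
    have "(\<lambda>w\<in>W'. g (w, 0)) = compose W' g (\<lambda>w\<in>W'. (w, 0))"
      by (simp add: compose_def fun_eq_iff restrict_def)
    also have "\<dots> \<in> Mor W' Z"
    proof (rule Mor_compose [OF _ g RepD(1) [OF W']])
      show "(\<lambda>w\<in>W'. (w, 0)) \<in> Mor W' (W' \<times> U)"
        using RepD(1) [OF W'] 0 by (intro MorI) (auto simp: subspace_add subspace_scale norm_Pair)
    qed
    finally have g': "(\<lambda>w\<in>W'. g (w, 0)) \<in> Mor W' Z" .
    have "(\<lambda>w\<in>W. compose (W \<times> U) g (map_sum W U f (\<lambda>u. u)) (w, 0)) = compose W (\<lambda>w\<in>W'. g (w, 0)) f"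
      using 0 Mor_mem [OF f] by (auto simp: compose_def map_sum_def fun_eq_iff restrict_def)
    then show ?thesis using mor_comp [OF H W W' Z f g' x] by simp
  qed
  then show ?thesis
    unfolding kan_mor_def kan_unit_def
    by (intro arg_cong [where f = Kan] restrict_ext)
      (simp add: Mor_compose [OF ext_Mor [OF W U f] _ Rep_Times(2) [OF W U]])
qed

end

text \<open>Conjugation preserves the inclusion \<open>V \<rightarrow> V \<oplus> U\<close>, because the representation fixes \<open>0\<close>.\<close>

lemma kan_unit_cmp:
  assumes o: "orbit_map G a K H" and V: "V \<in> Rep \<U> K" and aV: "ract \<U> a ` V \<in> Rep \<U> H" and U: "U \<in> vcat \<beta>"
    and x: "x \<in> topspace (tp (obj E K V))"
  shows "kan_unit H (ract \<U> a ` V) (ract \<beta> a ` U) (cmp E a K H V x) =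
    kan_cmp G \<U> \<beta> E a K H (V \<times> U) (kan_unit K V U x)"
proof -
  note D = orbit_mapD [OF o]
  have ia: "inv a \<in> carrier G" using D(1) by simp
  let ?X = "ract \<U> a ` V \<times> ract \<beta> a ` U"
  have 0: "0 \<in> U" using vcatD(1) [OF U] by (rule subspace_0)
  have a0: "ract \<beta> a 0 = 0"
    using Mor_zero [OF rep_Mor [OF \<beta>_rep D(1)] rep_subspace [OF \<beta>_rep]] subspace_0 [OF rep_subspace [OF \<beta>_rep]] by simp
  have "mor E H (ract \<U> a ` V) Z (\<lambda>w\<in>ract \<U> a ` V. g (w, 0)) (cmp E a K H V x) =
      cmp E a K H (ract \<U> (inv a) ` Z) (kan_fam (kan_unit K V U x) (ract \<U> (inv a) ` Z)
        (conj_map G (\<U> \<oplus>\<^sub>r \<beta>) \<U> (inv a) ?X g))"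
    if Z: "Z \<in> Rep \<U> H" and g: "g \<in> Mor ?X Z" for Z g
  proof -
    let ?Z = "ract \<U> (inv a) ` Z" and ?g = "conj_map G (\<U> \<oplus>\<^sub>r \<beta>) \<U> (inv a) ?X g"
    have aZ: "?Z \<in> Rep \<U> K" by (rule Rep_pull [OF universe_rep o Z])
    have aaZ: "ract \<U> a ` ?Z = Z" by (rule rep_image_inv_right [OF universe_rep D(1) RepD(3) [OF Z]])
    have g': "?g \<in> Mor (V \<times> U) ?Z"
      using pull_conj_Mor [OF \<beta>_rep o Rep_Times(1,3) [OF V U] Z] g by simp
    have r: "(\<lambda>w\<in>V. ?g (w, 0)) \<in> Mor V ?Z" by (rule zero_restrict_Mor [OF D(2) V U g'])
    have "conj_map G \<U> \<U> a V (\<lambda>w\<in>V. ?g (w, 0)) = (\<lambda>w\<in>ract \<U> a ` V. g (w, 0))"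
    proof (rule extensionalityI [of _ "ract \<U> a ` V"])
      fix y assume "y \<in> ract \<U> a ` V"
      then obtain v where v: "v \<in> V" and y: "y = ract \<U> a v" by auto
      have vU: "v \<in> rspace \<U>" using v RepD(3) [OF V] by blast
      have X: "?X \<subseteq> rspace (\<U> \<oplus>\<^sub>r \<beta>)" 
        using rep_image_subset [OF universe_rep D(1) RepD(3) [OF V]] rep_image_subset [OF \<beta>_rep D(1) vcatD(2) [OF U]] by auto
      have vX: "(ract \<U> a v, 0) \<in> ?X" using v 0 a0 by force
      have "(v, 0) = ract (\<U> \<oplus>\<^sub>r \<beta>) (inv a) (ract \<U> a v, 0)"
      proof -
        have "ract \<beta> (inv a) 0 = 0"
          using rep_inv_left [OF \<beta>_rep D(1), of 0] a0 vcatD(2) [OF U] 0 by auto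
        then show ?thesis using rep_inv_left [OF universe_rep D(1) vU] by simp
      qed
      then have "?g (v, 0) = ract \<U> (inv a) (g (ract \<U> a v, 0))"
        using conj_map_apply [OF orthogonal_rep_sum [OF universe_rep \<beta>_rep] ia X vX, of \<U> g] by simp
      moreover have "g (ract \<U> a v, 0) \<in> rspace \<U>" using Mor_mem [OF g vX] RepD(3) [OF Z] by blast
      ultimately show "conj_map G \<U> \<U> a V (\<lambda>w\<in>V. ?g (w, 0)) y = (\<lambda>w\<in>ract \<U> a ` V. g (w, 0)) y"
        using v
        by (simp add: y conj_map_apply [OF universe_rep D(1) RepD(3) [OF V] v] rep_inv_right [OF universe_rep D(1)])
    qed (simp_all add: conj_map_def)
    moreover have "cmp E a K H ?Z (mor E K V ?Z (\<lambda>w\<in>V. ?g (w, 0)) x) =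
        mor E H (ract \<U> a ` V) Z (conj_map G \<U> \<U> a V (\<lambda>w\<in>V. ?g (w, 0))) (cmp E a K H V x)"
      using cmp_mor [OF o V aZ aV _ r x] aaZ Z by simp
    ultimately show ?thesis using aZ g' by (simp add: kan_unit_def)
  qed
  then show ?thesis
    unfolding kan_cmp_def kan_unit_def [of H] ract_sum_image by (simp cong: restrict_cong)
qed

theorem two_morphism_tau_unit: "two_morphism G \<U> E (tau G \<U> \<beta> E) (tau_unit \<U> \<beta> E)"
proof (rule two_morphismI [OF _ weiss_functor_tau])
  show "weiss_functor G \<U> E" by unfold_locales
  fix H W assume H: "subgroup H G" and W: "W \<in> Rep \<U> H"
  show "continuous_map (tp (obj E H W)) (tp (obj (tau G \<U> \<beta> E) H W)) (tau_unit \<U> \<beta> E H W)"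
    unfolding tau_tp tau_unit_apply
  proof (rule continuous_map_into_holim)
    show "continuous_map (prod_topology (tp (obj E H W)) (simplex_top n)) (kan_top \<U> E H (W \<times> fst z n))
        (\<lambda>(x, t). kan_unit H W (fst z n) x)" if "z \<in> nerve (vcat \<beta>) n" for n z
      using continuous_map_compose [OF continuous_map_fst kan_unit_continuous [OF H W vcat_last [OF that]]]
      by (simp add: o_def case_prod_unfold)
    show "kan_unit H W (fst z n) x = kan_mor \<U> H (W \<times> fst z (\<theta> m)) (W \<times> fst z n)
        (map_sum W (fst z (\<theta> m)) (\<lambda>w. w) (snd z (\<theta> m, n))) (kan_unit H W (fst (nerve_pull m \<theta> z) m) x)"
      if "monotone_map m n \<theta>" "z \<in> nerve (vcat \<beta>) n" for x m n \<theta> z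
    proof -
      have \<theta>m: "\<theta> m \<le> n" using monotone_mapD(1) [OF that(1)] by simp
      from kan_unit_incl [OF H W nerve_obj [OF that(2) \<theta>m] vcat_last [OF that(2)] nerve_Mor [OF that(2) \<theta>m order_refl]]
      show ?thesis by (simp add: nerve_pull_fst)
    qed
  qed
  show "tau_unit \<U> \<beta> E H W (pt0 (obj E H W)) = pt0 (obj (tau G \<U> \<beta> E) H W)"
    unfolding tau_unit_apply tau_pt0 by (rule tot_build_cong) (rule kan_unit_base [OF H W vcat_last])
  show "tau_unit \<U> \<beta> E H W' (mor E H W W' f x) = mor (tau G \<U> \<beta> E) H W W' f (tau_unit \<U> \<beta> E H W x)"
    if "W' \<in> Rep \<U> H" "f \<in> Mor W W'" "x \<in> topspace (tp (obj E H W))" for W' f x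
    unfolding tau_unit_apply tau_mor
    by (rule tot_build_cong) (simp add: kan_unit_mor [OF H W vcat_last that])
next
  fix a K H V x
  assume o: "orbit_map G a K H" and V: "V \<in> Rep \<U> K" and aV: "ract \<U> a ` V \<in> Rep \<U> H"
    and x: "x \<in> topspace (tp (obj E K V))"
  have ia: "inv a \<in> carrier G" using orbit_mapD(1) [OF o] by simp
  show "tau_unit \<U> \<beta> E H (ract \<U> a ` V) (cmp E a K H V x) = cmp (tau G \<U> \<beta> E) a K H V (tau_unit \<U> \<beta> E K V x)"
    unfolding tau_unit_apply tau_cmp
  proof (rule tot_build_cong)
    fix n t and z :: "'a nchain" assume t: "t \<in> standard_simplex n" and z: "z \<in> nerve (vcat \<beta>) n"
    show "kan_unit H (ract \<U> a ` V) (fst z n) (cmp E a K H V x) =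
        kan_cmp G \<U> \<beta> E a K H (V \<times> ract \<beta> (inv a) ` fst z n)
          (tot_fam (tot_build (vcat \<beta>) (\<lambda>n t z. kan_unit K V (fst z n) x)) n t (nerve_conj G \<beta> (inv a) n z))"
      using kan_unit_cmp [OF o V aV vcat_image [OF \<beta>_rep ia vcat_last [OF z]] x] t
        nerve_conj_mem [OF \<beta>_rep ia z] vcat_push_pull [OF o V aV vcat_last [OF z]]
      by (simp add: nerve_conj_fst)
  qed
qed

end

section \<open>Restriction to a subrepresentation\<close>

lemma tau_res_comp:
  assumes "vcat \<delta> \<subseteq> vcat \<gamma>"
  shows "tau_res \<delta> H W (tau_res \<gamma> H W p) = tau_res \<delta> H W p"
  unfolding tau_res_def by (rule tot_build_cong) (simp add: subsetD [OF nerve_mono [OF assms]])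

text \<open>Restriction only forgets strings, so it commutes with everything that is defined string by string.\<close>

lemma tau_res_tau_two:
  assumes "vcat \<gamma> \<subseteq> vcat \<beta>"
  shows "tau_res \<gamma> H W (tau_two \<U> \<beta> \<eta> H W p) = tau_two \<U> \<gamma> \<eta> H W (tau_res \<gamma> H W p)"
  unfolding tau_res_def tau_two_apply by (rule tot_build_cong) (simp add: subsetD [OF nerve_mono [OF assms]])

lemma tau_res_tau_unit:
  assumes "vcat \<gamma> \<subseteq> vcat \<beta>"
  shows "tau_res \<gamma> H W (tau_unit \<U> \<beta> E H W x) = tau_unit \<U> \<gamma> E H W x"
  unfolding tau_res_def tau_unit_def case_prod_unfold by (rule tot_build_cong) (simp add: subsetD [OF nerve_mono [OF assms]])

lemma subrepD:
  assumes "subrep G \<gamma> \<beta>"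
  shows "orthogonal_rep G \<gamma>" "orthogonal_rep G \<beta>" "rspace \<gamma> \<subseteq> rspace \<beta>"
    "\<And>g x. g \<in> carrier G \<Longrightarrow> x \<in> rspace \<gamma> \<Longrightarrow> ract \<gamma> g x = ract \<beta> g x"
  using assms by (auto simp: subrep_def)

lemma vcat_subrep: "subrep G \<gamma> \<beta> \<Longrightarrow> vcat \<gamma> \<subseteq> vcat \<beta>"
  using subrepD(3) unfolding vcat_def by blast

lemma subrep_image: "subrep G \<gamma> \<beta> \<Longrightarrow> g \<in> carrier G \<Longrightarrow> X \<subseteq> rspace \<gamma> \<Longrightarrow> ract \<gamma> g ` X = ract \<beta> g ` X"
  by (rule image_cong) (auto simp: subrepD(4))

lemma subrep_finite: "finite_rep G \<beta> \<Longrightarrow> subrep G \<gamma> \<beta> \<Longrightarrow> finite_rep G \<gamma>"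
  using subrepD [of G \<gamma> \<beta>] fin_dim_subset [of "rspace \<beta>" "rspace \<gamma>"] rep_subspace [of G \<gamma>]
  by (auto simp: finite_rep_def)

lemma subrep_trans: "subrep G \<delta> \<gamma> \<Longrightarrow> subrep G \<gamma> \<beta> \<Longrightarrow> subrep G \<delta> \<beta>"
  unfolding subrep_def by (auto simp: subset_iff)

lemma subrep_sum:
  assumes "subrep G \<gamma> \<beta>" "orthogonal_rep G \<epsilon>"
  shows "subrep G (\<gamma> \<oplus>\<^sub>r \<epsilon>) (\<beta> \<oplus>\<^sub>r \<epsilon>)"
  using subrepD [OF assms(1)] orthogonal_rep_sum [OF _ assms(2)] unfolding subrep_def by auto

lemma finite_rep_sum: "finite_rep G \<alpha> \<Longrightarrow> finite_rep G \<epsilon> \<Longrightarrow> finite_rep G (\<alpha> \<oplus>\<^sub>r \<epsilon>)"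
  by (simp add: finite_rep_def orthogonal_rep_sum fin_dim_Times)

context group
begin

text \<open>On subspaces of \<open>P \<oplus> \<gamma>\<close> the two actions agree, so constructions for \<open>\<gamma>\<close> and for \<open>\<beta>\<close> give the same result.\<close>

lemma conj_map_subrep:
  assumes s: "subrep G \<gamma> \<beta>" and a: "a \<in> carrier G" and X: "X \<subseteq> rspace (P \<oplus>\<^sub>r \<gamma>)"
  shows "conj_map G (P \<oplus>\<^sub>r \<gamma>) \<U> a X f = conj_map G (P \<oplus>\<^sub>r \<beta>) \<U> a X f"
proof -
  have eq: "ract (P \<oplus>\<^sub>r \<gamma>) g x = ract (P \<oplus>\<^sub>r \<beta>) g x" if "g \<in> carrier G" "snd x \<in> rspace \<gamma>" for g x
    using that subrepD(4) [OF s] by (cases x) simp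
  have im: "ract (P \<oplus>\<^sub>r \<gamma>) a ` X = ract (P \<oplus>\<^sub>r \<beta>) a ` X"
    by (rule image_cong) (use X eq [OF a] in auto)
  have "snd x \<in> rspace \<gamma>" if "x \<in> ract (P \<oplus>\<^sub>r \<gamma>) a ` X" for x
    using that X rep_mem [OF subrepD(1) [OF s] a] by (auto simp: subset_iff)
  then show ?thesis
    unfolding conj_map_def im [symmetric] using eq [of "inv a"] a by (intro restrict_ext) simp
qed

lemma kan_cmp_subrep:
  assumes s: "subrep G \<gamma> \<beta>" and U: "orthogonal_rep G \<U>" and a: "a \<in> carrier G" and X: "X \<subseteq> rspace (\<U> \<oplus>\<^sub>r \<gamma>)"
  shows "kan_cmp G \<U> \<gamma> E a K H X p = kan_cmp G \<U> \<beta> E a K H X p"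
proof -
  have im: "ract (\<U> \<oplus>\<^sub>r \<gamma>) a ` X = ract (\<U> \<oplus>\<^sub>r \<beta>) a ` X"
    by (rule image_cong) (use X subrepD(4) [OF s a] in auto)
  have "ract (\<U> \<oplus>\<^sub>r \<gamma>) a ` X \<subseteq> rspace (\<U> \<oplus>\<^sub>r \<gamma>)"
    by (rule rep_image_subset [OF orthogonal_rep_sum [OF U subrepD(1) [OF s]] a X])
  then show ?thesis
    unfolding kan_cmp_def im using conj_map_subrep [OF s, of "inv a" "ract (\<U> \<oplus>\<^sub>r \<beta>) a ` X" \<U> \<U>] a im
    by (intro arg_cong [where f = Kan] restrict_ext) simp
qed

lemma nerve_conj_subrep:
  assumes s: "subrep G \<gamma> \<beta>" and a: "a \<in> carrier G" and z: "z \<in> nerve (vcat \<gamma>) n"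
  shows "nerve_conj G \<gamma> a n z = nerve_conj G \<beta> a n z"
proof -
  have c: "fst z i \<subseteq> rspace \<gamma>" if "i \<le> n" for i
    using vcatD(2) [OF nerve_obj [OF z that]] .
  have im: "ract \<gamma> a ` fst z i = ract \<beta> a ` fst z i" if "i \<le> n" for i
    by (rule subrep_image [OF s a c [OF that]])
  have conj: "conj_map G \<gamma> \<gamma> a (fst z i) (snd z (i, j)) = conj_map G \<beta> \<beta> a (fst z i) (snd z (i, j))"
    if "i \<le> j" "j \<le> n" for i j
  proof (rule extensionalityI [of _ "ract \<beta> a ` fst z i"])
    fix y assume "y \<in> ract \<beta> a ` fst z i"
    then obtain x where x: "x \<in> fst z i" and y: "y = ract \<beta> a x" by auto
    have xg: "x \<in> rspace \<gamma>" using x c [of i] that by auto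
    have y': "y = ract \<gamma> a x" using subrepD(4) [OF s a xg] y by simp
    have fx: "snd z (i, j) x \<in> rspace \<gamma>" using Mor_mem [OF nerve_Mor [OF z that] x] c [OF that(2)] by blast
    have c': "fst z i \<subseteq> rspace \<gamma>" "fst z i \<subseteq> rspace \<beta>" using c [of i] subrepD(3) [OF s] that by auto
    show "conj_map G \<gamma> \<gamma> a (fst z i) (snd z (i, j)) y = conj_map G \<beta> \<beta> a (fst z i) (snd z (i, j)) y"
      using conj_map_apply [OF subrepD(1) [OF s] a c'(1) x, of \<gamma> "snd z (i, j)"]
        conj_map_apply [OF subrepD(2) [OF s] a c'(2) x, of \<beta> "snd z (i, j)"] subrepD(4) [OF s a fx] y y' by simp
  qed (use im [of i] that in \<open>auto simp: conj_map_def\<close>)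
  have "(\<lambda>i\<in>{..n}. ract \<gamma> a ` fst z i) = (\<lambda>i\<in>{..n}. ract \<beta> a ` fst z i)"
    by (rule restrict_ext) (simp add: im)
  moreover have "(\<lambda>(i, j)\<in>{(i, j). i \<le> j \<and> j \<le> n}. conj_map G \<gamma> \<gamma> a (fst z i) (snd z (i, j))) =
      (\<lambda>(i, j)\<in>{(i, j). i \<le> j \<and> j \<le> n}. conj_map G \<beta> \<beta> a (fst z i) (snd z (i, j)))"
    by (rule restrict_ext) (clarsimp simp: conj)
  ultimately show ?thesis by (simp add: nerve_conj_def case_prod_unfold)
qed

end

locale tau_subrep = tau_functor G \<U> E \<beta>
  for G :: "('g, 'm) monoid_scheme" (structure) and \<U> :: "('g, 'v::real_inner) rep"
    and E :: "('g, 'v, ('x, 'v, 'a::real_inner) point) weiss" and \<beta> +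
  fixes \<gamma> assumes subrep: "subrep G \<gamma> \<beta>"
begin

sublocale \<gamma>: tau_functor G \<U> E \<gamma>
  by unfold_locales (rule subrep_finite [OF finite_rep subrep])

lemma sub_nerve: "z \<in> nerve (vcat \<gamma>) n \<Longrightarrow> z \<in> nerve (vcat \<beta>) n"
  using nerve_mono [OF vcat_subrep [OF subrep]] by blast

theorem two_morphism_tau_res: "two_morphism G \<U> (tau G \<U> \<beta> E) (tau G \<U> \<gamma> E) (tau_res \<gamma>)"
proof (rule two_morphismI [OF weiss_functor_tau \<gamma>.weiss_functor_tau])
  fix H W assume H: "subgroup H G" and W: "W \<in> Rep \<U> H"
  show "continuous_map (tp (obj (tau G \<U> \<beta> E) H W)) (tp (obj (tau G \<U> \<gamma> E) H W)) (tau_res \<gamma> H W)"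
    unfolding tau_tp \<gamma>.tau_tp tau_res_def
    by (rule holim_map [where r = "\<lambda>n z. z" and \<rho> = "\<lambda>U. U" and \<kappa> = "\<lambda>U x. x"])
      (auto simp: sub_nerve continuous_map_id [unfolded id_def])
  show "tau_res \<gamma> H W (pt0 (obj (tau G \<U> \<beta> E) H W)) = pt0 (obj (tau G \<U> \<gamma> E) H W)"
    unfolding tau_res_def tau_pt0 \<gamma>.tau_pt0 by (rule tot_build_cong) (simp add: sub_nerve)
  show "tau_res \<gamma> H W' (mor (tau G \<U> \<beta> E) H W W' f p) = mor (tau G \<U> \<gamma> E) H W W' f (tau_res \<gamma> H W p)" for W' f p
    unfolding tau_res_def tau_mor \<gamma>.tau_mor by (rule tot_build_cong) (simp add: sub_nerve)
next
  fix a K H V p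
  assume o: "orbit_map G a K H" and V: "V \<in> Rep \<U> K"
  have a: "a \<in> carrier G" "inv a \<in> carrier G" using orbit_mapD(1) [OF o] by auto
  show "tau_res \<gamma> H (ract \<U> a ` V) (cmp (tau G \<U> \<beta> E) a K H V p) = cmp (tau G \<U> \<gamma> E) a K H V (tau_res \<gamma> K V p)"
    unfolding tau_res_def tau_cmp \<gamma>.tau_cmp
  proof (rule tot_build_cong)
    fix n t and z :: "'a nchain" assume t: "t \<in> standard_simplex n" and z: "z \<in> nerve (vcat \<gamma>) n"
    have U: "ract \<gamma> (inv a) ` fst z n \<in> vcat \<gamma>" by (rule vcat_image [OF \<gamma>.\<beta>_rep a(2) \<gamma>.vcat_last [OF z]])
    have im: "ract \<gamma> (inv a) ` fst z n = ract \<beta> (inv a) ` fst z n"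
      by (rule subrep_image [OF subrep a(2) vcatD(2) [OF \<gamma>.vcat_last [OF z]]])
    have "kan_cmp G \<U> \<gamma> E a K H (V \<times> ract \<gamma> (inv a) ` fst z n) q = kan_cmp G \<U> \<beta> E a K H (V \<times> ract \<gamma> (inv a) ` fst z n) q" for q
      by (rule kan_cmp_subrep [OF subrep universe_rep a(1) \<gamma>.Rep_Times(3) [OF V U]])
    then show "tot_fam (tot_build (vcat \<beta>) (\<lambda>n t z. kan_cmp G \<U> \<beta> E a K H (V \<times> ract \<beta> (inv a) ` fst z n)
          (tot_fam p n t (nerve_conj G \<beta> (inv a) n z)))) n t z =
        kan_cmp G \<U> \<gamma> E a K H (V \<times> ract \<gamma> (inv a) ` fst z n) (tot_fam (tot_build (vcat \<gamma>) (tot_fam p)) n t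
          (nerve_conj G \<gamma> (inv a) n z))"
      using t sub_nerve [OF z] nerve_conj_mem [OF \<gamma>.\<beta>_rep a(2) z] nerve_conj_subrep [OF subrep a(2) z] im by simp
  qed
qed

end

section \<open>Mapping telescopes\<close>

text \<open>Products distribute over disjoint unions because the inclusions of the summands are open.\<close>

lemma continuous_map_prod_sum:
  assumes "\<And>i. i \<in> I \<Longrightarrow> continuous_map (prod_topology Z (X i)) Y (\<lambda>(z, x). h z (i, x))"
  shows "continuous_map (prod_topology Z (sum_topology X I)) Y (\<lambda>(z, p). h z p)"
  unfolding continuous_map_def
proof (intro conjI allI impI)
  show "(\<lambda>(z, p). h z p) \<in> topspace (prod_topology Z (sum_topology X I)) \<rightarrow> topspace Y"
  proof clarsimp
    fix z i x assume "z \<in> topspace Z" "i \<in> I" "x \<in> topspace (X i)"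
    then show "h z (i, x) \<in> topspace Y"
      using continuous_map_funspace [OF assms [of i]] by (auto simp: Pi_iff)
  qed
  fix V assume V: "openin Y V"
  let ?S = "{q \<in> topspace (prod_topology Z (sum_topology X I)). (case q of (z, p) \<Rightarrow> h z p) \<in> V}"
  have "\<exists>T. openin (prod_topology Z (sum_topology X I)) T \<and> q \<in> T \<and> T \<subseteq> ?S" if q: "q \<in> ?S" for q
  proof -
    obtain z i x where [simp]: "q = (z, (i, x))" by (metis surj_pair)
    have i: "i \<in> I" and x: "x \<in> topspace (X i)" and z: "z \<in> topspace Z" and hV: "h z (i, x) \<in> V" using q by auto
    define T where "T = {q \<in> topspace (prod_topology Z (X i)). (case q of (z, x) \<Rightarrow> h z (i, x)) \<in> V}"
    have "openin (prod_topology Z (X i)) T"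
      unfolding T_def by (rule openin_continuous_map_preimage [OF assms [OF i] V])
    moreover have "(z, x) \<in> T" using x z hV by (simp add: T_def)
    ultimately have "\<exists>A B. openin Z A \<and> openin (X i) B \<and> z \<in> A \<and> x \<in> B \<and> A \<times> B \<subseteq> T"
      by (simp only: openin_prod_topology_alt)
    then obtain A B where AB: "openin Z A" "openin (X i) B" "z \<in> A" "x \<in> B" "A \<times> B \<subseteq> T"
      by blast
    have "openin (sum_topology X I) ((\<lambda>x. (i, x)) ` B)"
      using open_map_component_injection [OF i, of X] AB(2) by (simp add: open_map_def)
    with AB(1) have "openin (prod_topology Z (sum_topology X I)) (A \<times> (\<lambda>x. (i, x)) ` B)"
      by (simp add: openin_prod_Times_iff)
    moreover have "A \<times> (\<lambda>x. (i, x)) ` B \<subseteq> ?S"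
      using AB(5) i by (auto simp: T_def)
    ultimately show ?thesis using AB(3,4) by auto
  qed
  then show "openin (prod_topology Z (sum_topology X I)) ?S" by (subst openin_subopen) blast
qed

abbreviation cylinders :: "(nat \<Rightarrow> ('g, 'p) gspace) \<Rightarrow> (nat \<times> 'p \<times> real) topology" where
  "cylinders X \<equiv> sum_topology (\<lambda>n. prod_topology (tp (X n)) (top_of_set {0..1})) UNIV"

lemma tel_quot_quotient_map:
  "quotient_map (cylinders X) (tp (telescope X s)) (\<lambda>(n, x, r). tel_quot X s n x r)"
  unfolding telescope_def by (simp add: quotient_map_quotient_topology)

lemma telescope_cases:
  assumes "p \<in> topspace (tp (telescope X s))"
  obtains n x r where "x \<in> topspace (tp (X n))" "0 \<le> r" "r \<le> 1" "p = tel_quot X s n x r"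
proof -
  have "p \<in> (\<lambda>(n, x, r). tel_quot X s n x r) ` topspace (cylinders X)"
    using assms quotient_imp_surjective_map [OF tel_quot_quotient_map] by blast
  then show thesis using that by auto
qed

text \<open>Maps of telescopes can be computed on arbitrary representatives \<open>(n, x, r)\<close>, not only on normal forms.
  For \<open>r = 1\<close> the normal form passes to the next stage, and there commutation with the transition maps
  is needed.\<close>

lemma tel_map_quot:
  assumes "\<And>n. m n (pt0 (X n)) = pt0 (Y n)" "m (Suc n) (s n x) = s' n (m n x)"
    and "s' n (pt0 (Y n)) = pt0 (Y (Suc n))"
  shows "tel_map Y s' m (tel_quot X s n x r) = tel_quot Y s' n (m n x) r"
  using assms by (auto simp: tel_map_def tel_quot_def tel_base_def)

lemma tel_map_base: "m 0 (pt0 (X 0)) = pt0 (Y 0) \<Longrightarrow> tel_map Y s' m (tel_base X) = tel_base Y"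
  by (simp add: tel_map_def tel_quot_def tel_base_def)

lemma tel_base_mem:
  assumes "pt0 (X 0) \<in> topspace (tp (X 0))"
  shows "tel_base X \<in> topspace (tp (telescope X s))"
proof -
  have "tel_quot X s 0 (pt0 (X 0)) 0 \<in> topspace (tp (telescope X s))"
    using quotient_imp_surjective_map [OF tel_quot_quotient_map [of X s]] assms by force
  then show ?thesis by (simp add: tel_quot_def)
qed

lemma continuous_map_tel_quot:
  assumes "continuous_map P (tp (X n)) u" "continuous_map P euclideanreal r" 
    and "\<And>p. p \<in> topspace P \<Longrightarrow> r p \<in> {0..1}"
  shows "continuous_map P (tp (telescope X s)) (\<lambda>p. tel_quot X s n (u p) (r p))"
proof -
  have "continuous_map P (top_of_set {0..1}) r"
    using assms(2,3) by (auto simp: continuous_map_in_subtopology)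
  then have "continuous_map P (prod_topology (tp (X n)) (top_of_set {0..1})) (\<lambda>p. (u p, r p))"
    by (intro continuous_map_pairedI assms(1))
  moreover have "continuous_map (prod_topology (tp (X n)) (top_of_set {0..1})) (cylinders X) (\<lambda>y. (n, y))"
    using continuous_map_component_injection [of n UNIV "\<lambda>n. prod_topology (tp (X n)) (top_of_set {0..1})"] by simp
  ultimately have "continuous_map P (cylinders X) (\<lambda>p. (n, u p, r p))"
    using continuous_map_compose by (force simp: o_def)
  from continuous_map_compose [OF this quotient_imp_continuous_map [OF tel_quot_quotient_map]]
  show ?thesis by (simp add: o_def)
qed

text \<open>The product of \<open>Z\<close> with the quotient map onto the telescope is a quotient map since \<open>Z\<close> is locally
  compact Hausdorff (Whitehead), so continuity can be checked on the cylinders.\<close>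

lemma tel_map_continuous_joint:
  assumes Z: "locally_compact_space Z" "Hausdorff_space Z"
    and m: "\<And>n. continuous_map (prod_topology Z (tp (X n))) (tp (Y n)) (\<lambda>(z, x). m z n x)"
    and pt: "\<And>z n. z \<in> topspace Z \<Longrightarrow> m z n (pt0 (X n)) = pt0 (Y n)"
    and comm: "\<And>z n x. z \<in> topspace Z \<Longrightarrow> x \<in> topspace (tp (X n)) \<Longrightarrow> m z (Suc n) (s n x) = s' n (m z n x)"
    and s': "\<And>n. s' n (pt0 (Y n)) = pt0 (Y (Suc n))"
  shows "continuous_map (prod_topology Z (tp (telescope X s))) (tp (telescope Y s')) (\<lambda>(z, p). tel_map Y s' (m z) p)"
proof (rule continuous_compose_quotient_map)
  show "quotient_map (prod_topology Z (cylinders X)) (prod_topology Z (tp (telescope X s)))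
      (\<lambda>(z, y). (z, (\<lambda>(n, x, r). tel_quot X s n x r) y))"
    using quotient_map_prod_right [OF Z(1) disjI1 [OF Z(2)] tel_quot_quotient_map] .
  have "continuous_map (prod_topology Z (cylinders X)) (tp (telescope Y s'))
      (\<lambda>(z, y). tel_quot Y s' (fst y) (m z (fst y) (fst (snd y))) (snd (snd y)))"
  proof (rule continuous_map_prod_sum)
    fix n :: nat
    let ?P = "prod_topology Z (prod_topology (tp (X n)) (top_of_set {0..1::real}))"
    have "continuous_map ?P (tp (X n)) (\<lambda>q. fst (snd q))" "continuous_map ?P (top_of_set {0..1}) (\<lambda>q. snd (snd q))"
      using continuous_map_compose [OF continuous_map_snd continuous_map_fst]
        continuous_map_compose [OF continuous_map_snd continuous_map_snd] by (auto simp: o_def)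
    then have "continuous_map ?P (tp (Y n)) (\<lambda>q. m (fst q) n (fst (snd q)))"
      "continuous_map ?P euclideanreal (\<lambda>q. snd (snd q))"
      using continuous_map_apply2 [OF m continuous_map_fst] continuous_map_into_fulltopology by blast+
    from continuous_map_tel_quot [where X = Y and n = n and s = s', OF this] 
    show "continuous_map ?P (tp (telescope Y s')) (\<lambda>(z, x). tel_quot Y s' (fst (n, x)) (m z (fst (n, x)) (fst (snd (n, x)))) (snd (snd (n, x))))"
      by (auto simp: case_prod_unfold)
  qed
  then show "continuous_map (prod_topology Z (cylinders X)) (tp (telescope Y s'))
      ((\<lambda>(z, p). tel_map Y s' (m z) p) \<circ> (\<lambda>(z, y). (z, (\<lambda>(n, x, r). tel_quot X s n x r) y)))"
    by (rule continuous_map_eq) (auto simp: tel_map_quot pt comm s')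
qed

lemma tel_map_continuous:
  assumes m: "\<And>n. continuous_map (tp (X n)) (tp (Y n)) (m n)"
    and pt: "\<And>n. m n (pt0 (X n)) = pt0 (Y n)"
    and comm: "\<And>n x. x \<in> topspace (tp (X n)) \<Longrightarrow> m (Suc n) (s n x) = s' n (m n x)"
    and s': "\<And>n. s' n (pt0 (Y n)) = pt0 (Y (Suc n))"
  shows "continuous_map (tp (telescope X s)) (tp (telescope Y s')) (tel_map Y s' m)"
proof -
  let ?D = "discrete_topology {()}"
  have "continuous_map (prod_topology ?D (tp (X n))) (tp (Y n)) (\<lambda>(z, x). m n x)" for n
    using continuous_map_compose [OF continuous_map_snd m] by (simp add: o_def case_prod_unfold)
  then have "continuous_map (prod_topology ?D (tp (telescope X s))) (tp (telescope Y s')) (\<lambda>(z, p). tel_map Y s' m p)"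
    using pt comm s' by (intro tel_map_continuous_joint [where m = "\<lambda>_. m"])
      (auto simp: locally_compact_space_discrete_topology)
  moreover have "continuous_map (tp (telescope X s)) (prod_topology ?D (tp (telescope X s))) (\<lambda>p. ((), p))"
    by (intro continuous_map_pairedI) auto
  ultimately show ?thesis by (force dest: continuous_map_compose simp: o_def)
qed

section \<open>Sequential homotopy colimits of Weiss functors\<close>

locale weiss_sequence = group G for G :: "('g, 'm) monoid_scheme" (structure) +
  fixes \<U> :: "('g, 'v::real_inner) rep" and E :: "nat \<Rightarrow> ('g, 'v, ('x, 'v, 'a) point) weiss"
    and \<sigma> :: "nat \<Rightarrow> ('g, 'v, ('x, 'v, 'a) point) two_cell"
  assumes universe: "complete_universe G \<U>"
    and step: "\<And>n. two_morphism G \<U> (E n) (E (Suc n)) (\<sigma> n)"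
begin

sublocale E: weiss_functor G \<U> "E n" for n
  using step [of n] by unfold_locales (auto simp: universe two_morphism_def)

abbreviation "hocolim \<equiv> weiss_hocolim \<U> E \<sigma>"

lemma step_cell: "weiss_two_cell G \<U> (E n) (E (Suc n)) (\<sigma> n)"
  by unfold_locales (rule step)

lemmas step_pt0 = weiss_two_cell.two_pt0 [OF step_cell]
  and step_mor = weiss_two_cell.two_mor [OF step_cell]
  and step_cmp = weiss_two_cell.two_cmp [OF step_cell]
  and step_mem = weiss_two_cell.two_mem [OF step_cell]

lemma hocolim_obj: "obj hocolim H W = telescope (\<lambda>n. obj (E n) H W) (\<lambda>n. \<sigma> n H W)"
  and hocolim_mor: "mor hocolim H W W' f =
    tel_map (\<lambda>n. obj (E n) H W') (\<lambda>n. \<sigma> n H W') (\<lambda>n. mor (E n) H W W' f)"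
  and hocolim_cmp: "cmp hocolim a K H V =
    tel_map (\<lambda>n. obj (E n) H (ract \<U> a ` V)) (\<lambda>n. \<sigma> n H (ract \<U> a ` V)) (\<lambda>n. cmp (E n) a K H V)"
  by (simp_all add: weiss_hocolim_def)

lemma hocolim_pt0: "pt0 (obj hocolim H W) = tel_base (\<lambda>n. obj (E n) H W)"
  and hocolim_act: "act (obj hocolim H W) h =
    tel_map (\<lambda>n. obj (E n) H W) (\<lambda>n. \<sigma> n H W) (\<lambda>n. act (obj (E n) H W) h)"
  by (simp_all add: hocolim_obj telescope_def)

lemma hocolim_mor_quot:
  assumes "subgroup H G" "W \<in> Rep \<U> H" "W' \<in> Rep \<U> H" "f \<in> Mor W W'" "x \<in> topspace (tp (obj (E n) H W))"
  shows "mor hocolim H W W' f (tel_quot (\<lambda>n. obj (E n) H W) (\<lambda>n. \<sigma> n H W) n x r) =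
    tel_quot (\<lambda>n. obj (E n) H W') (\<lambda>n. \<sigma> n H W') n (mor (E n) H W W' f x) r"
  unfolding hocolim_mor
  by (rule tel_map_quot) (use assms in \<open>simp_all add: E.mor_pt0 step_mor step_pt0\<close>)

lemma hocolim_cmp_quot:
  assumes "orbit_map G a K H" "V \<in> Rep \<U> K" "ract \<U> a ` V \<in> Rep \<U> H" "x \<in> topspace (tp (obj (E n) K V))"
  shows "cmp hocolim a K H V (tel_quot (\<lambda>n. obj (E n) K V) (\<lambda>n. \<sigma> n K V) n x r) =
    tel_quot (\<lambda>n. obj (E n) H (ract \<U> a ` V)) (\<lambda>n. \<sigma> n H (ract \<U> a ` V)) n (cmp (E n) a K H V x) r"
  unfolding hocolim_cmp
  by (rule tel_map_quot) (use assms orbit_mapD(3) [OF assms(1)] in \<open>simp_all add: E.cmp_pt0 step_cmp step_pt0\<close>)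

text \<open>The stagewise inverses of the comparison maps commute with the transition maps and therefore induce
  an inverse.\<close>

lemma hocolim_cmp_homeo:
  assumes o: "orbit_map G a K H" and V: "V \<in> Rep \<U> K" and aV: "ract \<U> a ` V \<in> Rep \<U> H"
  shows "homeomorphic_map (tp (obj hocolim K V)) (tp (obj hocolim H (ract \<U> a ` V))) (cmp hocolim a K H V)"
proof -
  note D = orbit_mapD [OF o]
  let ?aV = "ract \<U> a ` V"
  have "\<forall>n. \<exists>g. homeomorphic_maps (tp (obj (E n) K V)) (tp (obj (E n) H ?aV)) (cmp (E n) a K H V) g"
    using E.cmp_homeo [OF o V aV] homeomorphic_map_maps by blast
  then obtain g where g: "\<And>n. homeomorphic_maps (tp (obj (E n) K V)) (tp (obj (E n) H ?aV)) (cmp (E n) a K H V) (g n)"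
    by metis
  have gl: "g n (cmp (E n) a K H V x) = x" if "x \<in> topspace (tp (obj (E n) K V))" for n x
    using g [of n] that by (simp add: homeomorphic_maps_def)
  have gr: "cmp (E n) a K H V (g n y) = y" if "y \<in> topspace (tp (obj (E n) H ?aV))" for n y
    using g [of n] that by (simp add: homeomorphic_maps_def)
  have gc: "continuous_map (tp (obj (E n) H ?aV)) (tp (obj (E n) K V)) (g n)" for n
    using g [of n] by (simp add: homeomorphic_maps_def)
  have gm: "g n y \<in> topspace (tp (obj (E n) K V))" if "y \<in> topspace (tp (obj (E n) H ?aV))" for n y
    using continuous_map_funspace [OF gc] that by blast
  have gpt: "g n (pt0 (obj (E n) H ?aV)) = pt0 (obj (E n) K V)" for n
    using gl [OF E.pt0_mem [OF D(2) V]] E.cmp_pt0 [OF o V aV] by simp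
  have gcomm: "g (Suc n) (\<sigma> n H ?aV y) = \<sigma> n K V (g n y)" if y: "y \<in> topspace (tp (obj (E n) H ?aV))" for n y
  proof -
    have "\<sigma> n H ?aV y = cmp (E (Suc n)) a K H V (\<sigma> n K V (g n y))"
      using step_cmp [OF o V aV gm [OF y]] gr [OF y] by simp
    then show ?thesis using gl [OF step_mem [OF D(2) V gm [OF y]]] by simp
  qed
  define \<Psi> where "\<Psi> = tel_map (\<lambda>n. obj (E n) K V) (\<lambda>n. \<sigma> n K V) g"
  have \<Psi>_quot: "\<Psi> (tel_quot (\<lambda>n. obj (E n) H ?aV) (\<lambda>n. \<sigma> n H ?aV) n y r) =
      tel_quot (\<lambda>n. obj (E n) K V) (\<lambda>n. \<sigma> n K V) n (g n y) r" if "y \<in> topspace (tp (obj (E n) H ?aV))" for n y r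
    unfolding \<Psi>_def by (rule tel_map_quot) (simp_all add: gpt gcomm that step_pt0 [OF D(2) V])
  have "homeomorphic_maps (tp (obj hocolim K V)) (tp (obj hocolim H ?aV)) (cmp hocolim a K H V) \<Psi>"
    unfolding homeomorphic_maps_def
  proof (intro conjI ballI)
    show "continuous_map (tp (obj hocolim K V)) (tp (obj hocolim H ?aV)) (cmp hocolim a K H V)"
      unfolding hocolim_obj hocolim_cmp
      by (rule tel_map_continuous)
        (simp_all add: homeomorphic_imp_continuous_map [OF E.cmp_homeo [OF o V aV]] E.cmp_pt0 [OF o V aV]
          step_cmp [OF o V aV] step_pt0 [OF D(3) aV])
    show "continuous_map (tp (obj hocolim H ?aV)) (tp (obj hocolim K V)) \<Psi>"
      unfolding hocolim_obj \<Psi>_def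
      by (rule tel_map_continuous) (simp_all add: gc gpt gcomm step_pt0 [OF D(2) V])
    show "\<Psi> (cmp hocolim a K H V p) = p" if "p \<in> topspace (tp (obj hocolim K V))" for p
      using that unfolding hocolim_obj
      by (elim telescope_cases) (simp add: hocolim_cmp_quot [OF o V aV] \<Psi>_quot E.cmp_mem [OF o V aV] gl)
    show "cmp hocolim a K H V (\<Psi> q) = q" if "q \<in> topspace (tp (obj hocolim H ?aV))" for q
      using that unfolding hocolim_obj
      by (elim telescope_cases) (simp add: hocolim_cmp_quot [OF o V aV] \<Psi>_quot gm gr)
  qed
  then show ?thesis by (rule homeomorphic_maps_imp_map)
qed

theorem one_morphism_hocolim: "one_morphism G \<U> hocolim"
proof (rule one_morphismI [OF complete_universe_rep [OF universe]])
  fix H W assume H: "subgroup H G" and W: "W \<in> Rep \<U> H"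
  show "pt0 (obj hocolim H W) \<in> topspace (tp (obj hocolim H W))"
    unfolding hocolim_pt0 unfolding hocolim_obj by (rule tel_base_mem) (rule E.pt0_mem [OF H W])
  show "mor hocolim H W W (\<lambda>w\<in>W. w) p = p" if "p \<in> topspace (tp (obj hocolim H W))" for p
    using that unfolding hocolim_obj
    by (elim telescope_cases)
      (simp add: hocolim_mor_quot [OF H W W Mor_id [OF order_refl RepD(1) [OF W]]] E.mor_id [OF H W])
  fix W' assume W': "W' \<in> Rep \<U> H"
  show "continuous_map (prod_topology (Mor_top W W') (tp (obj hocolim H W))) (tp (obj hocolim H W'))
      (\<lambda>(f, p). mor hocolim H W W' f p)"
    unfolding hocolim_obj hocolim_mor
  proof (rule tel_map_continuous_joint)
    show "locally_compact_space (Mor_top W W')"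
      by (rule compact_imp_locally_compact_space [OF compact_Mor_top [OF RepD(1) [OF W] RepD(2) [OF W']]])
  qed (simp_all add: Hausdorff_Mor_top E.mor_cont [OF H W W'] E.mor_pt0 [OF H W W'] step_mor [OF H W W'] step_pt0 [OF H W'])
  show "mor hocolim H W W' f (pt0 (obj hocolim H W)) = pt0 (obj hocolim H W')" if "f \<in> Mor W W'" for f
    unfolding hocolim_pt0 hocolim_mor by (rule tel_map_base) (rule E.mor_pt0 [OF H W W' that])
  fix W'' f g p assume W'': "W'' \<in> Rep \<U> H" and f: "f \<in> Mor W W'" and g: "g \<in> Mor W' W''"
    and p: "p \<in> topspace (tp (obj hocolim H W))"
  show "mor hocolim H W W'' (compose W g f) p = mor hocolim H W' W'' g (mor hocolim H W W' f p)"
    using p unfolding hocolim_obj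
    by (elim telescope_cases)
      (simp add: hocolim_mor_quot [OF H W W' f] hocolim_mor_quot [OF H W' W'' g]
        hocolim_mor_quot [OF H W W'' Mor_compose [OF f g RepD(1) [OF W]]]
        E.mor_mem [OF H W W' f] E.mor_comp [OF H W W' W'' f g])
next
  fix a K H V assume o: "orbit_map G a K H" and V: "V \<in> Rep \<U> K" and aV: "ract \<U> a ` V \<in> Rep \<U> H"
  note D = orbit_mapD [OF o]
  show "homeomorphic_map (tp (obj hocolim K V)) (tp (obj hocolim H (ract \<U> a ` V))) (cmp hocolim a K H V)"
    by (rule hocolim_cmp_homeo [OF o V aV])
  show "cmp hocolim a K H V (pt0 (obj hocolim K V)) = pt0 (obj hocolim H (ract \<U> a ` V))"
    unfolding hocolim_pt0 hocolim_cmp by (rule tel_map_base) (rule E.cmp_pt0 [OF o V aV])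
  fix V' f p assume V': "V' \<in> Rep \<U> K" "ract \<U> a ` V' \<in> Rep \<U> H" and f: "f \<in> Mor V V'"
    and p: "p \<in> topspace (tp (obj hocolim K V))"
  have f': "conj_map G \<U> \<U> a V f \<in> Mor (ract \<U> a ` V) (ract \<U> a ` V')"
    by (rule conj_map_Mor [OF complete_universe_rep [OF universe] complete_universe_rep [OF universe] D(1)
          RepD(1,3) [OF V] RepD(1,3) [OF V'(1)] f])
  show "cmp hocolim a K H V' (mor hocolim K V V' f p) = mor hocolim H (ract \<U> a ` V) (ract \<U> a ` V')
      (conj_map G \<U> \<U> a V f) (cmp hocolim a K H V p)"
    using p unfolding hocolim_obj
    by (elim telescope_cases)
      (simp add: hocolim_mor_quot [OF D(2) V V'(1) f] hocolim_cmp_quot [OF o V'] hocolim_cmp_quot [OF o V aV]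
        hocolim_mor_quot [OF D(3) aV V'(2) f'] E.mor_mem [OF D(2) V V'(1) f] E.cmp_mem [OF o V aV]
        E.cmp_mor [OF o V V'(1) aV V'(2) f])
next
  fix a b L K H V p
  assume o: "orbit_map G b L K" "orbit_map G a K H" and V: "V \<in> Rep \<U> L" and bV: "ract \<U> b ` V \<in> Rep \<U> K"
    and abV: "ract \<U> (a \<otimes> b) ` V \<in> Rep \<U> H" and p: "p \<in> topspace (tp (obj hocolim L V))"
  have ab: "a \<in> carrier G" "b \<in> carrier G" using o by (auto simp: orbit_map_def)
  have eq: "ract \<U> (a \<otimes> b) ` V = ract \<U> a ` ract \<U> b ` V"
    by (rule rep_image_mult [OF complete_universe_rep [OF universe] ab RepD(3) [OF V]])
  have oab: "orbit_map G (a \<otimes> b) L H"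
  proof -
    have "a \<otimes> b \<otimes> l \<otimes> inv (a \<otimes> b) \<in> H" if "l \<in> L" for l
    proof -
      have l: "l \<in> carrier G" using subgroup.mem_carrier [OF orbit_mapD(2) [OF o(1)] that] .
      have "a \<otimes> b \<otimes> l \<otimes> inv (a \<otimes> b) = a \<otimes> (b \<otimes> l \<otimes> inv b) \<otimes> inv a"
        using ab l by (simp add: inv_mult_group m_assoc)
      then show ?thesis using orbit_mapD(4) [OF o(2) orbit_mapD(4) [OF o(1) that]] by simp
    qed
    then show ?thesis using o ab by (simp add: orbit_map_def)
  qed
  show "cmp hocolim (a \<otimes> b) L H V p = cmp hocolim a K H (ract \<U> b ` V) (cmp hocolim b L K V p)"
    using p unfolding hocolim_obj
    by (elim telescope_cases)
      (simp add: hocolim_cmp_quot [OF oab V abV] hocolim_cmp_quot [OF o(1) V bV] hocolim_cmp_quot [OF o(2) bV abV [unfolded eq]]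
        E.cmp_mem [OF o(1) V bV] E.cmp_cmp [OF o V bV abV] eq)
next
  fix H V h p
  assume H: "subgroup H G" and h: "h \<in> H" and V: "V \<in> Rep \<U> H" and p: "p \<in> topspace (tp (obj hocolim H V))"
  note o = orbit_map_self [OF H h]
  have hV: "ract \<U> h ` V = V" by (rule Rep_image_eq [OF complete_universe_rep [OF universe] H V h])
  have act_pt: "act (obj (E n) H V) h (pt0 (obj (E n) H V)) = pt0 (obj (E n) H V)" for n
    using E.pointed [OF H V] h by (simp add: pointed_gspace_def)
  have act_step: "act (obj (E (Suc n)) H V) h (\<sigma> n H V x) = \<sigma> n H V (act (obj (E n) H V) h x)"
    if x: "x \<in> topspace (tp (obj (E n) H V))" for n x
    using step_cmp [OF o V _ x] hV V E.cmp_act [OF H h V x] E.cmp_act [OF H h V step_mem [OF H V x]] by simp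
  show "cmp hocolim h H H V p = act (obj hocolim H V) h p"
    using p unfolding hocolim_obj
  proof (elim telescope_cases)
    fix n x r assume x: "x \<in> topspace (tp (obj (E n) H V))"
      and p: "p = tel_quot (\<lambda>n. obj (E n) H V) (\<lambda>n. \<sigma> n H V) n x r"
    have "act (obj hocolim H V) h p = tel_quot (\<lambda>n. obj (E n) H V) (\<lambda>n. \<sigma> n H V) n (act (obj (E n) H V) h x) r"
      unfolding hocolim_act p by (rule tel_map_quot) (simp_all add: act_pt act_step x step_pt0 [OF H V])
    then show "cmp hocolim h H H V p = act (telescope (\<lambda>n. obj (E n) H V) (\<lambda>n. \<sigma> n H V)) h p"
      using hocolim_cmp_quot [OF o V _ x] hV V E.cmp_act [OF H h V x] by (simp add: p hocolim_obj)
  qed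
qed

lemma weiss_functor_hocolim: "weiss_functor G \<U> hocolim"
  by unfold_locales (rule universe one_morphism_hocolim)+

theorem two_morphism_hocolim_incl:
  "two_morphism G \<U> (E 0) hocolim (\<lambda>H W x. tel_quot (\<lambda>n. obj (E n) H W) (\<lambda>n. \<sigma> n H W) 0 x 0)"
proof (rule two_morphismI [OF _ weiss_functor_hocolim])
  show "weiss_functor G \<U> (E 0)" by unfold_locales
  fix H W assume H: "subgroup H G" and W: "W \<in> Rep \<U> H"
  show "continuous_map (tp (obj (E 0) H W)) (tp (obj hocolim H W))
      (\<lambda>x. tel_quot (\<lambda>n. obj (E n) H W) (\<lambda>n. \<sigma> n H W) 0 x 0)"
    unfolding hocolim_obj by (rule continuous_map_tel_quot) (auto intro: continuous_map_id [unfolded id_def])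
  show "tel_quot (\<lambda>n. obj (E n) H W) (\<lambda>n. \<sigma> n H W) 0 (pt0 (obj (E 0) H W)) 0 = pt0 (obj hocolim H W)"
    by (simp add: hocolim_pt0 tel_quot_def)
qed (simp_all add: hocolim_mor_quot hocolim_cmp_quot)

end

theorem two_morphism_hocolim_map:
  assumes E: "weiss_sequence G \<U> E \<sigma>" and F: "weiss_sequence G \<U> F \<sigma>'"
    and \<rho>: "\<And>n. two_morphism G \<U> (E n) (F n) (\<rho> n)"
    and comm: "\<And>n H W x. subgroup H G \<Longrightarrow> W \<in> Rep \<U> H \<Longrightarrow> x \<in> topspace (tp (obj (E n) H W)) \<Longrightarrow>
      \<rho> (Suc n) H W (\<sigma> n H W x) = \<sigma>' n H W (\<rho> n H W x)"
  shows "two_morphism G \<U> (weiss_hocolim \<U> E \<sigma>) (weiss_hocolim \<U> F \<sigma>')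
      (\<lambda>H W. tel_map (\<lambda>n. obj (F n) H W) (\<lambda>n. \<sigma>' n H W) (\<lambda>n. \<rho> n H W))" (is ?two)
    and "\<And>n H W x r. subgroup H G \<Longrightarrow> W \<in> Rep \<U> H \<Longrightarrow> x \<in> topspace (tp (obj (E n) H W)) \<Longrightarrow>
      tel_map (\<lambda>n. obj (F n) H W) (\<lambda>n. \<sigma>' n H W) (\<lambda>n. \<rho> n H W) (tel_quot (\<lambda>n. obj (E n) H W) (\<lambda>n. \<sigma> n H W) n x r) =
      tel_quot (\<lambda>n. obj (F n) H W) (\<lambda>n. \<sigma>' n H W) n (\<rho> n H W x) r"
proof -
  interpret E: weiss_sequence G \<U> E \<sigma> by (rule E)
  interpret F: weiss_sequence G \<U> F \<sigma>' by (rule F)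
  have cell: "weiss_two_cell G \<U> (E n) (F n) (\<rho> n)" for n by unfold_locales (rule \<rho>)
  note cont = weiss_two_cell.two_cont [OF cell] and pt = weiss_two_cell.two_pt0 [OF cell]
    and mem = weiss_two_cell.two_mem [OF cell] and mor = weiss_two_cell.two_mor [OF cell]
    and cmp = weiss_two_cell.two_cmp [OF cell]
  show quot: "tel_map (\<lambda>n. obj (F n) H W) (\<lambda>n. \<sigma>' n H W) (\<lambda>n. \<rho> n H W) (tel_quot (\<lambda>n. obj (E n) H W) (\<lambda>n. \<sigma> n H W) n x r) =
      tel_quot (\<lambda>n. obj (F n) H W) (\<lambda>n. \<sigma>' n H W) n (\<rho> n H W x) r"
    if "subgroup H G" "W \<in> Rep \<U> H" "x \<in> topspace (tp (obj (E n) H W))" for n H W x r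
    by (rule tel_map_quot) (use that in \<open>simp_all add: pt comm F.step_pt0\<close>)
  show ?two
  proof (rule two_morphismI [OF E.weiss_functor_hocolim F.weiss_functor_hocolim])
    fix H W assume H: "subgroup H G" and W: "W \<in> Rep \<U> H"
    show "continuous_map (tp (obj (weiss_hocolim \<U> E \<sigma>) H W)) (tp (obj (weiss_hocolim \<U> F \<sigma>') H W))
        (tel_map (\<lambda>n. obj (F n) H W) (\<lambda>n. \<sigma>' n H W) (\<lambda>n. \<rho> n H W))"
      unfolding E.hocolim_obj F.hocolim_obj
      by (rule tel_map_continuous) (simp_all add: cont [OF H W] pt [OF H W] comm [OF H W] F.step_pt0 [OF H W])
    show "tel_map (\<lambda>n. obj (F n) H W) (\<lambda>n. \<sigma>' n H W) (\<lambda>n. \<rho> n H W) (pt0 (obj (weiss_hocolim \<U> E \<sigma>) H W)) =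
        pt0 (obj (weiss_hocolim \<U> F \<sigma>') H W)"
      unfolding E.hocolim_pt0 F.hocolim_pt0 by (rule tel_map_base) (rule pt [OF H W])
    fix W' f p assume W': "W' \<in> Rep \<U> H" and f: "f \<in> Mor W W'"
      and p: "p \<in> topspace (tp (obj (weiss_hocolim \<U> E \<sigma>) H W))"
    show "tel_map (\<lambda>n. obj (F n) H W') (\<lambda>n. \<sigma>' n H W') (\<lambda>n. \<rho> n H W') (mor (weiss_hocolim \<U> E \<sigma>) H W W' f p) =
        mor (weiss_hocolim \<U> F \<sigma>') H W W' f (tel_map (\<lambda>n. obj (F n) H W) (\<lambda>n. \<sigma>' n H W) (\<lambda>n. \<rho> n H W) p)"
      using p unfolding E.hocolim_obj
      by (elim telescope_cases)
        (simp add: E.hocolim_mor_quot [OF H W W' f] F.hocolim_mor_quot [OF H W W' f] quot [OF H W] quot [OF H W']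
          E.E.mor_mem [OF H W W' f] mem [OF H W] mor [OF H W W' f])
  next
    fix a K H V p assume o: "orbit_map G a K H" and V: "V \<in> Rep \<U> K" and aV: "ract \<U> a ` V \<in> Rep \<U> H"
      and p: "p \<in> topspace (tp (obj (weiss_hocolim \<U> E \<sigma>) K V))"
    note D = E.orbit_mapD [OF o]
    show "tel_map (\<lambda>n. obj (F n) H (ract \<U> a ` V)) (\<lambda>n. \<sigma>' n H (ract \<U> a ` V)) (\<lambda>n. \<rho> n H (ract \<U> a ` V))
          (cmp (weiss_hocolim \<U> E \<sigma>) a K H V p) =
        cmp (weiss_hocolim \<U> F \<sigma>') a K H V (tel_map (\<lambda>n. obj (F n) K V) (\<lambda>n. \<sigma>' n K V) (\<lambda>n. \<rho> n K V) p)"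
      using p unfolding E.hocolim_obj
      by (elim telescope_cases)
        (simp add: E.hocolim_cmp_quot [OF o V aV] F.hocolim_cmp_quot [OF o V aV] quot [OF D(2) V] quot [OF D(3) aV]
          E.E.cmp_mem [OF o V aV] mem [OF D(2) V] cmp [OF o V aV])
  qed
qed

section \<open>Taylor approximations\<close>

lemma two_morphism_id:
  assumes "weiss_functor G \<U> E"
  shows "two_morphism G \<U> E E (\<lambda>H W x. x)"
  by (rule two_morphismI [OF assms assms]) (auto simp: continuous_map_id [unfolded id_def])

lemma two_morphism_comp:
  assumes U: "complete_universe G \<U>" "group G" and \<eta>: "two_morphism G \<U> E F \<eta>" and \<theta>: "two_morphism G \<U> F D \<theta>"
  shows "two_morphism G \<U> E D (\<theta> \<circ>\<^sub>2 \<eta>)"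
proof -
  have om: "one_morphism G \<U> E" "one_morphism G \<U> F" "one_morphism G \<U> D"
    using \<eta> \<theta> by (auto simp: two_morphism_def)
  have w: "weiss_functor G \<U> E" "weiss_functor G \<U> F" "weiss_functor G \<U> D"
    by (auto intro!: weiss_functor.intro weiss_functor_axioms.intro U om)
  interpret \<eta>: weiss_two_cell G \<U> E F \<eta>
    by (intro weiss_two_cell.intro weiss_two_cell_axioms.intro w \<eta>)
  interpret \<theta>: weiss_two_cell G \<U> F D \<theta>
    by (intro weiss_two_cell.intro weiss_two_cell_axioms.intro w \<theta>)
  show ?thesis
  proof (rule two_morphismI [OF w(1,3)])
    show "continuous_map (tp (obj E H W)) (tp (obj D H W)) ((\<theta> \<circ>\<^sub>2 \<eta>) H W)"
      if "subgroup H G" "W \<in> Rep \<U> H" for H W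
      using continuous_map_compose [OF \<eta>.two_cont [OF that] \<theta>.two_cont [OF that]]
      by (simp add: two_cell_comp_def o_def)
  next
    fix a K H V x assume o: "orbit_map G a K H" and "V \<in> Rep \<U> K" "ract \<U> a ` V \<in> Rep \<U> H"
      "x \<in> topspace (tp (obj E K V))"
    then show "(\<theta> \<circ>\<^sub>2 \<eta>) H (ract \<U> a ` V) (cmp E a K H V x) = cmp D a K H V ((\<theta> \<circ>\<^sub>2 \<eta>) K V x)"
      using \<eta>.orbit_mapD(2) [OF o]
      by (simp add: two_cell_comp_def \<eta>.two_cmp \<theta>.two_cmp \<eta>.two_mem)
  qed (simp_all add: two_cell_comp_def \<eta>.two_pt0 \<theta>.two_pt0 \<eta>.two_mor \<theta>.two_mor \<eta>.two_mem)
qed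

context tau_functor
begin

lemma tau_iter_Suc: "tau_iter G \<U> \<beta> E (Suc n) = tau G \<U> \<beta> (tau_iter G \<U> \<beta> E n)"
  by (simp add: tau_iter_def)

lemma tau_step_Suc: "tau_step \<U> \<beta> E (Suc n) = tau_two \<U> \<beta> (tau_step \<U> \<beta> E n)"
  by (simp add: tau_step_def)

lemma tau_functor_iter: "tau_functor G \<U> (tau_iter G \<U> \<beta> E n) \<beta>"
proof (induction n)
  case 0
  show ?case unfolding tau_iter_def by simp unfold_locales
next
  case (Suc n)
  then interpret T: tau_functor G \<U> "tau_iter G \<U> \<beta> E n" \<beta> .
  show ?case
    unfolding tau_iter_Suc by unfold_locales (rule universe T.one_morphism_tau finite_rep)+
qed

lemma two_morphism_step:
  "two_morphism G \<U> (tau_iter G \<U> \<beta> E n) (tau_iter G \<U> \<beta> E (Suc n)) (tau_step \<U> \<beta> E n)"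
proof (induction n)
  case 0
  show ?case using two_morphism_tau_unit by (simp add: tau_iter_def tau_step_def)
next
  case (Suc n)
  interpret S: tau_functor G \<U> "tau_iter G \<U> \<beta> E n" \<beta> by (rule tau_functor_iter)
  interpret T: tau_functor G \<U> "tau_iter G \<U> \<beta> E (Suc n)" \<beta> by (rule tau_functor_iter)
  interpret C: tau_two_cell G \<U> "tau_iter G \<U> \<beta> E n" "tau_iter G \<U> \<beta> E (Suc n)" "tau_step \<U> \<beta> E n" \<beta>
    by unfold_locales (rule Suc)
  show ?case
    unfolding tau_step_Suc tau_iter_Suc [of n] tau_iter_Suc [of "Suc n"]
    using C.two_morphism_tau_two by (simp add: tau_iter_Suc)
qed

lemma weiss_sequence_tau: "weiss_sequence G \<U> (tau_iter G \<U> \<beta> E) (tau_step \<U> \<beta> E)"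
  by unfold_locales (rule universe two_morphism_step)+

end

context tau_subrep
begin

lemma tau_subrep_iter: "tau_subrep G \<U> (tau_iter G \<U> \<beta> E n) \<beta> \<gamma>"
  by (intro tau_subrep.intro tau_subrep_axioms.intro tau_functor_iter subrep)

lemma two_morphism_iter_res:
  "two_morphism G \<U> (tau_iter G \<U> \<beta> E n) (tau_iter G \<U> \<gamma> E n) (tau_iter_res \<U> \<gamma> n)"
proof (induction n)
  case 0
  have "weiss_functor G \<U> E" by unfold_locales
  then show ?case using two_morphism_id by (simp add: tau_iter_def)
next
  case (Suc n)
  interpret S: tau_subrep G \<U> "tau_iter G \<U> \<beta> E n" \<beta> \<gamma> by (rule tau_subrep_iter)
  interpret T: tau_functor G \<U> "tau_iter G \<U> \<gamma> E n" \<gamma> by (rule \<gamma>.tau_functor_iter)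
  interpret C: tau_two_cell G \<U> "tau_iter G \<U> \<beta> E n" "tau_iter G \<U> \<gamma> E n" "tau_iter_res \<U> \<gamma> n" \<gamma>
    by unfold_locales (rule Suc)
  show ?case
    unfolding tau_iter_Suc \<gamma>.tau_iter_Suc tau_iter_res.simps
    by (rule two_morphism_comp [OF universe group_axioms S.two_morphism_tau_res C.two_morphism_tau_two])
qed

text \<open>Restriction is compatible with the transition maps of the two telescopes. For the first stage this
  says that restriction maps the unit for \<open>\<beta>\<close> to the unit for \<open>\<gamma>\<close>; the later stages follow by applying
  \<open>\<tau>\<^sub>\<gamma>\<close> and moving \<open>tau_res\<close> past \<open>tau_two\<close>.\<close>

lemma iter_res_step:
  assumes "subgroup H G" "W \<in> Rep \<U> H" "x \<in> topspace (tp (obj (tau_iter G \<U> \<beta> E n) H W))"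
  shows "tau_iter_res \<U> \<gamma> (Suc n) H W (tau_step \<U> \<beta> E n H W x) =
    tau_step \<U> \<gamma> E n H W (tau_iter_res \<U> \<gamma> n H W x)"
  using assms
proof (induction n arbitrary: H W x)
  case 0
  interpret U: weiss_two_cell G \<U> E "tau G \<U> \<gamma> E" "tau_unit \<U> \<gamma> E"
    by (intro weiss_two_cell.intro weiss_two_cell_axioms.intro \<gamma>.weiss_functor_tau \<gamma>.two_morphism_tau_unit)
      unfold_locales
  have "tau_unit \<U> \<gamma> E H W x \<in> topspace (tp (obj (tau G \<U> \<gamma> E) H W))"
    using U.two_mem [OF 0(1,2)] 0(3) by (simp add: tau_iter_def)
  then show ?case
    using \<gamma>.tau_two_id by (simp add: tau_step_def two_cell_comp_def tau_res_tau_unit [OF vcat_subrep [OF subrep]])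
next
  case (Suc n)
  let ?r = "tau_iter_res \<U> \<gamma>"
  interpret S: tau_subrep G \<U> "tau_iter G \<U> \<beta> E n" \<beta> \<gamma> by (rule tau_subrep_iter)
  interpret R: weiss_two_cell G \<U> "tau G \<U> \<beta> (tau_iter G \<U> \<beta> E n)" "tau G \<U> \<gamma> (tau_iter G \<U> \<beta> E n)" "tau_res \<gamma>"
    by (intro weiss_two_cell.intro weiss_two_cell_axioms.intro S.weiss_functor_tau S.\<gamma>.weiss_functor_tau S.two_morphism_tau_res)
  let ?x = "tau_res \<gamma> H W x"
  have x: "?x \<in> topspace (tp (obj (tau G \<U> \<gamma> (tau_iter G \<U> \<beta> E n)) H W))"
    using R.two_mem [OF Suc.prems(1,2)] Suc.prems(3) by (simp only: tau_iter_Suc)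
  have "?r (Suc (Suc n)) H W (tau_step \<U> \<beta> E (Suc n) H W x) =
      tau_two \<U> \<gamma> (?r (Suc n) \<circ>\<^sub>2 tau_step \<U> \<beta> E n) H W ?x"
    unfolding tau_step_Suc tau_iter_res.simps(2) [of \<U> \<gamma> "Suc n"] two_cell_comp_def [of _ "tau_res \<gamma>"]
    by (simp only: tau_res_tau_two [OF vcat_subrep [OF subrep]] tau_two_comp)
  also have "\<dots> = tau_two \<U> \<gamma> (tau_step \<U> \<gamma> E n \<circ>\<^sub>2 ?r n) H W ?x"
    by (rule S.\<gamma>.tau_two_cong [OF x]) (simp only: two_cell_comp_def Suc.IH [OF Suc.prems(1), unfolded two_cell_comp_def])
  also have "\<dots> = tau_step \<U> \<gamma> E (Suc n) H W (?r (Suc n) H W x)"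
    unfolding \<gamma>.tau_step_Suc tau_iter_res.simps(2) two_cell_comp_def [of _ "tau_res \<gamma>"] by (simp only: tau_two_comp)
  finally show ?case .
qed

text \<open>At each stage all restrictions of strings can be moved to the right, where two successive ones
  combine; the rest is the induction hypothesis under \<open>\<tau>\<^sub>\<delta>\<close>.\<close>

lemma iter_res_res:
  assumes s: "subrep G \<delta> \<gamma>" and "subgroup H G" "W \<in> Rep \<U> H" "x \<in> topspace (tp (obj (tau_iter G \<U> \<beta> E n) H W))"
  shows "tau_iter_res \<U> \<delta> n H W (tau_iter_res \<U> \<gamma> n H W x) = tau_iter_res \<U> \<delta> n H W x"
  using assms(2-)
proof (induction n arbitrary: H W x)
  case 0
  then show ?case by simp
next
  case (Suc n)
  interpret D: tau_subrep G \<U> E \<beta> \<delta>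
    by (intro tau_subrep.intro tau_subrep_axioms.intro subrep_trans [OF s subrep]) unfold_locales
  interpret S: tau_subrep G \<U> "tau_iter G \<U> \<beta> E n" \<beta> \<delta> by (rule D.tau_subrep_iter)
  interpret R: weiss_two_cell G \<U> "tau G \<U> \<beta> (tau_iter G \<U> \<beta> E n)" "tau G \<U> \<delta> (tau_iter G \<U> \<beta> E n)" "tau_res \<delta>"
    by (intro weiss_two_cell.intro weiss_two_cell_axioms.intro S.weiss_functor_tau S.\<gamma>.weiss_functor_tau S.two_morphism_tau_res)
  let ?r = "tau_iter_res \<U>" and ?x = "tau_res \<delta> H W x"
  have x: "?x \<in> topspace (tp (obj (tau G \<U> \<delta> (tau_iter G \<U> \<beta> E n)) H W))"
    using R.two_mem [OF Suc.prems(1,2)] Suc.prems(3) by (simp only: tau_iter_Suc)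
  have "?r \<delta> (Suc n) H W (?r \<gamma> (Suc n) H W x) = tau_two \<U> \<delta> (?r \<delta> n \<circ>\<^sub>2 ?r \<gamma> n) H W ?x"
    unfolding tau_iter_res.simps(2) two_cell_comp_def [of _ "tau_res _"]
    by (simp only: tau_res_tau_two [OF vcat_subrep [OF s]] tau_res_comp [OF vcat_subrep [OF s]] tau_two_comp)
  also have "\<dots> = tau_two \<U> \<delta> (?r \<delta> n) H W ?x"
    by (rule S.\<gamma>.tau_two_cong [OF x]) (simp only: two_cell_comp_def Suc.IH [OF Suc.prems(1)])
  also have "\<dots> = ?r \<delta> (Suc n) H W x" by (simp add: two_cell_comp_def)
  finally show ?case .
qed

abbreviation "telescope_res H W \<equiv> tel_map (\<lambda>n. obj (tau_iter G \<U> \<gamma> E n) H W)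
  (\<lambda>n. tau_step \<U> \<gamma> E n H W) (\<lambda>n. tau_iter_res \<U> \<gamma> n H W)"

theorem two_morphism_telescope_res:
  "two_morphism G \<U> (weiss_hocolim \<U> (tau_iter G \<U> \<beta> E) (tau_step \<U> \<beta> E))
     (weiss_hocolim \<U> (tau_iter G \<U> \<gamma> E) (tau_step \<U> \<gamma> E)) telescope_res"
  by (rule two_morphism_hocolim_map(1) [where E = "tau_iter G \<U> \<beta> E" and \<sigma> = "tau_step \<U> \<beta> E" and F = "tau_iter G \<U> \<gamma> E"
      and \<sigma>' = "tau_step \<U> \<gamma> E" and \<rho> = "tau_iter_res \<U> \<gamma>",
      OF weiss_sequence_tau \<gamma>.weiss_sequence_tau two_morphism_iter_res iter_res_step])

lemma telescope_res_quot:
  assumes "subgroup H G" "W \<in> Rep \<U> H" "x \<in> topspace (tp (obj (tau_iter G \<U> \<beta> E n) H W))"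
  shows "telescope_res H W (tel_quot (\<lambda>n. obj (tau_iter G \<U> \<beta> E n) H W) (\<lambda>n. tau_step \<U> \<beta> E n H W) n x r) =
    tel_quot (\<lambda>n. obj (tau_iter G \<U> \<gamma> E n) H W) (\<lambda>n. tau_step \<U> \<gamma> E n H W) n (tau_iter_res \<U> \<gamma> n H W x) r"
  by (rule two_morphism_hocolim_map(2) [where E = "tau_iter G \<U> \<beta> E" and \<sigma> = "tau_step \<U> \<beta> E" and F = "tau_iter G \<U> \<gamma> E"
      and \<sigma>' = "tau_step \<U> \<gamma> E" and \<rho> = "tau_iter_res \<U> \<gamma>",
      OF weiss_sequence_tau \<gamma>.weiss_sequence_tau two_morphism_iter_res iter_res_step assms])

lemma iter_res_mem:
  assumes "subgroup H G" "W \<in> Rep \<U> H" "x \<in> topspace (tp (obj (tau_iter G \<U> \<beta> E n) H W))"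
  shows "tau_iter_res \<U> \<gamma> n H W x \<in> topspace (tp (obj (tau_iter G \<U> \<gamma> E n) H W))"
proof -
  interpret S: tau_functor G \<U> "tau_iter G \<U> \<beta> E n" \<beta> by (rule tau_functor_iter)
  interpret T: tau_functor G \<U> "tau_iter G \<U> \<gamma> E n" \<gamma> by (rule \<gamma>.tau_functor_iter)
  interpret C: weiss_two_cell G \<U> "tau_iter G \<U> \<beta> E n" "tau_iter G \<U> \<gamma> E n" "tau_iter_res \<U> \<gamma> n"
    by unfold_locales (rule two_morphism_iter_res)
  show ?thesis by (rule C.two_mem [OF assms])
qed

end

theorem theorem1:
  fixes G :: "'g monoid"
    and \<U> :: "('g, 'v::real_inner) rep"
    and \<alpha> :: "('g, 'a::real_inner) rep"
    and \<epsilon> :: "('g, 'e::real_inner) rep"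
    and E :: "('g, 'v, ('x, 'v, 'a \<times> 'e) point) weiss"
  assumes "group G" and "finite (carrier G)"
    and "complete_universe G \<U>"
    and "finite_rep G \<alpha>"
    and "finite_rep G \<epsilon>" and "dim (rspace \<epsilon>) = 1"
    and "one_morphism G \<U> E"
  shows "one_morphism G \<U> (taylor G \<U> \<alpha> \<epsilon> E) \<and>
    two_morphism G \<U> E (taylor G \<U> \<alpha> \<epsilon> E) (taylor_unit G \<U> \<alpha> \<epsilon> E) \<and>
    (\<forall>\<alpha>'. subrep G \<alpha>' \<alpha> \<longrightarrow>
       two_morphism G \<U> (taylor G \<U> \<alpha> \<epsilon> E) (taylor G \<U> \<alpha>' \<epsilon> E) (taylor_res G \<U> \<alpha> \<alpha>' \<epsilon> E) \<and>
       two_cell_eq G \<U> E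
         (taylor_unit G \<U> \<alpha>' \<epsilon> E)
         (taylor_res G \<U> \<alpha> \<alpha>' \<epsilon> E \<circ>\<^sub>2 taylor_unit G \<U> \<alpha> \<epsilon> E)) \<and>
    (\<forall>\<alpha>' \<alpha>''. subrep G \<alpha>' \<alpha> \<and> subrep G \<alpha>'' \<alpha>' \<longrightarrow>
       two_cell_eq G \<U> (taylor G \<U> \<alpha> \<epsilon> E)
         (taylor_res G \<U> \<alpha>' \<alpha>'' \<epsilon> E \<circ>\<^sub>2 taylor_res G \<U> \<alpha> \<alpha>' \<epsilon> E)
         (taylor_res G \<U> \<alpha> \<alpha>'' \<epsilon> E))"
proof -
  have tau_fun: "tau_functor G \<U> E (\<alpha>' \<oplus>\<^sub>r \<epsilon>)" if "finite_rep G \<alpha>'" for \<alpha>'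
    using assms finite_rep_sum [OF that assms(5)]
    by (intro tau_functor.intro kan_functor.intro weiss_functor.intro weiss_functor_axioms.intro tau_functor_axioms.intro)
  have \<epsilon>: "orthogonal_rep G \<epsilon>" using assms(5) by (simp add: finite_rep_def)
  have sub: "tau_subrep G \<U> E (\<alpha>' \<oplus>\<^sub>r \<epsilon>) (\<alpha>'' \<oplus>\<^sub>r \<epsilon>)" if "finite_rep G \<alpha>'" "subrep G \<alpha>'' \<alpha>'" for \<alpha>' \<alpha>''
    by (intro tau_subrep.intro tau_subrep_axioms.intro tau_fun that(1) subrep_sum [OF that(2) \<epsilon>])
  interpret T: tau_functor G \<U> E "\<alpha> \<oplus>\<^sub>r \<epsilon>" by (rule tau_fun [OF assms(4)])
  interpret S: weiss_sequence G \<U> "tau_iter G \<U> (\<alpha> \<oplus>\<^sub>r \<epsilon>) E" "tau_step \<U> (\<alpha> \<oplus>\<^sub>r \<epsilon>) E"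
    by (rule T.weiss_sequence_tau)
  have iter_0: "tau_iter G \<U> \<beta> E 0 = E" for \<beta> by (simp add: tau_iter_def)
  have res_unit: "two_cell_eq G \<U> E (taylor_unit G \<U> \<alpha>' \<epsilon> E)
      (taylor_res G \<U> \<alpha> \<alpha>' \<epsilon> E \<circ>\<^sub>2 taylor_unit G \<U> \<alpha> \<epsilon> E)" if s: "subrep G \<alpha>' \<alpha>" for \<alpha>'
  proof -
    interpret R: tau_subrep G \<U> E "\<alpha> \<oplus>\<^sub>r \<epsilon>" "\<alpha>' \<oplus>\<^sub>r \<epsilon>" by (rule sub [OF assms(4) s])
    show ?thesis
      unfolding two_cell_eq_def two_cell_comp_def taylor_unit_def taylor_res_def
      using R.telescope_res_quot [where n = 0] by (simp add: iter_0)
  qed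
  have res_res: "two_cell_eq G \<U> (taylor G \<U> \<alpha> \<epsilon> E)
      (taylor_res G \<U> \<alpha>' \<alpha>'' \<epsilon> E \<circ>\<^sub>2 taylor_res G \<U> \<alpha> \<alpha>' \<epsilon> E) (taylor_res G \<U> \<alpha> \<alpha>'' \<epsilon> E)"
    if s: "subrep G \<alpha>' \<alpha>" "subrep G \<alpha>'' \<alpha>'" for \<alpha>' \<alpha>''
  proof -
    interpret R: tau_subrep G \<U> E "\<alpha> \<oplus>\<^sub>r \<epsilon>" "\<alpha>' \<oplus>\<^sub>r \<epsilon>" by (rule sub [OF assms(4) s(1)])
    interpret R': tau_subrep G \<U> E "\<alpha>' \<oplus>\<^sub>r \<epsilon>" "\<alpha>'' \<oplus>\<^sub>r \<epsilon>"
      by (rule sub [OF subrep_finite [OF assms(4) s(1)] s(2)])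
    interpret R'': tau_subrep G \<U> E "\<alpha> \<oplus>\<^sub>r \<epsilon>" "\<alpha>'' \<oplus>\<^sub>r \<epsilon>"
      by (rule sub [OF assms(4) subrep_trans [OF s(2,1)]])
    have "R'.telescope_res H W (R.telescope_res H W p) = R''.telescope_res H W p"
      if H: "subgroup H G" and W: "W \<in> Rep \<U> H" and p: "p \<in> topspace (tp (obj S.hocolim H W))" for H W p
      using p unfolding S.hocolim_obj
      by (elim telescope_cases)
        (simp add: R.telescope_res_quot [OF H W] R'.telescope_res_quot [OF H W] R''.telescope_res_quot [OF H W]
          R.iter_res_mem [OF H W] R.iter_res_res [OF subrep_sum [OF s(2) \<epsilon>] H W])
    then show ?thesis
      unfolding two_cell_eq_def two_cell_comp_def taylor_def taylor_res_def by blast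
  qed
  have "one_morphism G \<U> (taylor G \<U> \<alpha> \<epsilon> E)"
    unfolding taylor_def by (rule S.one_morphism_hocolim)
  moreover have "two_morphism G \<U> E (taylor G \<U> \<alpha> \<epsilon> E) (taylor_unit G \<U> \<alpha> \<epsilon> E)"
    using S.two_morphism_hocolim_incl unfolding taylor_def taylor_unit_def iter_0 .
  moreover have "two_morphism G \<U> (taylor G \<U> \<alpha> \<epsilon> E) (taylor G \<U> \<alpha>' \<epsilon> E) (taylor_res G \<U> \<alpha> \<alpha>' \<epsilon> E)"
    if "subrep G \<alpha>' \<alpha>" for \<alpha>'
    unfolding taylor_def taylor_res_def
    by (rule tau_subrep.two_morphism_telescope_res [OF sub [OF assms(4) that]])
  ultimately show ?thesis using res_unit res_res by blast
qed

end
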